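(* Let $\mathcal{X}$ be a dispace and $\mathcal{A}$ a directed subspace of $\mathcal{X}$. There is an exact sequence in the category of natural systems of actions on $\overrightarrow{\mathbf{P}}(\mathcal{A})$: $$\cdots\to\overrightarrow{P}_n(\mathcal{A})\to\overrightarrow{P}_n(\mathcal{X})\to\overrightarrow{P}_n(\mathcal{X},\mathcal{A})\xrightarrow{\partial_n}\overrightarrow{P}_{n-1}(\mathcal{A})\to\cdots$$ $$\cdots\to\overrightarrow{P}_2(\mathcal{A})\xrightarrow{v}\overrightarrow{P}_2(\mathcal{X})\xrightarrow{f}\big(\overrightarrow{P}_2(\mathcal{X},\mathcal{A}),\overrightarrow{P}_2(\mathcal{X})\big)\xrightarrow{g}\overrightarrow{P}_1(\mathcal{A})\xrightarrow{h}\overrightarrow{P}_1(\mathcal{X})\to\overrightarrow{P}_1(\mathcal{X},\mathcal{A})\to 0.$$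
   Context: Dispaces. A dispace is a pair $\mathcal{X}=(X,dX)$ with $X$ a topological space and $dX$ a set of continuous paths $[0,1]\to X$ (dipaths) containing all constant paths, closed under monotonic reparametrization (precomposition with non-decreasing continuous maps $[0,1]\to[0,1]$) and under concatenation $\star$. A directed subspace of $\mathcal{X}$ is a dispace $\mathcal{A}=(A,dA)$ with $A\subseteq X$ a subspace and $dA\subseteq dX$. Traces. The trace space $\overrightarrow{\mathfrak{T}}(\mathcal{X})(x,y)$ is the space of dipaths from $x$ to $y$ (compact-open topology) modulo the equivalence relation generated by $f\sim f\circ\varphi$, $\varphi:[0,1]\to[0,1]$ a non-decreasing continuous surjection, with the quotient topology; for $x,y\in A$, $\overrightarrow{\mathfrak{T}}(\mathcal{A})(x,y)$ is regarded as a subspace of $\overrightarrow{\mathfrak{T}}(\mathcal{X})(x,y)$. The trace category $\overrightarrow{\mathbf{P}}(\mathcal{X})$ has objects the points of $X$, morphisms the traces, composition the concatenation. Natural systems. The category of factorizations $F\mathcal{C}$ of a category $\mathcal{C}$ has as objects the morphisms of $\mathcal{C}$, and as morphisms $f\to f'$ the pairs $(u,v)$ with $ufv=f'$ (diagrammatic order). A natural system on $\mathcal{C}$ with values in $\mathbf{V}$ is a functor $F\mathcal{C}\to\mathbf{V}$; morphisms are natural transformations. The category $\mathbf{Act}$ of actions. Objects are pairs $(S,G)$ with $S$ a set pointed at $0_S$ and $G$ a group acting on $S$ on the right (the base point need not be fixed). Morphisms $(S,G)\to(T,H)$ are pairs $(a',a'')$ with $a'$ a pointed map and $a''$ a group homomorphism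 such that $a'(s\cdot g)=a'(s)\cdot a''(g)$. A morphism is null if $a'$ is constant at $0_T$. Kernels and cokernels are taken with respect to null morphisms: $\ker(a)$ is the inclusion of $(a'^{-1}(0_T),a''^{-1}(H_0))$ with $H_0=\{h: 0_T\cdot h=0_T\}$; $\mathrm{cok}(a)$ is the projection $(T,H)\to(T/R,H)$ with $R$ the $H$-invariant equivalence relation generated by identifying all elements of $a'(S)$. A sequence $\xrightarrow{a}\bullet\xrightarrow{b}$ is exact at $\bullet$ if $\ker(\mathrm{cok}\,a)=\ker b$ (as subobjects). Pointed sets embed in $\mathbf{Act}$ by $S\mapsto(S,\{1\})$, and groups by $G\mapsto(|G|,G)$ (right translation action, pointed at $1$); $0$ denotes the action on a one-point set. A sequence of natural systems of actions is exact when it is exact in $\mathbf{Act}$ at each object of the factorization category. Relative homotopy. For a pointed pair $(Z,B,z)$ and $m\geq 1$, let $I^{m-1}=\{x_m=0\}\subset I^m=[0,1]^m$ and $J^m$ the closure of $\partial I^m\setminus I^{m-1}$; $\pi_m(Z,B)$ is the set of homotopy classes of maps $(I^m,\partial I^m,J^m)\to(Z,B,z)$. It is a pointed set for $m=1$ (paths starting in $B$ and ending at $z$), on which $\pi_1(Z,z)$ acts on the right by concatenation, and a group for $m\geq 2$. $\pi_0(Z,B)$ is defined as the cokernel of $\pi_0(B)\to\pi_0(Z)$. Natural homotopy systems on $\overrightarrow{\mathbf{P}}(\mathcal{A})$. For a trace $e:x\to y$ of $\mathcal{A}$ and $n\geq1$, $\overrightarrow{P}_n(\mathcal{A})_e=\pi_{n-1}(\overrightarrow{\mathfrak{T}}(\mathcal{A})(x,y),e)$,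 $\overrightarrow{P}_n(\mathcal{X})_e=\pi_{n-1}(\overrightarrow{\mathfrak{T}}(\mathcal{X})(x,y),e)$ (restricted to traces of $\mathcal{A}$), and $\overrightarrow{P}_n(\mathcal{X},\mathcal{A})_e=\pi_{n-1}(\overrightarrow{\mathfrak{T}}(\mathcal{X})(x,y),\overrightarrow{\mathfrak{T}}(\mathcal{A})(x,y))$ based at $e$; a factorization $(u,v)$ acts by $u\star-\star v$. All are viewed in $\mathbf{Act}$ by the embeddings above, except that at $n=2$ the relative term is the action $(\overrightarrow{P}_2(\mathcal{X},\mathcal{A}),\overrightarrow{P}_2(\mathcal{X}))$ of the group $\overrightarrow{P}_2(\mathcal{X})$ on the pointed set $\overrightarrow{P}_2(\mathcal{X},\mathcal{A})$ by concatenation. Maps. All maps are induced by inclusions, except: $\partial_n$ is restriction to the distinguished face; $f$ sends $\sigma$ to $(0\cdot\sigma,\sigma)$, with $0$ the base point of $\overrightarrow{P}_2(\mathcal{X},\mathcal{A})_e$; $g$ sends the class of a path $\tau$ to the path component of $\tau(0)$; and the last non-trivial map is the cokernel projection of $h$. *)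

theory Defs
  imports "HOL-Analysis.Analysis" "HOL-Algebra.Elementary_Groups"
begin

section \<open>Categories, functors, factorizations\<close>

text \<open>Composition is written in diagrammatic order throughout: \<open>Comp C f g\<close> is
  \<open>f\<close> followed by \<open>g\<close>.\<close>

record ('o, 'm) category =
  Obj :: "'o set"
  Arr :: "'m set"
  Dom :: "'m \<Rightarrow> 'o"
  Cod :: "'m \<Rightarrow> 'o"
  Id :: "'o \<Rightarrow> 'm"
  Comp :: "'m \<Rightarrow> 'm \<Rightarrow> 'm"

definition is_category :: "('o, 'm) category \<Rightarrow> bool" where
  "is_category C \<longleftrightarrow>
     (\<forall>f\<in>Arr C. Dom C f \<in> Obj C \<and> Cod C f \<in> Obj C) \<and>
     (\<forall>x\<in>Obj C. Id C x \<in> Arr C \<and> Dom C (Id C x) = x \<and> Cod C (Id C x) = x) \<and>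
     (\<forall>f\<in>Arr C. \<forall>g\<in>Arr C. Cod C f = Dom C g \<longrightarrow>
        Comp C f g \<in> Arr C \<and> Dom C (Comp C f g) = Dom C f \<and> Cod C (Comp C f g) = Cod C g) \<and>
     (\<forall>f\<in>Arr C. Comp C (Id C (Dom C f)) f = f \<and> Comp C f (Id C (Cod C f)) = f) \<and>
     (\<forall>f\<in>Arr C. \<forall>g\<in>Arr C. \<forall>h\<in>Arr C. Cod C f = Dom C g \<longrightarrow> Cod C g = Dom C h \<longrightarrow>
        Comp C (Comp C f g) h = Comp C f (Comp C g h))"

record ('o, 'm, 'p, 'n) cfunctor =
  onobj :: "'o \<Rightarrow> 'p"
  onarr :: "'m \<Rightarrow> 'n"

definition is_functor ::
  "('o, 'm) category \<Rightarrow> ('p, 'n) category \<Rightarrow> ('o, 'm, 'p, 'n) cfunctor \<Rightarrow> bool" where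
  "is_functor C D F \<longleftrightarrow> is_category C \<and> is_category D \<and>
     (\<forall>x\<in>Obj C. onobj F x \<in> Obj D) \<and>
     (\<forall>f\<in>Arr C. onarr F f \<in> Arr D \<and>
        Dom D (onarr F f) = onobj F (Dom C f) \<and> Cod D (onarr F f) = onobj F (Cod C f)) \<and>
     (\<forall>x\<in>Obj C. onarr F (Id C x) = Id D (onobj F x)) \<and>
     (\<forall>f\<in>Arr C. \<forall>g\<in>Arr C. Cod C f = Dom C g \<longrightarrow>
        onarr F (Comp C f g) = Comp D (onarr F f) (onarr F g))"

text \<open>The triple \<open>(u, f, v)\<close> is the factorization \<open>(u, v)\<close> regarded as a morphism
  from \<open>f\<close> to \<open>u f v\<close>.\<close>

definition factorization_category ::
  "('o, 'm) category \<Rightarrow> ('m, 'm \<times> 'm \<times> 'm) category" where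
  "factorization_category C =
     \<lparr>Obj = Arr C,
      Arr = {(u, f, v). u \<in> Arr C \<and> f \<in> Arr C \<and> v \<in> Arr C \<and>
                        Cod C u = Dom C f \<and> Cod C f = Dom C v},
      Dom = (\<lambda>(u, f, v). f),
      Cod = (\<lambda>(u, f, v). Comp C u (Comp C f v)),
      Id = (\<lambda>f. (Id C (Dom C f), f, Id C (Cod C f))),
      Comp = (\<lambda>(u, f, v) (u', f', v'). (Comp C u' u, f, Comp C v v'))\<rparr>"


section \<open>The category of actions\<close>

record ('s, 'g) action =
  pset :: "'s set"
  bpt :: 's
  grp :: "'g monoid"
  ract :: "'s \<Rightarrow> 'g \<Rightarrow> 's"

definition is_action :: "('s, 'g) action \<Rightarrow> bool" where
  "is_action S \<longleftrightarrow> bpt S \<in> pset S \<and> group (grp S) \<and>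
     (\<forall>s\<in>pset S. \<forall>g\<in>carrier (grp S). ract S s g \<in> pset S) \<and>
     (\<forall>s\<in>pset S. ract S s \<one>\<^bsub>grp S\<^esub> = s) \<and>
     (\<forall>s\<in>pset S. \<forall>g\<in>carrier (grp S). \<forall>h\<in>carrier (grp S).
        ract S s (g \<otimes>\<^bsub>grp S\<^esub> h) = ract S (ract S s g) h)"

text \<open>The two components of a morphism are extensional, so that equality of morphisms is
  equality in HOL. Source and target may be carried by different types.\<close>

record ('s, 'g, 't, 'h) action_mor =
  src :: "('s, 'g) action"
  tgt :: "('t, 'h) action"
  smap :: "'s \<Rightarrow> 't"
  gmap :: "'g \<Rightarrow> 'h"

definition is_action_mor :: "('s, 'g, 't, 'h) action_mor \<Rightarrow> bool" where
  "is_action_mor a \<longleftrightarrow> is_action (src a) \<and> is_action (tgt a) \<and>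
     smap a \<in> pset (src a) \<rightarrow>\<^sub>E pset (tgt a) \<and>
     smap a (bpt (src a)) = bpt (tgt a) \<and>
     gmap a \<in> hom (grp (src a)) (grp (tgt a)) \<and>
     gmap a \<in> extensional (carrier (grp (src a))) \<and>
     (\<forall>s\<in>pset (src a). \<forall>g\<in>carrier (grp (src a)).
        smap a (ract (src a) s g) = ract (tgt a) (smap a s) (gmap a g))"

definition mk_action_mor ::
  "('s, 'g) action \<Rightarrow> ('t, 'h) action \<Rightarrow> ('s \<Rightarrow> 't) \<Rightarrow> ('g \<Rightarrow> 'h) \<Rightarrow> ('s, 'g, 't, 'h) action_mor" where
  "mk_action_mor S T a' a'' =
     \<lparr>src = S, tgt = T, smap = restrict a' (pset S), gmap = restrict a'' (carrier (grp S))\<rparr>"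

definition action_id :: "('s, 'g) action \<Rightarrow> ('s, 'g, 's, 'g) action_mor" where
  "action_id S = mk_action_mor S S id id"

definition action_comp ::
  "('s, 'g, 't, 'h) action_mor \<Rightarrow> ('t, 'h, 'u, 'k) action_mor \<Rightarrow> ('s, 'g, 'u, 'k) action_mor" where
  "action_comp a b = mk_action_mor (src a) (tgt b) (smap b \<circ> smap a) (gmap b \<circ> gmap a)"

definition Act :: "(('s, 'g) action, ('s, 'g, 's, 'g) action_mor) category" where
  "Act = \<lparr>Obj = {S. is_action S}, Arr = {a. is_action_mor a}, Dom = src, Cod = tgt,
          Id = action_id, Comp = action_comp\<rparr>"

definition kernel :: "('s, 'g, 't, 'h) action_mor \<Rightarrow> ('s, 'g, 's, 'g) action_mor" where
  "kernel a =
     mk_action_mor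
       ((src a)\<lparr>pset := {s \<in> pset (src a). smap a s = bpt (tgt a)},
                grp := (grp (src a))\<lparr>carrier := {g \<in> carrier (grp (src a)).
                          ract (tgt a) (bpt (tgt a)) (gmap a g) = bpt (tgt a)}\<rparr>\<rparr>)
       (src a) id id"

text \<open>The least invariant equivalence relation on the pointed set of \<open>T\<close> that identifies all
  elements of \<open>P\<close>.\<close>

definition invariant_equiv_generated :: "('t, 'h) action \<Rightarrow> 't set \<Rightarrow> ('t \<times> 't) set" where
  "invariant_equiv_generated T P =
     \<Inter>{R. equiv (pset T) R \<and>
         (\<forall>(s, t)\<in>R. \<forall>h\<in>carrier (grp T). (ract T s h, ract T t h) \<in> R) \<and>
         P \<times> P \<subseteq> R}"

definition quotient_action :: "('t, 'h) action \<Rightarrow> ('t \<times> 't) set \<Rightarrow> ('t set, 'h) action" where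
  "quotient_action T R =
     \<lparr>pset = pset T // R, bpt = R `` {bpt T}, grp = grp T,
      ract = (\<lambda>c h. \<Union>t\<in>c. R `` {ract T t h})\<rparr>"

definition cokernel :: "('s, 'g, 't, 'h) action_mor \<Rightarrow> ('t, 'h, 't set, 'h) action_mor" where
  "cokernel a =
     (let R = invariant_equiv_generated (tgt a) (smap a ` pset (src a))
      in mk_action_mor (tgt a) (quotient_action (tgt a) R) (\<lambda>t. R `` {t}) id)"

definition is_action_iso :: "('s, 'g, 't, 'h) action_mor \<Rightarrow> bool" where
  "is_action_iso p \<longleftrightarrow> is_action_mor p \<and>
     (\<exists>q. is_action_mor q \<and> src q = tgt p \<and> tgt q = src p \<and>
          action_comp p q = action_id (src p) \<and> action_comp q p = action_id (tgt p))"

definition same_subobject ::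
  "('s, 'g, 'u, 'k) action_mor \<Rightarrow> ('t, 'h, 'u, 'k) action_mor \<Rightarrow> bool" where
  "same_subobject i j \<longleftrightarrow> tgt i = tgt j \<and>
     (\<exists>p. is_action_iso p \<and> src p = src i \<and> tgt p = src j \<and> action_comp p j = i)"

definition action_exact ::
  "('s, 'g, 't, 'h) action_mor \<Rightarrow> ('t, 'h, 'u, 'k) action_mor \<Rightarrow> bool" where
  "action_exact a b \<longleftrightarrow> is_action_mor a \<and> is_action_mor b \<and> tgt a = src b \<and>
     same_subobject (kernel (cokernel a)) (kernel b)"

text \<open>The embedding of pointed sets; the trivial group is carried by the base point.\<close>

definition pset_action :: "'s set \<Rightarrow> 's \<Rightarrow> ('s, 's) action" where
  "pset_action S z = \<lparr>pset = S, bpt = z, grp = singleton_group z, ract = (\<lambda>s _. s)\<rparr>"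

definition group_action_of :: "'g monoid \<Rightarrow> ('g, 'g) action" where
  "group_action_of G = \<lparr>pset = carrier G, bpt = \<one>\<^bsub>G\<^esub>, grp = G, ract = mult G\<rparr>"

definition zero_action :: "(unit, unit) action" where
  "zero_action = pset_action {()} ()"


section \<open>Natural systems of actions\<close>

type_synonym ('m, 's, 'g) natural_system =
  "('m, 'm \<times> 'm \<times> 'm, ('s, 'g) action, ('s, 'g, 's, 'g) action_mor) cfunctor"

definition is_natural_system :: "('o, 'm) category \<Rightarrow> ('m, 's, 'g) natural_system \<Rightarrow> bool" where
  "is_natural_system C N \<longleftrightarrow> is_category C \<and> is_functor (factorization_category C) Act N"

definition is_natural_transformation ::
  "('o, 'm) category \<Rightarrow> ('m, 's, 'g) natural_system \<Rightarrow> ('m, 't, 'h) natural_system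
     \<Rightarrow> ('m \<Rightarrow> ('s, 'g, 't, 'h) action_mor) \<Rightarrow> bool" where
  "is_natural_transformation C M N \<alpha> \<longleftrightarrow>
     is_natural_system C M \<and> is_natural_system C N \<and>
     (\<forall>e\<in>Obj (factorization_category C).
        is_action_mor (\<alpha> e) \<and> src (\<alpha> e) = onobj M e \<and> tgt (\<alpha> e) = onobj N e) \<and>
     (\<forall>k\<in>Arr (factorization_category C).
        action_comp (onarr M k) (\<alpha> (Cod (factorization_category C) k)) =
        action_comp (\<alpha> (Dom (factorization_category C) k)) (onarr N k))"

text \<open>\<open>L \<rightarrow> M \<rightarrow> N\<close> is a sequence of natural systems of actions that is exact at \<open>M\<close>.\<close>

definition exact_sequence_at ::
  "('o, 'm) category \<Rightarrow> ('m, 's, 'g) natural_system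
     \<Rightarrow> ('m \<Rightarrow> ('s, 'g, 't, 'h) action_mor) \<Rightarrow> ('m, 't, 'h) natural_system
     \<Rightarrow> ('m \<Rightarrow> ('t, 'h, 'u, 'k) action_mor) \<Rightarrow> ('m, 'u, 'k) natural_system \<Rightarrow> bool" where
  "exact_sequence_at C L \<alpha> M \<beta> N \<longleftrightarrow>
     is_natural_transformation C L M \<alpha> \<and> is_natural_transformation C M N \<beta> \<and>
     (\<forall>e\<in>Obj (factorization_category C). action_exact (\<alpha> e) (\<beta> e))"

definition zero_natural_system :: "('m, unit, unit) natural_system" where
  "zero_natural_system = \<lparr>onobj = (\<lambda>_. zero_action), onarr = (\<lambda>_. action_id zero_action)\<rparr>"

definition to_zero ::
  "('m, 's, 'g) natural_system \<Rightarrow> 'm \<Rightarrow> ('s, 'g, unit, unit) action_mor" where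
  "to_zero N e = mk_action_mor (onobj N e) zero_action (\<lambda>_. ()) (\<lambda>_. ())"


section \<open>Function spaces and quotient topologies\<close>

definition compact_open_topology :: "'a topology \<Rightarrow> 'b topology \<Rightarrow> ('a \<Rightarrow> 'b) topology" where
  "compact_open_topology X Y =
     topology_generated_by
       {{f \<in> extensional (topspace X). continuous_map X Y f \<and> f ` K \<subseteq> U} | K U.
          compactin X K \<and> openin Y U}"

definition quotient_topology :: "'a topology \<Rightarrow> ('a \<Rightarrow> 'b) \<Rightarrow> 'b topology" where
  "quotient_topology X q =
     topology (\<lambda>U. U \<subseteq> q ` topspace X \<and> openin X {x \<in> topspace X. q x \<in> U})"

lemma openin_quotient_topology:
  "openin (quotient_topology X q) U \<longleftrightarrow>
     U \<subseteq> q ` topspace X \<and> openin X {x \<in> topspace X. q x \<in> U}"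
proof -
  have "istopology (\<lambda>U. U \<subseteq> q ` topspace X \<and> openin X {x \<in> topspace X. q x \<in> U})"
    unfolding istopology_def
  proof (intro conjI allI impI)
    fix S T
    assume S: "S \<subseteq> q ` topspace X \<and> openin X {x \<in> topspace X. q x \<in> S}"
      and T: "T \<subseteq> q ` topspace X \<and> openin X {x \<in> topspace X. q x \<in> T}"
    have "{x \<in> topspace X. q x \<in> S \<inter> T} = {x \<in> topspace X. q x \<in> S} \<inter> {x \<in> topspace X. q x \<in> T}"
      by blast
    then show "openin X {x \<in> topspace X. q x \<in> S \<inter> T}"
      using S T by auto
    show "S \<inter> T \<subseteq> q ` topspace X"
      using S by blast
  next
    fix \<K>
    assume K: "\<forall>S\<in>\<K>. S \<subseteq> q ` topspace X \<and> openin X {x \<in> topspace X. q x \<in> S}"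
    have "{x \<in> topspace X. q x \<in> \<Union>\<K>} = (\<Union>S\<in>\<K>. {x \<in> topspace X. q x \<in> S})"
      by blast
    then show "openin X {x \<in> topspace X. q x \<in> \<Union>\<K>}"
      using K by auto
    show "\<Union>\<K> \<subseteq> q ` topspace X"
      using K by blast
  qed
  then show ?thesis
    unfolding quotient_topology_def by (simp add: topology_inverse')
qed

lemma topspace_quotient_topology: "topspace (quotient_topology X q) = q ` topspace X"
proof -
  have "{x \<in> topspace X. q x \<in> q ` topspace X} = topspace X"
    by blast
  then have "openin (quotient_topology X q) (q ` topspace X)"
    by (simp add: openin_quotient_topology)
  then show ?thesis
    by (meson openin_quotient_topology openin_subset openin_topspace subset_antisym)
qed

lemma quotient_map_quotient_topology: "quotient_map X (quotient_topology X q) q"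
  by (simp add: quotient_map_def topspace_quotient_topology openin_quotient_topology)


section \<open>Dispaces and traces\<close>

record 'a dispace =
  dspace :: "'a topology"
  dipaths :: "(real \<Rightarrow> 'a) set"

text \<open>The library's path concatenation requires a topological type class, hence the variant for
  abstract topologies. Paths are extensional outside the unit interval.\<close>

definition path_concat :: "(real \<Rightarrow> 'a) \<Rightarrow> (real \<Rightarrow> 'a) \<Rightarrow> real \<Rightarrow> 'a" where
  "path_concat f g = (\<lambda>t\<in>{0..1}. if t \<le> 1/2 then f (2 * t) else g (2 * t - 1))"

definition path_reparam :: "(real \<Rightarrow> 'a) \<Rightarrow> (real \<Rightarrow> real) \<Rightarrow> real \<Rightarrow> 'a" where
  "path_reparam f \<phi> = (\<lambda>t\<in>{0..1}. f (\<phi> t))"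

definition is_dispace :: "'a dispace \<Rightarrow> bool" where
  "is_dispace X \<longleftrightarrow>
     (\<forall>f\<in>dipaths X. f \<in> extensional {0..1} \<and> pathin (dspace X) f) \<and>
     (\<forall>x\<in>topspace (dspace X). (\<lambda>t\<in>{0..1}. x) \<in> dipaths X) \<and>
     (\<forall>f\<in>dipaths X. \<forall>\<phi>. continuous_on {0..1} \<phi> \<and> mono_on {0..1} \<phi> \<and> \<phi> ` {0..1} \<subseteq> {0..1} \<longrightarrow>
        path_reparam f \<phi> \<in> dipaths X) \<and>
     (\<forall>f\<in>dipaths X. \<forall>g\<in>dipaths X. f 1 = g 0 \<longrightarrow> path_concat f g \<in> dipaths X)"

definition directed_subspace :: "'a dispace \<Rightarrow> 'a dispace \<Rightarrow> bool" where
  "directed_subspace A X \<longleftrightarrow> is_dispace A \<and>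
     topspace (dspace A) \<subseteq> topspace (dspace X) \<and>
     dspace A = subtopology (dspace X) (topspace (dspace A)) \<and>
     dipaths A \<subseteq> dipaths X"

definition dipath_space :: "'a dispace \<Rightarrow> 'a \<Rightarrow> 'a \<Rightarrow> (real \<Rightarrow> 'a) topology" where
  "dipath_space X x y =
     subtopology (compact_open_topology (top_of_set {0..1}) (dspace X))
       {f \<in> dipaths X. f 0 = x \<and> f 1 = y}"

definition reparam_step :: "'a dispace \<Rightarrow> ((real \<Rightarrow> 'a) \<times> (real \<Rightarrow> 'a)) set" where
  "reparam_step X =
     {(f, path_reparam f \<phi>) | f \<phi>. f \<in> dipaths X \<and>
        continuous_on {0..1} \<phi> \<and> mono_on {0..1} \<phi> \<and> \<phi> ` {0..1} = {0..1}}"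

definition trace_of :: "'a dispace \<Rightarrow> (real \<Rightarrow> 'a) \<Rightarrow> (real \<Rightarrow> 'a) set" where
  "trace_of X f = {g. (f, g) \<in> (reparam_step X \<union> (reparam_step X)\<inverse>)\<^sup>*}"

definition trace_space :: "'a dispace \<Rightarrow> 'a \<Rightarrow> 'a \<Rightarrow> (real \<Rightarrow> 'a) set topology" where
  "trace_space X x y = quotient_topology (dipath_space X x y) (trace_of X)"

definition trace_source :: "(real \<Rightarrow> 'a) set \<Rightarrow> 'a" where
  "trace_source \<sigma> = (THE x. \<forall>f\<in>\<sigma>. f 0 = x)"

definition trace_target :: "(real \<Rightarrow> 'a) set \<Rightarrow> 'a" where
  "trace_target \<sigma> = (THE y. \<forall>f\<in>\<sigma>. f 1 = y)"

definition trace_concat ::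
  "'a dispace \<Rightarrow> (real \<Rightarrow> 'a) set \<Rightarrow> (real \<Rightarrow> 'a) set \<Rightarrow> (real \<Rightarrow> 'a) set" where
  "trace_concat X \<sigma> \<tau> = (\<Union>f\<in>\<sigma>. \<Union>g\<in>\<tau>. trace_of X (path_concat f g))"

definition trace_category :: "'a dispace \<Rightarrow> ('a, (real \<Rightarrow> 'a) set) category" where
  "trace_category X =
     \<lparr>Obj = topspace (dspace X),
      Arr = (\<Union>x\<in>topspace (dspace X). \<Union>y\<in>topspace (dspace X). topspace (trace_space X x y)),
      Dom = trace_source, Cod = trace_target,
      Id = (\<lambda>x. trace_of X (\<lambda>t\<in>{0..1}. x)),
      Comp = trace_concat X\<rparr>"

text \<open>The inclusion of the traces of a directed subspace into the traces of \<open>X\<close>: a trace \<open>\<sigma>\<close> of the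
  subspace is sent to the trace in \<open>X\<close> of any of its representatives.\<close>

definition trace_incl :: "'a dispace \<Rightarrow> (real \<Rightarrow> 'a) set \<Rightarrow> (real \<Rightarrow> 'a) set" where
  "trace_incl X \<sigma> = (\<Union>f\<in>\<sigma>. trace_of X f)"


section \<open>Homotopy groups and relative homotopy groups\<close>

text \<open>Coordinates are numbered from \<open>0\<close>, so the last coordinate of the \<open>m\<close>-cube has index
  \<open>m - 1\<close>. The \<open>0\<close>-cube is a single point with empty boundary.\<close>

definition cube :: "nat \<Rightarrow> (nat \<Rightarrow> real) topology" where
  "cube m = product_topology (\<lambda>_. top_of_set {0..1}) {..<m}"

definition cube_boundary :: "nat \<Rightarrow> (nat \<Rightarrow> real) set" where
  "cube_boundary m = {x \<in> topspace (cube m). \<exists>i<m. x i = 0 \<or> x i = 1}"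

definition cube_face :: "nat \<Rightarrow> (nat \<Rightarrow> real) set" where
  "cube_face m = {x \<in> topspace (cube m). x (m - 1) = 0}"

definition cube_J :: "nat \<Rightarrow> (nat \<Rightarrow> real) set" where
  "cube_J m = (cube m) closure_of (cube_boundary m - cube_face m)"

definition cube_maps ::
  "nat \<Rightarrow> 'z topology \<Rightarrow> (((nat \<Rightarrow> real) \<Rightarrow> 'z) \<Rightarrow> bool) \<Rightarrow> ((nat \<Rightarrow> real) \<Rightarrow> 'z) set" where
  "cube_maps m Z P = {f \<in> extensional (topspace (cube m)). continuous_map (cube m) Z f \<and> P f}"

definition cube_class ::
  "nat \<Rightarrow> 'z topology \<Rightarrow> (((nat \<Rightarrow> real) \<Rightarrow> 'z) \<Rightarrow> bool)
     \<Rightarrow> ((nat \<Rightarrow> real) \<Rightarrow> 'z) \<Rightarrow> ((nat \<Rightarrow> real) \<Rightarrow> 'z) set" where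
  "cube_class m Z P f = {g \<in> cube_maps m Z P. homotopic_with P (cube m) Z f g}"

definition abs_cond :: "nat \<Rightarrow> 'z \<Rightarrow> ((nat \<Rightarrow> real) \<Rightarrow> 'z) \<Rightarrow> bool" where
  "abs_cond m z f \<longleftrightarrow> f ` cube_boundary m \<subseteq> {z}"

definition rel_cond :: "nat \<Rightarrow> 'z set \<Rightarrow> 'z \<Rightarrow> ((nat \<Rightarrow> real) \<Rightarrow> 'z) \<Rightarrow> bool" where
  "rel_cond m B z f \<longleftrightarrow> f ` cube_boundary m \<subseteq> B \<and> f ` cube_J m \<subseteq> {z}"

definition const_cube :: "nat \<Rightarrow> 'z \<Rightarrow> (nat \<Rightarrow> real) \<Rightarrow> 'z" where
  "const_cube m z = (\<lambda>x\<in>topspace (cube m). z)"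

text \<open>Concatenation is in the first coordinate. For \<open>m = 1\<close> this is concatenation of paths; for
  \<open>m \<ge> 2\<close> it differs from the coordinate defining the distinguished face.\<close>

definition cube_concat ::
  "nat \<Rightarrow> ((nat \<Rightarrow> real) \<Rightarrow> 'z) \<Rightarrow> ((nat \<Rightarrow> real) \<Rightarrow> 'z) \<Rightarrow> (nat \<Rightarrow> real) \<Rightarrow> 'z" where
  "cube_concat m f g =
     (\<lambda>x\<in>topspace (cube m).
        if x 0 \<le> 1/2 then f (x(0 := 2 * x 0)) else g (x(0 := 2 * x 0 - 1)))"

definition class_concat ::
  "nat \<Rightarrow> 'z topology \<Rightarrow> (((nat \<Rightarrow> real) \<Rightarrow> 'z) \<Rightarrow> bool) \<Rightarrow> ((nat \<Rightarrow> real) \<Rightarrow> 'z) set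
     \<Rightarrow> ((nat \<Rightarrow> real) \<Rightarrow> 'z) set \<Rightarrow> ((nat \<Rightarrow> real) \<Rightarrow> 'z) set" where
  "class_concat m Z P a b = (\<Union>f\<in>a. \<Union>g\<in>b. cube_class m Z P (cube_concat m f g))"

text \<open>The map of homotopy classes induced by a map \<open>\<phi>\<close> into \<open>Z\<close>; \<open>P\<close> is the condition
  on cubes in \<open>Z\<close>.\<close>

definition class_map ::
  "nat \<Rightarrow> 'z topology \<Rightarrow> (((nat \<Rightarrow> real) \<Rightarrow> 'z) \<Rightarrow> bool) \<Rightarrow> ('y \<Rightarrow> 'z)
     \<Rightarrow> ((nat \<Rightarrow> real) \<Rightarrow> 'y) set \<Rightarrow> ((nat \<Rightarrow> real) \<Rightarrow> 'z) set" where
  "class_map m Z P \<phi> a = (\<Union>f\<in>a. cube_class m Z P (\<lambda>x\<in>topspace (cube m). \<phi> (f x)))"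

definition class_restrict_face ::
  "nat \<Rightarrow> 'z topology \<Rightarrow> (((nat \<Rightarrow> real) \<Rightarrow> 'z) \<Rightarrow> bool)
     \<Rightarrow> ((nat \<Rightarrow> real) \<Rightarrow> 'z) set \<Rightarrow> ((nat \<Rightarrow> real) \<Rightarrow> 'z) set" where
  "class_restrict_face m Z P a =
     (\<Union>f\<in>a. cube_class (m - 1) Z P (\<lambda>x\<in>topspace (cube (m - 1)). f (x(m - 1 := 0))))"

definition homotopy_set ::
  "nat \<Rightarrow> 'z topology \<Rightarrow> (((nat \<Rightarrow> real) \<Rightarrow> 'z) \<Rightarrow> bool) \<Rightarrow> ((nat \<Rightarrow> real) \<Rightarrow> 'z) set set" where
  "homotopy_set m Z P = cube_class m Z P ` cube_maps m Z P"

definition homotopy_group ::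
  "nat \<Rightarrow> 'z topology \<Rightarrow> (((nat \<Rightarrow> real) \<Rightarrow> 'z) \<Rightarrow> bool) \<Rightarrow> 'z \<Rightarrow> ((nat \<Rightarrow> real) \<Rightarrow> 'z) set monoid" where
  "homotopy_group m Z P z =
     \<lparr>carrier = homotopy_set m Z P, mult = class_concat m Z P,
      one = cube_class m Z P (const_cube m z)\<rparr>"

type_synonym 'z cubes = "((nat \<Rightarrow> real) \<Rightarrow> 'z) set"

text \<open>The homotopy group of degree \<open>m \<ge> 1\<close>, and for \<open>m = 0\<close> the pointed set of path components, as
  an action.\<close>

definition homotopy_action :: "nat \<Rightarrow> 'z topology \<Rightarrow> 'z \<Rightarrow> ('z cubes, 'z cubes) action" where
  "homotopy_action m Z z =
     (if m = 0
      then pset_action (homotopy_set 0 Z (abs_cond 0 z)) (cube_class 0 Z (abs_cond 0 z) (const_cube 0 z))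
      else group_action_of (homotopy_group m Z (abs_cond m z) z))"

text \<open>Relative homotopy in degree \<open>m \<ge> 1\<close>: the fundamental group of \<open>(Z, z)\<close> acting on the pointed set
  of degree 1 by concatenation, and the relative homotopy group in higher degrees.\<close>

definition rel_homotopy_action ::
  "nat \<Rightarrow> 'z topology \<Rightarrow> 'z set \<Rightarrow> 'z \<Rightarrow> ('z cubes, 'z cubes) action" where
  "rel_homotopy_action m Z B z =
     (if m = 1
      then \<lparr>pset = homotopy_set 1 Z (rel_cond 1 B z),
            bpt = cube_class 1 Z (rel_cond 1 B z) (const_cube 1 z),
            grp = homotopy_group 1 Z (abs_cond 1 z) z,
            ract = class_concat 1 Z (rel_cond 1 B z)\<rparr>
      else group_action_of (homotopy_group m Z (rel_cond m B z) z))"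

definition homotopy_incl ::
  "nat \<Rightarrow> 'z topology \<Rightarrow> 'z set \<Rightarrow> 'z \<Rightarrow> ('z cubes, 'z cubes, 'z cubes, 'z cubes) action_mor" where
  "homotopy_incl m Z B z =
     mk_action_mor (homotopy_action m (subtopology Z B) z) (homotopy_action m Z z)
       (class_map m Z (abs_cond m z) id) (class_map m Z (abs_cond m z) id)"

definition homotopy_rel ::
  "nat \<Rightarrow> 'z topology \<Rightarrow> 'z set \<Rightarrow> 'z \<Rightarrow> ('z cubes, 'z cubes, 'z cubes, 'z cubes) action_mor" where
  "homotopy_rel m Z B z =
     mk_action_mor (homotopy_action m Z z) (rel_homotopy_action m Z B z)
       (class_map m Z (rel_cond m B z) id) (class_map m Z (rel_cond m B z) id)"

definition homotopy_boundary ::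
  "nat \<Rightarrow> 'z topology \<Rightarrow> 'z set \<Rightarrow> 'z \<Rightarrow> ('z cubes, 'z cubes, 'z cubes, 'z cubes) action_mor" where
  "homotopy_boundary m Z B z =
     mk_action_mor (rel_homotopy_action m Z B z) (homotopy_action (m - 1) (subtopology Z B) z)
       (class_restrict_face m (subtopology Z B) (abs_cond (m - 1) z))
       (class_restrict_face m (subtopology Z B) (abs_cond (m - 1) z))"

definition orbit_map ::
  "'z topology \<Rightarrow> 'z set \<Rightarrow> 'z \<Rightarrow> ('z cubes, 'z cubes, 'z cubes, 'z cubes) action_mor" where
  "orbit_map Z B z =
     (let R = rel_homotopy_action 1 Z B z
      in mk_action_mor (homotopy_action 1 Z z) R (\<lambda>\<sigma>. ract R (bpt R) \<sigma>) (\<lambda>\<sigma>. \<sigma>))"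

text \<open>The face of a path \<open>\<tau>\<close> is the \<open>0\<close>-cube with value \<open>\<tau>(0)\<close>, whose class is the path component
  of \<open>\<tau>(0)\<close> in \<open>B\<close>. The group component is the homomorphism to the trivial group.\<close>

definition start_component_map ::
  "'z topology \<Rightarrow> 'z set \<Rightarrow> 'z \<Rightarrow> ('z cubes, 'z cubes, 'z cubes, 'z cubes) action_mor" where
  "start_component_map Z B z =
     (let T = homotopy_action 0 (subtopology Z B) z
      in mk_action_mor (rel_homotopy_action 1 Z B z) T
           (class_restrict_face 1 (subtopology Z B) (abs_cond 0 z)) (\<lambda>_. \<one>\<^bsub>grp T\<^esub>))"


section \<open>Natural homotopy systems of a directed subspace\<close>

text \<open>Objects are traces \<open>e\<close> of \<open>A\<close>. The pointed pair attached to \<open>e\<close> consists of the trace space of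
  \<open>X\<close> between the endpoints of \<open>e\<close>, the subset of those traces that come from \<open>A\<close>, which carries
  the subspace topology, and the trace \<open>e\<close> itself.\<close>

definition tr_space :: "'a dispace \<Rightarrow> (real \<Rightarrow> 'a) set \<Rightarrow> (real \<Rightarrow> 'a) set topology" where
  "tr_space X e = trace_space X (trace_source e) (trace_target e)"

definition tr_sub :: "'a dispace \<Rightarrow> 'a dispace \<Rightarrow> (real \<Rightarrow> 'a) set \<Rightarrow> (real \<Rightarrow> 'a) set set" where
  "tr_sub X A e = trace_incl X ` topspace (trace_space A (trace_source e) (trace_target e))"

definition tr_push ::
  "'a dispace \<Rightarrow> (real \<Rightarrow> 'a) set \<Rightarrow> (real \<Rightarrow> 'a) set \<Rightarrow> (real \<Rightarrow> 'a) set \<Rightarrow> (real \<Rightarrow> 'a) set" where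
  "tr_push X u v \<sigma> = trace_concat X (trace_incl X u) (trace_concat X \<sigma> (trace_incl X v))"

type_synonym 'a trace_cubes = "(real \<Rightarrow> 'a) set cubes"

type_synonym 'a homotopy_system =
  "((real \<Rightarrow> 'a) set, 'a trace_cubes, 'a trace_cubes) natural_system"

definition P_sub :: "'a dispace \<Rightarrow> 'a dispace \<Rightarrow> nat \<Rightarrow> 'a homotopy_system" where
  "P_sub X A n =
     (let ob = (\<lambda>e. homotopy_action (n - 1) (subtopology (tr_space X e) (tr_sub X A e)) (trace_incl X e))
      in \<lparr>onobj = ob,
          onarr = (\<lambda>(u, e, v).
            let e' = trace_concat A u (trace_concat A e v);
                k = class_map (n - 1) (subtopology (tr_space X e') (tr_sub X A e'))
                      (abs_cond (n - 1) (trace_incl X e')) (tr_push X u v)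
            in mk_action_mor (ob e) (ob e') k k)\<rparr>)"

definition P_amb :: "'a dispace \<Rightarrow> 'a dispace \<Rightarrow> nat \<Rightarrow> 'a homotopy_system" where
  "P_amb X A n =
     (let ob = (\<lambda>e. homotopy_action (n - 1) (tr_space X e) (trace_incl X e))
      in \<lparr>onobj = ob,
          onarr = (\<lambda>(u, e, v).
            let e' = trace_concat A u (trace_concat A e v);
                k = class_map (n - 1) (tr_space X e')
                      (abs_cond (n - 1) (trace_incl X e')) (tr_push X u v)
            in mk_action_mor (ob e) (ob e') k k)\<rparr>)"

text \<open>The relative systems for \<open>n \<ge> 2\<close>; at \<open>n = 2\<close> the acting group is the absolute one.\<close>

definition P_rel :: "'a dispace \<Rightarrow> 'a dispace \<Rightarrow> nat \<Rightarrow> 'a homotopy_system" where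
  "P_rel X A n =
     (let ob = (\<lambda>e. rel_homotopy_action (n - 1) (tr_space X e) (tr_sub X A e) (trace_incl X e))
      in \<lparr>onobj = ob,
          onarr = (\<lambda>(u, e, v).
            let e' = trace_concat A u (trace_concat A e v);
                k = class_map (n - 1) (tr_space X e')
                      (rel_cond (n - 1) (tr_sub X A e') (trace_incl X e')) (tr_push X u v);
                l = class_map (n - 1) (tr_space X e')
                      (abs_cond (n - 1) (trace_incl X e')) (tr_push X u v)
            in mk_action_mor (ob e) (ob e') k (if n = 2 then l else k))\<rparr>)"

definition incl_map ::
  "'a dispace \<Rightarrow> 'a dispace \<Rightarrow> nat \<Rightarrow> (real \<Rightarrow> 'a) set
     \<Rightarrow> ('a trace_cubes, 'a trace_cubes, 'a trace_cubes, 'a trace_cubes) action_mor" where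
  "incl_map X A n e = homotopy_incl (n - 1) (tr_space X e) (tr_sub X A e) (trace_incl X e)"

definition rel_map ::
  "'a dispace \<Rightarrow> 'a dispace \<Rightarrow> nat \<Rightarrow> (real \<Rightarrow> 'a) set
     \<Rightarrow> ('a trace_cubes, 'a trace_cubes, 'a trace_cubes, 'a trace_cubes) action_mor" where
  "rel_map X A n e = homotopy_rel (n - 1) (tr_space X e) (tr_sub X A e) (trace_incl X e)"

definition boundary_map ::
  "'a dispace \<Rightarrow> 'a dispace \<Rightarrow> nat \<Rightarrow> (real \<Rightarrow> 'a) set
     \<Rightarrow> ('a trace_cubes, 'a trace_cubes, 'a trace_cubes, 'a trace_cubes) action_mor" where
  "boundary_map X A n e = homotopy_boundary (n - 1) (tr_space X e) (tr_sub X A e) (trace_incl X e)"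

definition f_map ::
  "'a dispace \<Rightarrow> 'a dispace \<Rightarrow> (real \<Rightarrow> 'a) set
     \<Rightarrow> ('a trace_cubes, 'a trace_cubes, 'a trace_cubes, 'a trace_cubes) action_mor" where
  "f_map X A e = orbit_map (tr_space X e) (tr_sub X A e) (trace_incl X e)"

definition g_map ::
  "'a dispace \<Rightarrow> 'a dispace \<Rightarrow> (real \<Rightarrow> 'a) set
     \<Rightarrow> ('a trace_cubes, 'a trace_cubes, 'a trace_cubes, 'a trace_cubes) action_mor" where
  "g_map X A e = start_component_map (tr_space X e) (tr_sub X A e) (trace_incl X e)"

text \<open>The relative system for \<open>n = 1\<close> is the cokernel of \<open>incl_map X A 1\<close>, with the maps induced on
  classes.\<close>

definition coker_map ::
  "'a dispace \<Rightarrow> 'a dispace \<Rightarrow> (real \<Rightarrow> 'a) set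
     \<Rightarrow> ('a trace_cubes, 'a trace_cubes, 'a trace_cubes set, 'a trace_cubes) action_mor" where
  "coker_map X A e = cokernel (incl_map X A 1 e)"

definition P_rel1 ::
  "'a dispace \<Rightarrow> 'a dispace
     \<Rightarrow> ((real \<Rightarrow> 'a) set, 'a trace_cubes set, 'a trace_cubes) natural_system" where
  "P_rel1 X A =
     \<lparr>onobj = (\<lambda>e. tgt (coker_map X A e)),
      onarr = (\<lambda>(u, e, v).
        let e' = trace_concat A u (trace_concat A e v);
            k = onarr (P_amb X A 1) (u, e, v)
        in mk_action_mor (tgt (coker_map X A e)) (tgt (coker_map X A e'))
             (\<lambda>c. \<Union>t\<in>c. smap (coker_map X A e') (smap k t)) (gmap k))\<rparr>"

end

theory Submission
  imports Defs
begin

text \<open>For fixed end points the trace spaces of \<open>X\<close> and \<open>A\<close> form a pair \<open>B \<subseteq> Z\<close>, and pushing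
  forward along a factorization is a continuous map of pointed pairs. So the theorem is the long exact
  homotopy sequence of a pointed pair together with its naturality. In \<open>Act\<close>, a sequence \<open>a, b\<close> is
  exact as soon as the image of \<open>a\<close> on pointed sets is the preimage of the base point under \<open>b\<close>: the
  congruence \<open>b s = b t\<close> contains the one defining the cokernel of \<open>a\<close>, and the condition on group
  elements reduces to the one on points since \<open>b (0 \<cdot> g) = 0 \<cdot> b g\<close>.\<close>

section \<open>Actions\<close>

text \<open>Homotopy classes, quotient actions and traces are sets of representatives, and every
  operation on them is a union over representatives. Each operation therefore needs one lemma saying
  that all members of the union coincide; afterwards calculations use single representatives.
  Boundary conditions occur in three guises: absolute cubes, relative cubes whose first and last
  coordinates differ, and relative paths on which loops act. One condition, \<open>pcond\<close>,
  covers all of them, so unit, associativity and inverse laws are proved once, as reparametrizations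
  of the first coordinate. The image statements on classes hold in every degree including the
  lowest; only the algebraic structure around them changes there, which is why \<open>f_map\<close>
  and \<open>g_map\<close> need morphism proofs of their own. At the end of the sequence the
  relative term is a cokernel by definition: exactness is formal, and the work is to show that the
  induced maps are functorial. Concatenation of dipaths is associative and unital only up to
  reparametrization, so functor laws become available only after passing to traces.\<close>

lemma is_category_factorization_category:
  assumes "is_category C"
  shows "is_category (factorization_category C)"
proof -
  have dc: "\<And>f. f \<in> Arr C \<Longrightarrow> Dom C f \<in> Obj C \<and> Cod C f \<in> Obj C"
    and idc: "\<And>x. x \<in> Obj C \<Longrightarrow> Id C x \<in> Arr C \<and> Dom C (Id C x) = x \<and> Cod C (Id C x) = x"
    and comp: "\<And>f g. \<lbrakk>f \<in> Arr C; g \<in> Arr C; Cod C f = Dom C g\<rbrakk> \<Longrightarrow>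
        Comp C f g \<in> Arr C \<and> Dom C (Comp C f g) = Dom C f \<and> Cod C (Comp C f g) = Cod C g"
    and unit: "\<And>f. f \<in> Arr C \<Longrightarrow> Comp C (Id C (Dom C f)) f = f \<and> Comp C f (Id C (Cod C f)) = f"
    and assoc: "\<And>f g h. \<lbrakk>f \<in> Arr C; g \<in> Arr C; h \<in> Arr C; Cod C f = Dom C g; Cod C g = Dom C h\<rbrakk> \<Longrightarrow>
        Comp C (Comp C f g) h = Comp C f (Comp C g h)"
    using assms unfolding is_category_def by blast+
  have unitl: "Comp C (Id C x) f = f" if "f \<in> Arr C" "x = Dom C f" for x f
    using unit that by simp
  have unitr: "Comp C f (Id C x) = f" if "f \<in> Arr C" "x = Cod C f" for x f
    using unit that by simp
  show ?thesis
    unfolding is_category_def factorization_category_def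
    by (auto simp: dc idc comp unitl unitr assoc)
qed

text \<open>The restrictions built into \<open>mk_action_mor\<close> are invisible to the axioms: an
  action contains its base point and is closed under acting, and its group is closed under products.
  Morphism checks can therefore use the bare component functions.\<close>

lemma is_action_mor_mk_iff:
  "is_action_mor (mk_action_mor S T a b) \<longleftrightarrow> is_action S \<and> is_action T \<and>
     a \<in> pset S \<rightarrow> pset T \<and> a (bpt S) = bpt T \<and> b \<in> hom (grp S) (grp T) \<and>
     (\<forall>s\<in>pset S. \<forall>g\<in>carrier (grp S). a (ract S s g) = ract T (a s) (b g))"
proof (cases "is_action S")
  case True
  then have S: "bpt S \<in> pset S" "group (grp S)"
    "\<And>s g. s \<in> pset S \<Longrightarrow> g \<in> carrier (grp S) \<Longrightarrow> ract S s g \<in> pset S"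
    by (auto simp: is_action_def)
  interpret group "grp S" by fact
  have "restrict b (carrier (grp S)) \<in> hom (grp S) (grp T) \<longleftrightarrow> b \<in> hom (grp S) (grp T)"
    by (auto simp: hom_def Pi_iff)
  then show ?thesis
    using S by (auto simp: is_action_mor_def mk_action_mor_def Pi_iff)
qed (auto simp: is_action_mor_def mk_action_mor_def)

lemma src_mk_action_mor [simp]: "src (mk_action_mor S T a b) = S"
  and tgt_mk_action_mor [simp]: "tgt (mk_action_mor S T a b) = T"
  and smap_mk_action_mor: "smap (mk_action_mor S T a b) = restrict a (pset S)"
  and gmap_mk_action_mor: "gmap (mk_action_mor S T a b) = restrict b (carrier (grp S))"
  by (simp_all add: mk_action_mor_def)

lemma mk_action_mor_cong:
  "\<lbrakk>\<And>s. s \<in> pset S \<Longrightarrow> a s = a' s; \<And>g. g \<in> carrier (grp S) \<Longrightarrow> b g = b' g\<rbrakk>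
    \<Longrightarrow> mk_action_mor S T a b = mk_action_mor S T a' b'"
  by (auto simp: mk_action_mor_def restrict_def)

lemma action_comp_mk:
  assumes "a \<in> pset S \<rightarrow> pset T" "b \<in> carrier (grp S) \<rightarrow> carrier (grp T)"
  shows "action_comp (mk_action_mor S T a b) (mk_action_mor T U a' b') =
    mk_action_mor S U (\<lambda>s. a' (a s)) (\<lambda>g. b' (b g))"
  unfolding action_comp_def
  using assms by (auto simp: mk_action_mor_def fun_eq_iff restrict_def Pi_iff)

lemma action_mor_eq_mk:
  assumes "is_action_mor a"
  shows "a = mk_action_mor (src a) (tgt a) (smap a) (gmap a)"
  using assms unfolding is_action_mor_def mk_action_mor_def
  by (auto simp: PiE_def extensional_restrict)

lemma is_action_mor_id: "is_action S \<Longrightarrow> is_action_mor (action_id S)"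
  unfolding action_id_def is_action_mor_mk_iff by (auto simp: is_action_def hom_def)

lemma is_action_mor_comp:
  assumes "is_action_mor a" "is_action_mor b" "tgt a = src b"
  shows "is_action_mor (action_comp a b)"
  using assms unfolding action_comp_def is_action_mor_mk_iff
  by (auto simp: is_action_mor_def hom_def Pi_iff PiE_iff)

lemma action_comp_id_left:
  assumes "is_action_mor a"
  shows "action_comp (action_id (src a)) a = a"
  using assms unfolding action_comp_def action_id_def
  by (auto simp: mk_action_mor_def is_action_mor_def PiE_def fun_eq_iff restrict_def
      extensional_def intro!: action_mor.equality)

lemma action_comp_id_right:
  assumes "is_action_mor a"
  shows "action_comp a (action_id (tgt a)) = a"
  using assms unfolding action_comp_def action_id_def
  by (auto simp: mk_action_mor_def is_action_mor_def PiE_def fun_eq_iff restrict_def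
      extensional_def hom_def Pi_iff intro!: action_mor.equality)

lemma action_comp_assoc:
  assumes "is_action_mor a" "tgt a = src b"
  shows "action_comp (action_comp a b) c = action_comp a (action_comp b c)"
proof -
  have "smap a s \<in> pset (src b)" if "s \<in> pset (src a)" for s
    using that assms by (metis PiE_mem is_action_mor_def)
  moreover have "gmap a g \<in> carrier (grp (src b))" if "g \<in> carrier (grp (src a))" for g
    using that assms by (metis hom_in_carrier is_action_mor_def)
  ultimately show ?thesis
    unfolding action_comp_def by (auto simp: mk_action_mor_def fun_eq_iff restrict_def)
qed

lemma src_action_id [simp]: "src (action_id S) = S" and tgt_action_id [simp]: "tgt (action_id S) = S"
  and src_action_comp [simp]: "src (action_comp a b) = src a"
  and tgt_action_comp [simp]: "tgt (action_comp a b) = tgt b"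
  by (simp_all add: action_id_def action_comp_def)

lemma is_category_Act: "is_category Act"
  unfolding is_category_def Act_def
  by (simp add: is_action_mor_id is_action_mor_comp action_comp_id_left action_comp_id_right
      action_comp_assoc) (simp add: is_action_mor_def)

lemma is_action_pset_action: "z \<in> S \<Longrightarrow> is_action (pset_action S z)"
  by (auto simp: is_action_def pset_action_def)

lemma is_action_group_action_of: "group G \<Longrightarrow> is_action (group_action_of G)"
  by (auto simp: is_action_def group_action_of_def group.is_monoid monoid.m_assoc
      intro: monoid.m_closed)

section \<open>Invariant equivalence relations and quotient actions\<close>

text \<open>Each defining property survives intersection. The family has to be nonempty for the
  intersection to stay inside \<open>pset T \<times> pset T\<close>; the total relation is a
  member.\<close>

lemma invariant_equiv_generated_properties:
  fixes T :: "('t, 'h) action"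
  assumes T: "is_action T" and P: "P \<subseteq> pset T"
  defines "R \<equiv> invariant_equiv_generated T P"
  shows "equiv (pset T) R"
    and "\<And>s t h. (s, t) \<in> R \<Longrightarrow> h \<in> carrier (grp T) \<Longrightarrow> (ract T s h, ract T t h) \<in> R"
    and "P \<times> P \<subseteq> R"
proof -
  let ?F = "{R. equiv (pset T) R \<and>
         (\<forall>(s, t)\<in>R. \<forall>h\<in>carrier (grp T). (ract T s h, ract T t h) \<in> R) \<and> P \<times> P \<subseteq> R}"
  have R: "R = \<Inter>?F"
    by (simp add: R_def invariant_equiv_generated_def)
  have top: "pset T \<times> pset T \<in> ?F"
    using T P by (auto simp: is_action_def equiv_def refl_on_def sym_def trans_def)
  show "equiv (pset T) R"
  proof (rule equivI)
    show "R \<subseteq> pset T \<times> pset T"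
      using top R by blast
    show "refl_on (pset T) R"
      unfolding R refl_on_def equiv_def by blast
    show "sym R"
      unfolding R sym_def equiv_def by blast
    show "trans R"
      unfolding R trans_def equiv_def by blast
  qed
  show "P \<times> P \<subseteq> R"
    unfolding R by blast
  show "(ract T s h, ract T t h) \<in> R" if "(s, t) \<in> R" "h \<in> carrier (grp T)" for s t h
    using that unfolding R by blast
qed

lemma invariant_equiv_generated_least:
  assumes "equiv (pset T) R"
    and "\<And>s t h. (s, t) \<in> R \<Longrightarrow> h \<in> carrier (grp T) \<Longrightarrow> (ract T s h, ract T t h) \<in> R"
    and "P \<times> P \<subseteq> R"
  shows "invariant_equiv_generated T P \<subseteq> R"
  unfolding invariant_equiv_generated_def using assms by (intro Inter_lower) auto

text \<open>Invariance makes all members of the union in \<open>quotient_action\<close> the same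
  class, and the union is over a nonempty set because the class of \<open>t\<close> contains
  \<open>t\<close>.\<close>

lemma quotient_action_ract:
  assumes "equiv (pset T) R"
    and "\<And>s t h. (s, t) \<in> R \<Longrightarrow> h \<in> carrier (grp T) \<Longrightarrow> (ract T s h, ract T t h) \<in> R"
    and "t \<in> pset T" "h \<in> carrier (grp T)"
  shows "ract (quotient_action T R) (R `` {t}) h = R `` {ract T t h}"
proof -
  have "t \<in> R `` {t}"
    using assms(1,3) by (rule equiv_class_self)
  moreover have "R `` {ract T s h} = R `` {ract T t h}" if "s \<in> R `` {t}" for s
    using that equiv_class_eq[OF assms(1) assms(2)[OF _ assms(4), of t s]] by simp
  ultimately have "(\<Union>s\<in>R `` {t}. R `` {ract T s h}) = R `` {ract T t h}"
    by (intro SUP_eq_const) blast+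
  then show ?thesis
    by (simp add: quotient_action_def)
qed

lemma is_action_quotient_action:
  assumes T: "is_action T" and R: "equiv (pset T) R"
    and inv: "\<And>s t h. (s, t) \<in> R \<Longrightarrow> h \<in> carrier (grp T) \<Longrightarrow> (ract T s h, ract T t h) \<in> R"
  shows "is_action (quotient_action T R)"
proof -
  have ract: "ract (quotient_action T R) (R `` {t}) h = R `` {ract T t h}"
    if "t \<in> pset T" "h \<in> carrier (grp T)" for t h
    using quotient_action_ract[OF R inv that] .
  have closed: "\<And>g h. g \<in> carrier (grp T) \<Longrightarrow> h \<in> carrier (grp T) \<Longrightarrow> g \<otimes>\<^bsub>grp T\<^esub> h \<in> carrier (grp T)"
    "\<one>\<^bsub>grp T\<^esub> \<in> carrier (grp T)"
    using T by (auto simp: is_action_def group.is_monoid monoid.m_closed)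
  have sel: "pset (quotient_action T R) = pset T // R" "bpt (quotient_action T R) = R `` {bpt T}"
    "grp (quotient_action T R) = grp T"
    by (simp_all add: quotient_action_def)
  have T': "bpt T \<in> pset T" "group (grp T)"
    "\<And>s g. s \<in> pset T \<Longrightarrow> g \<in> carrier (grp T) \<Longrightarrow> ract T s g \<in> pset T"
    "\<And>s. s \<in> pset T \<Longrightarrow> ract T s \<one>\<^bsub>grp T\<^esub> = s"
    "\<And>s g h. \<lbrakk>s \<in> pset T; g \<in> carrier (grp T); h \<in> carrier (grp T)\<rbrakk>
      \<Longrightarrow> ract T s (g \<otimes>\<^bsub>grp T\<^esub> h) = ract T (ract T s g) h"
    using T unfolding is_action_def by blast+
  show ?thesis
    unfolding is_action_def sel
  proof (intro conjI ballI)
    fix c g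
    assume "c \<in> pset T // R" and g: "g \<in> carrier (grp T)"
    then obtain t where t: "t \<in> pset T" "c = R `` {t}"
      by (auto elim: quotientE)
    show "ract (quotient_action T R) c g \<in> pset T // R"
      using t g T'(3) by (simp add: ract quotientI)
    fix h
    assume h: "h \<in> carrier (grp T)"
    show "ract (quotient_action T R) c (g \<otimes>\<^bsub>grp T\<^esub> h) =
        ract (quotient_action T R) (ract (quotient_action T R) c g) h"
      using t g h T'(3) by (simp add: ract closed T'(5))
  next
    fix c
    assume "c \<in> pset T // R"
    then obtain t where t: "t \<in> pset T" "c = R `` {t}"
      by (auto elim: quotientE)
    show "ract (quotient_action T R) c \<one>\<^bsub>grp T\<^esub> = c"
      using t by (simp add: ract closed T'(4))
  qed (use T' in \<open>simp_all add: quotientI\<close>)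
qed

section \<open>Cokernels of morphisms of actions\<close>

locale action_morphism =
  fixes a :: "('s, 'g, 't, 'h) action_mor"
  assumes mor: "is_action_mor a"
begin

definition crel :: "('t \<times> 't) set" where
  "crel = invariant_equiv_generated (tgt a) (smap a ` pset (src a))"

lemma target: "is_action (tgt a)" and image: "smap a ` pset (src a) \<subseteq> pset (tgt a)"
  using mor by (auto simp: is_action_mor_def)

lemma crel_equiv: "equiv (pset (tgt a)) crel"
  and crel_inv: "\<And>s t h. (s, t) \<in> crel \<Longrightarrow> h \<in> carrier (grp (tgt a))
        \<Longrightarrow> (ract (tgt a) s h, ract (tgt a) t h) \<in> crel"
  and crel_image: "smap a ` pset (src a) \<times> smap a ` pset (src a) \<subseteq> crel"
  unfolding crel_def using invariant_equiv_generated_properties[OF target image] by blast+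

lemma cokernel_eq:
  "cokernel a = mk_action_mor (tgt a) (quotient_action (tgt a) crel) (\<lambda>t. crel `` {t}) id"
  by (simp add: cokernel_def crel_def)

lemma is_action_cokernel_target: "is_action (quotient_action (tgt a) crel)"
  by (rule is_action_quotient_action[OF target crel_equiv crel_inv])

lemma is_action_mor_cokernel: "is_action_mor (cokernel a)"
  unfolding cokernel_eq is_action_mor_mk_iff
  using target is_action_cokernel_target quotient_action_ract[OF crel_equiv crel_inv]
  by (auto simp: quotient_action_def[where R = crel] quotientI hom_def is_action_def)

text \<open>A morphism preserves base points; consequently the class to which the cokernel collapses
  the image is the class of the base point.\<close>

lemma bpt_in_image: "bpt (tgt a) \<in> smap a ` pset (src a)"
  using mor by (metis image_eqI is_action_def is_action_mor_def)

end

section \<open>Kernels and the exactness criterion\<close>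

text \<open>The group of the kernel is the preimage under \<open>gmap b\<close> of the stabilizer of
  the base point, hence a subgroup. It preserves the kernel points because its images fix the base
  point of the target.\<close>

lemma is_action_kernel_source:
  assumes "is_action_mor b"
  shows "is_action (src (kernel b))"
proof -
  let ?S = "src b" and ?T = "tgt b"
  let ?H = "{g \<in> carrier (grp ?S). ract ?T (bpt ?T) (gmap b g) = bpt ?T}"
  have S: "is_action ?S" and T: "is_action ?T" and b: "smap b \<in> pset ?S \<rightarrow> pset ?T"
    "smap b (bpt ?S) = bpt ?T" "gmap b \<in> hom (grp ?S) (grp ?T)"
    "\<And>s g. s \<in> pset ?S \<Longrightarrow> g \<in> carrier (grp ?S) \<Longrightarrow> smap b (ract ?S s g) = ract ?T (smap b s) (gmap b g)"
    using assms by (auto simp: is_action_mor_def)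
  interpret G: group "grp ?S" using S by (simp add: is_action_def)
  interpret H: group "grp ?T" using T by (simp add: is_action_def)
  interpret h: group_hom "grp ?S" "grp ?T" "gmap b"
    by (unfold_locales) (rule b(3))
  have T': "bpt ?T \<in> pset ?T" "\<And>s. s \<in> pset ?T \<Longrightarrow> ract ?T s \<one>\<^bsub>grp ?T\<^esub> = s"
    "\<And>s g h. \<lbrakk>s \<in> pset ?T; g \<in> carrier (grp ?T); h \<in> carrier (grp ?T)\<rbrakk>
      \<Longrightarrow> ract ?T s (g \<otimes>\<^bsub>grp ?T\<^esub> h) = ract ?T (ract ?T s g) h"
    using T by (auto simp: is_action_def)
  have "subgroup ?H (grp ?S)"
  proof (rule G.subgroupI)
    show "?H \<noteq> {}" using T' by (auto intro!: exI[of _ "\<one>\<^bsub>grp ?S\<^esub>"])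
    fix g assume g: "g \<in> ?H"
    \<comment> \<open>Since \<open>gmap b g\<close> fixes the base point, it may be inserted for
      free; then it cancels against the inverse.\<close>
    have "ract ?T (bpt ?T) (gmap b (inv\<^bsub>grp ?S\<^esub> g)) = ract ?T (ract ?T (bpt ?T) (gmap b g)) (gmap b (inv\<^bsub>grp ?S\<^esub> g))"
      using g by simp
    also have "\<dots> = ract ?T (bpt ?T) (gmap b g \<otimes>\<^bsub>grp ?T\<^esub> gmap b (inv\<^bsub>grp ?S\<^esub> g))"
      using g T'(1) by (intro T'(3)[symmetric]) auto
    also have "\<dots> = bpt ?T"
      using g T' by simp
    finally show "inv\<^bsub>grp ?S\<^esub> g \<in> ?H" using g by simp
  next
    fix g h assume "g \<in> ?H" "h \<in> ?H"
    then show "g \<otimes>\<^bsub>grp ?S\<^esub> h \<in> ?H" using T' by (simp add: )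
  qed auto
  then have "group ((grp ?S)\<lparr>carrier := ?H\<rparr>)"
    by (rule subgroup.subgroup_is_group) unfold_locales
  then show ?thesis
    using S b by (auto simp: kernel_def mk_action_mor_def is_action_def)
qed

text \<open>Once the point sets agree, the two kernels are equal as records, so the identity serves
  as the isomorphism of subobjects. The targets may differ, as they do for a cokernel and the next
  morphism of a sequence.\<close>

lemma same_subobject_kernelI:
  assumes a: "is_action_mor a" and b: "is_action_mor b" and "src a = src b"
    and set_eq: "{s \<in> pset (src a). smap a s = bpt (tgt a)} = {s \<in> pset (src b). smap b s = bpt (tgt b)}"
  shows "same_subobject (kernel a) (kernel b)"
proof -
  \<comment> \<open>Stated for an arbitrary morphism, because it is applied to two morphisms whose
    targets have different types.\<close>
  have fix_iff: "ract (tgt c) (bpt (tgt c)) (gmap c g) = bpt (tgt c) \<longleftrightarrow>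
      ract (src c) (bpt (src c)) g \<in> {s \<in> pset (src c). smap c s = bpt (tgt c)}"
    if "is_action_mor c" "g \<in> carrier (grp (src c))" for c :: "('x, 'y, 'v, 'w) action_mor" and g
    using that by (auto simp: is_action_mor_def is_action_def)
  have "{g \<in> carrier (grp (src a)). ract (tgt a) (bpt (tgt a)) (gmap a g) = bpt (tgt a)} =
    {g \<in> carrier (grp (src b)). ract (tgt b) (bpt (tgt b)) (gmap b g) = bpt (tgt b)}"
    using fix_iff[OF a] fix_iff[OF b] assms(3) set_eq by auto
  then have eq: "kernel a = kernel b"
    unfolding kernel_def using assms(3) set_eq by simp
  let ?K = "src (kernel b)"
  have K: "is_action ?K" by (rule is_action_kernel_source[OF b])
  have "action_comp (action_id ?K) (action_id ?K) = action_id ?K"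
    using action_comp_id_left[OF is_action_mor_id[OF K]] by (simp add: action_id_def)
  moreover have "action_comp (action_id ?K) (kernel b) = kernel b"
    by (auto simp: action_comp_def action_id_def kernel_def mk_action_mor_def fun_eq_iff restrict_def)
  ultimately show ?thesis
    unfolding eq same_subobject_def is_action_iso_def using is_action_mor_id[OF K]
    by (intro conjI exI[of _ "action_id ?K"]) (auto simp: action_id_def)
qed

lemma action_exactI:
  assumes a: "is_action_mor a" and b: "is_action_mor b" and ab: "tgt a = src b"
    and ex: "smap a ` pset (src a) = {t \<in> pset (src b). smap b t = bpt (tgt b)}"
  shows "action_exact a b"
proof -
  interpret action_morphism a by standard fact
  have b': "is_action (tgt b)" "smap b \<in> pset (src b) \<rightarrow> pset (tgt b)" "smap b (bpt (src b)) = bpt (tgt b)"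
    "gmap b \<in> hom (grp (src b)) (grp (tgt b))"
    "\<And>s g. s \<in> pset (src b) \<Longrightarrow> g \<in> carrier (grp (src b)) \<Longrightarrow>
        smap b (ract (src b) s g) = ract (tgt b) (smap b s) (gmap b g)"
    using b by (auto simp: is_action_mor_def)
  let ?E = "{(s, t). s \<in> pset (tgt a) \<and> t \<in> pset (tgt a) \<and> smap b s = smap b t}"
  have "crel \<subseteq> ?E"
    unfolding crel_def
  proof (rule invariant_equiv_generated_least)
    show "equiv (pset (tgt a)) ?E"
      by (auto simp: equiv_def refl_on_def sym_def trans_def)
    show "smap a ` pset (src a) \<times> smap a ` pset (src a) \<subseteq> ?E"
      using ex ab by auto
    show "(ract (tgt a) s h, ract (tgt a) t h) \<in> ?E"
      if "(s, t) \<in> ?E" "h \<in> carrier (grp (tgt a))" for s t h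
      using that target ab b'(5) by (auto simp: is_action_def)
  qed
  \<comment> \<open>Such a \<open>t\<close> lies in the image of \<open>a\<close> by exactness on
    points, and the cokernel identifies the whole image with the base point.\<close>
  moreover have "(t, bpt (tgt a)) \<in> crel" if "t \<in> pset (tgt a)" "smap b t = bpt (tgt b)" for t
    using that ex ab crel_image bpt_in_image by auto
  ultimately have iff: "(t, bpt (tgt a)) \<in> crel \<longleftrightarrow> smap b t = bpt (tgt b)" if "t \<in> pset (tgt a)" for t
    using that b'(3) ab by auto
  have bpt: "bpt (tgt a) \<in> pset (tgt a)"
    using target by (simp add: is_action_def)
  have "crel `` {t} = crel `` {bpt (tgt a)} \<longleftrightarrow> smap b t = bpt (tgt b)" if "t \<in> pset (tgt a)" for t
    using iff[OF that] eq_equiv_class_iff[OF crel_equiv that bpt] by simp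
  then have "same_subobject (kernel (cokernel a)) (kernel b)"
    using is_action_mor_cokernel b ab
    by (intro same_subobject_kernelI)
      (auto simp: cokernel_eq smap_mk_action_mor quotient_action_def)
  then show ?thesis
    using a b ab by (simp add: action_exact_def)
qed

text \<open>Exactness here compares the kernel of the cokernel with itself.\<close>

lemma action_exact_cokernel:
  assumes "is_action_mor a"
  shows "action_exact a (cokernel a)"
proof -
  interpret action_morphism a by standard fact
  show ?thesis
    unfolding action_exact_def using assms is_action_mor_cokernel
    by (auto intro!: same_subobject_kernelI simp: cokernel_eq)
qed

lemma is_action_mor_to_zero:
  assumes "is_action S"
  shows "is_action_mor (mk_action_mor S zero_action (\<lambda>_. ()) (\<lambda>_. ()))"
  using assms is_action_pset_action[of "()" "{()}"]
  by (auto simp: is_action_mor_mk_iff zero_action_def pset_action_def hom_def singleton_group_def)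

text \<open>The projection to the quotient is onto, and every point lies over the only point of
  \<open>zero_action\<close>.\<close>

lemma action_exact_cokernel_zero:
  assumes "is_action_mor a"
  shows "action_exact (cokernel a) (mk_action_mor (tgt (cokernel a)) zero_action (\<lambda>_. ()) (\<lambda>_. ()))"
proof -
  interpret action_morphism a by standard fact
  show ?thesis
  proof (rule action_exactI)
    show "is_action_mor (mk_action_mor (tgt (cokernel a)) zero_action (\<lambda>_. ()) (\<lambda>_. ()))"
      using is_action_mor_cokernel by (intro is_action_mor_to_zero) (simp add: is_action_mor_def)
  next
    show "smap (cokernel a) ` pset (src (cokernel a)) = {t \<in> pset (src (mk_action_mor (tgt (cokernel a)) zero_action (\<lambda>_. ()) (\<lambda>_. ()))).
        smap (mk_action_mor (tgt (cokernel a)) zero_action (\<lambda>_. ()) (\<lambda>_. ())) t =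
        bpt (tgt (mk_action_mor (tgt (cokernel a)) zero_action (\<lambda>_. ()) (\<lambda>_. ())))}"
      by (auto simp: cokernel_eq smap_mk_action_mor quotient_action_def quotient_def)
  qed (auto simp: is_action_mor_cokernel)
qed

section \<open>Maps induced on cokernels\<close>

text \<open>The congruence of \<open>b\<close>, pulled back along \<open>k\<close>, is an invariant
  equivalence relation and identifies the image of \<open>a\<close>. By minimality it contains the
  congruence of \<open>a\<close>, so the value does not depend on the representative.\<close>

lemma cokernel_map_class:
  assumes a: "is_action_mor a" and b: "is_action_mor b"
    and k: "is_action_mor k" "src k = tgt a" "tgt k = tgt b"
    and comm: "\<And>s. s \<in> pset (src a) \<Longrightarrow> smap k (smap a s) \<in> smap b ` pset (src b)"
    and t: "t \<in> pset (tgt a)"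
  shows "(\<Union>s \<in> smap (cokernel a) t. smap (cokernel b) (smap k s)) = smap (cokernel b) (smap k t)"
proof -
  interpret A: action_morphism a by standard fact
  interpret B: action_morphism b by standard fact
  have k': "smap k \<in> pset (tgt a) \<rightarrow> pset (tgt b)" "gmap k \<in> hom (grp (tgt a)) (grp (tgt b))"
    "\<And>s g. s \<in> pset (tgt a) \<Longrightarrow> g \<in> carrier (grp (tgt a)) \<Longrightarrow>
        smap k (ract (tgt a) s g) = ract (tgt b) (smap k s) (gmap k g)"
    using k(1) unfolding is_action_mor_def k(2,3) by auto
  have hom: "\<And>g. g \<in> carrier (grp (tgt a)) \<Longrightarrow> gmap k g \<in> carrier (grp (tgt b))"
    using k'(2) by (auto simp: hom_def)
  let ?E = "{(s, t). s \<in> pset (tgt a) \<and> t \<in> pset (tgt a) \<and> (smap k s, smap k t) \<in> B.crel}"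
  have "A.crel \<subseteq> ?E"
    unfolding A.crel_def
  proof (rule invariant_equiv_generated_least)
    show "equiv (pset (tgt a)) ?E"
    proof (rule equivI)
      show "refl_on (pset (tgt a)) ?E"
        using B.crel_equiv k'(1) by (auto simp: equiv_def refl_on_def)
      show "sym ?E"
        using B.crel_equiv unfolding equiv_def sym_def by blast
      show "trans ?E"
        using B.crel_equiv unfolding equiv_def trans_def by blast
    qed auto
    show "smap a ` pset (src a) \<times> smap a ` pset (src a) \<subseteq> ?E"
      using A.image comm by (auto intro!: subsetD[OF B.crel_image])
    show "(ract (tgt a) s h, ract (tgt a) t h) \<in> ?E"
      if "(s, t) \<in> ?E" "h \<in> carrier (grp (tgt a))" for s t h
      using that A.target by (auto simp: is_action_def k'(3) intro!: B.crel_inv hom)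
  qed
  then have *: "B.crel `` {smap k s} = B.crel `` {smap k t}" "s \<in> pset (tgt a)" if "(t, s) \<in> A.crel" for s
    using that equiv_class_eq_iff[OF B.crel_equiv] by blast+
  have "t \<in> A.crel `` {t}"
    using A.crel_equiv t by (rule equiv_class_self)
  then have "(\<Union>s\<in>A.crel `` {t}. B.crel `` {smap k s}) = B.crel `` {smap k t}"
    using *(1) by (intro SUP_eq_const) blast+
  moreover have "smap (cokernel b) (smap k s) = B.crel `` {smap k s}" if "s \<in> A.crel `` {t}" for s
    using *(2)[of s] that funcset_mem[OF k'(1)] by (simp add: B.cokernel_eq smap_mk_action_mor)
  moreover have "smap (cokernel a) t = A.crel `` {t}" "smap (cokernel b) (smap k t) = B.crel `` {smap k t}"
    using t funcset_mem[OF k'(1)] by (simp_all add: A.cokernel_eq B.cokernel_eq smap_mk_action_mor)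
  ultimately show ?thesis
    by simp
qed

text \<open>The formula is the one in the arrow part of \<open>P_rel1\<close>, freed from traces, so
  that functoriality can be shown for arbitrary commuting squares.\<close>

definition cokernel_mor where
  "cokernel_mor a b k = mk_action_mor (tgt (cokernel a)) (tgt (cokernel b))
     (\<lambda>c. \<Union>t\<in>c. smap (cokernel b) (smap k t)) (gmap k)"

lemma smap_action_comp: "s \<in> pset (src a) \<Longrightarrow> smap (action_comp a b) s = smap b (smap a s)"
  and gmap_action_comp: "g \<in> carrier (grp (src a)) \<Longrightarrow> gmap (action_comp a b) g = gmap b (gmap a g)"
  by (simp_all add: action_comp_def smap_mk_action_mor gmap_mk_action_mor)

lemma action_mor_eqI:
  assumes "is_action_mor a" "is_action_mor b" "src a = src b" "tgt a = tgt b"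
    and "\<And>s. s \<in> pset (src a) \<Longrightarrow> smap a s = smap b s"
    and "\<And>g. g \<in> carrier (grp (src a)) \<Longrightarrow> gmap a g = gmap b g"
  shows "a = b"
proof -
  have "a = mk_action_mor (src a) (tgt a) (smap a) (gmap a)"
    by (rule action_mor_eq_mk[OF assms(1)])
  also have "\<dots> = mk_action_mor (src a) (tgt a) (smap b) (gmap b)"
    by (rule mk_action_mor_cong[OF assms(5,6)])
  also have "\<dots> = b"
    unfolding assms(3,4) by (rule action_mor_eq_mk[OF assms(2), symmetric])
  finally show ?thesis .
qed

lemma cokernel_properties:
  assumes "is_action_mor a"
  shows "src (cokernel a) = tgt a" "grp (tgt (cokernel a)) = grp (tgt a)"
    and "pset (tgt (cokernel a)) = smap (cokernel a) ` pset (tgt a)"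
    and "\<And>g. g \<in> carrier (grp (tgt a)) \<Longrightarrow> gmap (cokernel a) g = g"
proof -
  interpret action_morphism a by standard fact
  show "src (cokernel a) = tgt a" "grp (tgt (cokernel a)) = grp (tgt a)"
    "pset (tgt (cokernel a)) = smap (cokernel a) ` pset (tgt a)"
    "\<And>g. g \<in> carrier (grp (tgt a)) \<Longrightarrow> gmap (cokernel a) g = g"
    by (auto simp: cokernel_eq quotient_action_def quotient_def smap_mk_action_mor gmap_mk_action_mor)
qed

lemma action_mor_properties:
  assumes "is_action_mor a"
  shows "is_action (src a)" "is_action (tgt a)"
    and "\<And>s. s \<in> pset (src a) \<Longrightarrow> smap a s \<in> pset (tgt a)" "smap a (bpt (src a)) = bpt (tgt a)"
    and "gmap a \<in> hom (grp (src a)) (grp (tgt a))"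
    and "\<And>s g. s \<in> pset (src a) \<Longrightarrow> g \<in> carrier (grp (src a)) \<Longrightarrow>
        smap a (ract (src a) s g) = ract (tgt a) (smap a s) (gmap a g)"
  using assms unfolding is_action_mor_def by (auto dest: PiE_mem)

lemma is_action_properties:
  assumes "is_action S"
  shows "bpt S \<in> pset S" "group (grp S)"
    and "\<And>s g. s \<in> pset S \<Longrightarrow> g \<in> carrier (grp S) \<Longrightarrow> ract S s g \<in> pset S"
  using assms unfolding is_action_def by simp_all

text \<open>A cokernel projection is onto on points and the identity on groups, so it can be
  cancelled. Identities and composites of induced maps are later compared after precomposing with
  it.\<close>

lemma cokernel_epi:
  assumes a: "is_action_mor a" and m: "is_action_mor m" "is_action_mor m'"
    and "src m = tgt (cokernel a)" "src m' = tgt (cokernel a)"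
    and eq: "action_comp (cokernel a) m = action_comp (cokernel a) m'"
  shows "m = m'"
proof (rule action_mor_eqI[OF m])
  note q = cokernel_properties[OF a]
  show "src m = src m'" using assms by simp
  show "tgt m = tgt m'" using arg_cong[OF eq, of tgt] by simp
  show "smap m s = smap m' s" if s: "s \<in> pset (src m)" for s
  proof -
    obtain t where t: "t \<in> pset (tgt a)" "s = smap (cokernel a) t"
      using s assms(4) q(3) by auto
    then show ?thesis
      using smap_action_comp[of t "cokernel a" m] smap_action_comp[of t "cokernel a" m'] eq q(1) by simp
  qed
  show "gmap m g = gmap m' g" if g: "g \<in> carrier (grp (src m))" for g
  proof -
    have "g \<in> carrier (grp (tgt a))" using g assms(4) q(2) by simp
    then show ?thesis
      using gmap_action_comp[of g "cokernel a" m] gmap_action_comp[of g "cokernel a" m'] eq q(1,4) by simp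
  qed
qed

locale action_square =
  fixes a :: "('s, 'g, 't, 'h) action_mor" and b :: "('s2, 'g2, 't2, 'h2) action_mor"
    and j :: "('s, 'g, 's2, 'g2) action_mor" and k :: "('t, 'h, 't2, 'h2) action_mor"
  assumes a: "is_action_mor a" and b: "is_action_mor b"
    and j: "is_action_mor j" "src j = src a" "tgt j = src b"
    and k: "is_action_mor k" "src k = tgt a" "tgt k = tgt b"
    and comm: "action_comp j b = action_comp a k"
begin

lemma smap_cokernel_mor:
  assumes t: "t \<in> pset (tgt a)"
  shows "smap (cokernel_mor a b k) (smap (cokernel a) t) = smap (cokernel b) (smap k t)"
proof -
  have "smap k (smap a s) \<in> smap b ` pset (src b)" if s: "s \<in> pset (src a)" for s
  proof -
    have "smap k (smap a s) = smap b (smap j s)"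
      using smap_action_comp[of s a k] smap_action_comp[of s j b] comm s j(2) by simp
    moreover have "smap j s \<in> pset (src b)"
      using action_mor_properties(3)[OF j(1)] s j(2,3) by simp
    ultimately show ?thesis by simp
  qed
  from cokernel_map_class[OF a b k this t] show ?thesis
    using t cokernel_properties(3)[OF a] by (simp add: cokernel_mor_def smap_mk_action_mor)
qed

text \<open>Every point of the cokernel is the class of some \<open>t\<close>. Each axiom is
  evaluated at \<open>t\<close> and carried over by the two projections, which are morphisms
  themselves.\<close>

lemma is_action_mor_cokernel_mor: "is_action_mor (cokernel_mor a b k)"
proof -
  note q = cokernel_properties[OF a] and r = cokernel_properties[OF b]
  have qm: "is_action_mor (cokernel a)" and rm: "is_action_mor (cokernel b)"
    using a b action_morphism.is_action_mor_cokernel action_morphism.intro by blast+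
  note Q = action_mor_properties[OF qm] and R = action_mor_properties[OF rm]
    and K = action_mor_properties[OF k(1)]
  note T = is_action_properties[OF K(1)]
  let ?m = "smap (cokernel_mor a b k)"
  have m: "?m (smap (cokernel a) t) = smap (cokernel b) (smap k t)" if "t \<in> pset (tgt a)" for t
    by (rule smap_cokernel_mor[OF that])
  have gk: "gmap k g \<in> carrier (grp (tgt b))" if "g \<in> carrier (grp (tgt a))" for g
    using hom_in_carrier[OF K(5)] that k by simp
  have sk: "smap k t \<in> pset (tgt b)" if "t \<in> pset (tgt a)" for t
    using K(3) that k by simp
  have "cokernel_mor a b k = mk_action_mor (tgt (cokernel a)) (tgt (cokernel b)) ?m (gmap k)"
    unfolding cokernel_mor_def smap_mk_action_mor by (rule mk_action_mor_cong) simp_all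
  moreover have "is_action_mor (mk_action_mor (tgt (cokernel a)) (tgt (cokernel b)) ?m (gmap k))"
    unfolding is_action_mor_mk_iff
  proof (intro conjI ballI funcsetI Q(2) R(2))
    show "?m c \<in> pset (tgt (cokernel b))" if "c \<in> pset (tgt (cokernel a))" for c
      using that sk unfolding q(3) r(3) by (auto simp: m)
    show "?m (bpt (tgt (cokernel a))) = bpt (tgt (cokernel b))"
    proof -
      have "bpt (tgt (cokernel a)) = smap (cokernel a) (bpt (tgt a))" using Q(4) q(1) by simp
      moreover have "bpt (tgt a) \<in> pset (tgt a)" using T(1) k(2) by simp
      ultimately show ?thesis using m K(4) R(4) k(2,3) r(1) by simp
    qed
    show "gmap k \<in> hom (grp (tgt (cokernel a))) (grp (tgt (cokernel b)))"
      using K(5) k(2,3) q(2) r(2) by simp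
    show "?m (ract (tgt (cokernel a)) c g) = ract (tgt (cokernel b)) (?m c) (gmap k g)"
      if cg: "c \<in> pset (tgt (cokernel a))" "g \<in> carrier (grp (tgt (cokernel a)))" for c g
    proof -
      obtain t where t: "t \<in> pset (tgt a)" "c = smap (cokernel a) t"
        using cg(1) unfolding q(3) by blast
      have g: "g \<in> carrier (grp (tgt a))" using cg(2) q(2) by simp
      have tg: "ract (tgt a) t g \<in> pset (tgt a)" using T(3) t(1) g k(2) by simp
      have "ract (tgt (cokernel a)) c g = smap (cokernel a) (ract (tgt a) t g)"
        using Q(6)[of t g] t g q(1) q(4)[OF g] by simp
      then have "?m (ract (tgt (cokernel a)) c g) = smap (cokernel b) (smap k (ract (tgt a) t g))"
        using m[OF tg] by simp
      also have "\<dots> = smap (cokernel b) (ract (tgt b) (smap k t) (gmap k g))"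
        using K(6)[of t g] t g k(2,3) by simp
      also have "\<dots> = ract (tgt (cokernel b)) (smap (cokernel b) (smap k t)) (gmap k g)"
        using R(6)[of "smap k t" "gmap k g"] sk[OF t(1)] gk[OF g] r(1) r(4)[OF gk[OF g]] by simp
      finally show ?thesis using m[OF t(1)] t(2) by simp
    qed
  qed
  ultimately show ?thesis by simp
qed

lemma cokernel_mor_square:
  "action_comp (cokernel a) (cokernel_mor a b k) = action_comp k (cokernel b)"
proof -
  note q = cokernel_properties[OF a] and r = cokernel_properties[OF b]
  have "\<And>g. g \<in> carrier (grp (tgt a)) \<Longrightarrow> gmap k g \<in> carrier (grp (tgt b))"
    using hom_in_carrier[OF action_mor_properties(5)[OF k(1)]] k by simp
  then have "gmap (cokernel b) (gmap k g) = gmap (cokernel_mor a b k) (gmap (cokernel a) g)"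
    if "g \<in> carrier (grp (tgt a))" for g
    using that q(2,4) r(4) by (simp add: cokernel_mor_def gmap_mk_action_mor)
  then show ?thesis
    unfolding action_comp_def q(1) k(2)
    by (simp add: cokernel_mor_def[of a b k, THEN arg_cong[where f = tgt]], intro mk_action_mor_cong)
      (simp_all add: smap_cokernel_mor)
qed

end

lemma cokernel_mor_ident:
  assumes "is_action_mor a" "action_square a a j k" "k = action_id (tgt a)"
  shows "cokernel_mor a a k = action_id (tgt (cokernel a))"
proof (rule cokernel_epi[OF assms(1)])
  have qm: "is_action_mor (cokernel a)"
    using assms(1) by (rule action_morphism.is_action_mor_cokernel[OF action_morphism.intro])
  note q = cokernel_properties[OF assms(1)]
  show "is_action_mor (cokernel_mor a a k)"
    by (rule action_square.is_action_mor_cokernel_mor[OF assms(2)])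
  show "is_action_mor (action_id (tgt (cokernel a)))"
    by (rule is_action_mor_id[OF action_mor_properties(2)[OF qm]])
  show "action_comp (cokernel a) (cokernel_mor a a k) = action_comp (cokernel a) (action_id (tgt (cokernel a)))"
  proof -
    have "action_comp (cokernel a) (cokernel_mor a a k) = action_comp k (cokernel a)"
      by (rule action_square.cokernel_mor_square[OF assms(2)])
    also have "\<dots> = cokernel a"
      using action_comp_id_left[OF qm] q(1) by (simp add: assms(3))
    finally show ?thesis
      using action_comp_id_right[OF qm] by simp
  qed
qed (simp_all add: cokernel_mor_def)

text \<open>Pasting two squares: both sides have the same composite with the projection onto the
  cokernel of \<open>a\<close>, and that projection can be cancelled.\<close>

lemma cokernel_mor_comp:
  assumes 1: "action_square a b j k" and 2: "action_square b c j' k'"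
    and 3: "action_square a c j'' k''" and k: "k'' = action_comp k k'"
  shows "action_comp (cokernel_mor a b k) (cokernel_mor b c k') = cokernel_mor a c k''"
proof -
  interpret s1: action_square a b j k by (rule 1)
  interpret s2: action_square b c j' k' by (rule 2)
  interpret s3: action_square a c j'' k'' by (rule 3)
  have qm: "is_action_mor (cokernel a)" "is_action_mor (cokernel b)"
    using s1.a s1.b by (auto intro: action_morphism.is_action_mor_cokernel[OF action_morphism.intro])
  have st: "src (cokernel_mor x y l) = tgt (cokernel x)" "tgt (cokernel_mor x y l) = tgt (cokernel y)" for x y l
    by (simp_all add: cokernel_mor_def)
  show ?thesis
  proof (rule cokernel_epi[OF s1.a])
    show "is_action_mor (action_comp (cokernel_mor a b k) (cokernel_mor b c k'))"
      by (rule is_action_mor_comp[OF s1.is_action_mor_cokernel_mor s2.is_action_mor_cokernel_mor]) (simp add: st)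
    show "is_action_mor (cokernel_mor a c k'')" by (rule s3.is_action_mor_cokernel_mor)
    have "action_comp (cokernel a) (action_comp (cokernel_mor a b k) (cokernel_mor b c k')) =
        action_comp (action_comp (cokernel a) (cokernel_mor a b k)) (cokernel_mor b c k')"
      by (rule action_comp_assoc[symmetric, OF qm(1)]) (simp add: st)
    also have "\<dots> = action_comp (action_comp k (cokernel b)) (cokernel_mor b c k')"
      by (simp add: s1.cokernel_mor_square)
    also have "\<dots> = action_comp k (action_comp (cokernel b) (cokernel_mor b c k'))"
      by (rule action_comp_assoc[OF s1.k(1)]) (simp add: s1.k cokernel_properties[OF s1.b])
    also have "\<dots> = action_comp k (action_comp k' (cokernel c))"
      by (simp add: s2.cokernel_mor_square)
    also have "\<dots> = action_comp (action_comp k k') (cokernel c)"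
      by (rule action_comp_assoc[symmetric, OF s1.k(1)]) (simp add: s1.k s2.k)
    also have "\<dots> = action_comp (cokernel a) (cokernel_mor a c k'')"
      unfolding k[symmetric] by (rule s3.cokernel_mor_square[symmetric])
    finally show "action_comp (cokernel a) (action_comp (cokernel_mor a b k) (cokernel_mor b c k')) =
      action_comp (cokernel a) (cokernel_mor a c k'')" .
  qed (simp_all add: st)
qed


section \<open>Natural systems\<close>

lemma Obj_factorization: "Obj (factorization_category C) = Arr C"
  and Arr_factorization: "(u, f, v) \<in> Arr (factorization_category C) \<longleftrightarrow>
    u \<in> Arr C \<and> f \<in> Arr C \<and> v \<in> Arr C \<and> Cod C u = Dom C f \<and> Cod C f = Dom C v"
  and Dom_factorization: "Dom (factorization_category C) (u, f, v) = f"
  and Cod_factorization: "Cod (factorization_category C) (u, f, v) = Comp C u (Comp C f v)"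
  and Id_factorization: "Id (factorization_category C) f = (Id C (Dom C f), f, Id C (Cod C f))"
  and Comp_factorization: "Comp (factorization_category C) (u, f, v) (u', f', v') = (Comp C u' u, f, Comp C v v')"
  by (simp_all add: factorization_category_def)

text \<open>When \<open>(u, e, v)\<close> is composed with a second factorization, composability
  forces the middle entry of the second to be \<open>u e v\<close>. The functor law can therefore be
  stated in terms of the outer factors.\<close>

lemma is_natural_systemI:
  assumes C: "is_category C"
    and "\<And>e. e \<in> Arr C \<Longrightarrow> is_action (onobj N e)"
    and "\<And>u e v. (u, e, v) \<in> Arr (factorization_category C) \<Longrightarrow>
      is_action_mor (onarr N (u, e, v)) \<and> src (onarr N (u, e, v)) = onobj N e \<and>
      tgt (onarr N (u, e, v)) = onobj N (Comp C u (Comp C e v))"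
    and "\<And>e. e \<in> Arr C \<Longrightarrow> onarr N (Id C (Dom C e), e, Id C (Cod C e)) = action_id (onobj N e)"
    and "\<And>u e v u' v'. \<lbrakk>(u, e, v) \<in> Arr (factorization_category C);
        (u', Comp C u (Comp C e v), v') \<in> Arr (factorization_category C)\<rbrakk> \<Longrightarrow>
      onarr N (Comp C u' u, e, Comp C v v') =
        action_comp (onarr N (u, e, v)) (onarr N (u', Comp C u (Comp C e v), v'))"
  shows "is_natural_system C N"
proof -
  have Act: "Obj Act = {S. is_action S}" "Arr Act = {a. is_action_mor a}" "Dom Act = src" "Cod Act = tgt"
    "Id Act = action_id" "Comp Act = action_comp"
    by (simp_all add: Act_def)
  show ?thesis
    unfolding is_natural_system_def is_functor_def Act Obj_factorization Id_factorization
    using C assms(2,4) is_category_factorization_category[OF C] is_category_Act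
  proof (intro conjI ballI impI)
    fix k assume "k \<in> Arr (factorization_category C)"
    moreover obtain u e v where k: "k = (u, e, v)" by (cases k)
    ultimately have "(u, e, v) \<in> Arr (factorization_category C)" by simp
    from assms(3)[OF this]
    show "onarr N k \<in> {a. is_action_mor a}" "src (onarr N k) = onobj N (Dom (factorization_category C) k)"
      "tgt (onarr N k) = onobj N (Cod (factorization_category C) k)"
      by (simp_all add: k Dom_factorization Cod_factorization)
  next
    fix k l assume kl: "k \<in> Arr (factorization_category C)" "l \<in> Arr (factorization_category C)"
      "Cod (factorization_category C) k = Dom (factorization_category C) l"
    obtain u e v where k: "k = (u, e, v)" by (cases k)
    obtain u' e' v' where l: "l = (u', e', v')" by (cases l)
    have e': "e' = Comp C u (Comp C e v)" using kl(3) by (simp add: k l Dom_factorization Cod_factorization)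
    show "onarr N (Comp (factorization_category C) k l) = action_comp (onarr N k) (onarr N l)"
      unfolding k l Comp_factorization using assms(5)[of u e v u' v'] kl(1,2) e' by (simp add: k l)
  qed auto
qed

lemma is_natural_transformationI:
  assumes "is_natural_system C M" "is_natural_system C N"
    and "\<And>e. e \<in> Arr C \<Longrightarrow> is_action_mor (\<alpha> e) \<and> src (\<alpha> e) = onobj M e \<and> tgt (\<alpha> e) = onobj N e"
    and "\<And>u e v. (u, e, v) \<in> Arr (factorization_category C) \<Longrightarrow>
      action_comp (onarr M (u, e, v)) (\<alpha> (Comp C u (Comp C e v))) = action_comp (\<alpha> e) (onarr N (u, e, v))"
  shows "is_natural_transformation C M N \<alpha>"
  unfolding is_natural_transformation_def Obj_factorization
proof (intro conjI ballI assms(1,2))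
  fix k assume "k \<in> Arr (factorization_category C)"
  moreover obtain u e v where k: "k = (u, e, v)" by (cases k)
  ultimately show "action_comp (onarr M k) (\<alpha> (Cod (factorization_category C) k)) =
      action_comp (\<alpha> (Dom (factorization_category C) k)) (onarr N k)"
    using assms(4)[of u e v] by (simp add: k Dom_factorization Cod_factorization)
qed (use assms(3) in auto)

lemma is_natural_system_zero:
  assumes "is_category C"
  shows "is_natural_system C zero_natural_system"
proof -
  have z: "is_action zero_action" unfolding zero_action_def by (intro is_action_pset_action) simp
  show ?thesis
    using z is_action_mor_id[OF z] action_comp_id_left[OF is_action_mor_id[OF z]]
    by (intro is_natural_systemI[OF assms]) (simp_all add: zero_natural_system_def)
qed

lemma is_natural_transformation_to_zero:
  assumes "is_natural_system C N"
  shows "is_natural_transformation C N zero_natural_system (to_zero N)"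
proof (rule is_natural_transformationI[OF assms is_natural_system_zero])
  show "is_category C" using assms by (simp add: is_natural_system_def)
  have F: "is_functor (factorization_category C) Act N" using assms by (simp add: is_natural_system_def)
  have act: "is_action (onobj N e)" if "e \<in> Arr C" for e
    using F that unfolding is_functor_def Obj_factorization by (simp add: Act_def)
  show "is_action_mor (to_zero N e) \<and> src (to_zero N e) = onobj N e \<and> tgt (to_zero N e) = onobj zero_natural_system e"
    if "e \<in> Arr C" for e
    using is_action_mor_to_zero[OF act[OF that]] by (simp add: to_zero_def zero_natural_system_def)
  fix u e v assume uev: "(u, e, v) \<in> Arr (factorization_category C)"
  have "src (onarr N (u, e, v)) = onobj N e"
    using F uev unfolding is_functor_def by (auto simp: Act_def Dom_factorization)
  then show "action_comp (onarr N (u, e, v)) (to_zero N (Comp C u (Comp C e v))) =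
      action_comp (to_zero N e) (onarr zero_natural_system (u, e, v))"
    by (simp add: action_comp_def to_zero_def zero_natural_system_def mk_action_mor_def action_id_def
        fun_eq_iff)
qed


section \<open>Cubes and concatenation\<close>

lemma topspace_cube: "topspace (cube m) = (\<Pi>\<^sub>E i\<in>{..<m}. {0..1})"
  by (simp add: cube_def)

lemma cube_coord:
  assumes "x \<in> topspace (cube m)" "i < m"
  shows "0 \<le> x i" "x i \<le> 1"
  using assms by (auto simp: topspace_cube PiE_iff)

lemma cube_fun_upd:
  "\<lbrakk>x \<in> topspace (cube m); j < m; 0 \<le> r; r \<le> 1\<rbrakk> \<Longrightarrow> x(j := r) \<in> topspace (cube m)"
  by (auto simp: topspace_cube PiE_iff extensional_def)

lemma continuous_map_cubeI:
  assumes "\<And>i. i < m \<Longrightarrow> continuous_map X euclideanreal (\<lambda>x. F x i)"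
    and "\<And>x. x \<in> topspace X \<Longrightarrow> F x \<in> topspace (cube m)"
  shows "continuous_map X (cube m) F"
  unfolding cube_def continuous_map_componentwise
  using assms by (auto simp: continuous_map_in_subtopology topspace_cube PiE_iff)

lemma continuous_map_cube_coord:
  assumes "continuous_map X (cube m) F" "i < m"
  shows "continuous_map X euclideanreal (\<lambda>x. F x i)"
  using assms unfolding cube_def continuous_map_componentwise
  by (auto simp: continuous_map_in_subtopology)

lemma continuous_map_cube_fun_upd:
  assumes "continuous_map X (cube m) F" "continuous_map X euclideanreal r"
    and "\<And>x. x \<in> topspace X \<Longrightarrow> 0 \<le> r x \<and> r x \<le> 1" and "j < m"
  shows "continuous_map X (cube m) (\<lambda>x. (F x)(j := r x))"
proof (rule continuous_map_cubeI)
  show "continuous_map X euclideanreal (\<lambda>x. ((F x)(j := r x)) i)" if "i < m" for i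
    using assms continuous_map_cube_coord[OF assms(1) that] by (cases "i = j") auto
  show "(F x)(j := r x) \<in> topspace (cube m)" if "x \<in> topspace X" for x
    using assms that continuous_map_funspace[OF assms(1)] by (intro cube_fun_upd) auto
qed

text \<open>The time coordinate is a real function with bounds, not a map into a subspace.
  Continuity of explicit reparametrizations then follows from rules for real functions, and the
  bounds become a separate arithmetical goal.\<close>

lemma continuous_map_homotopy_compose:
  assumes "continuous_map (prod_topology (top_of_set {0..1::real}) Y) Z h"
    and "continuous_map W euclideanreal r" "\<And>w. w \<in> topspace W \<Longrightarrow> 0 \<le> r w \<and> r w \<le> 1"
    and "continuous_map W Y G"
  shows "continuous_map W Z (\<lambda>w. h (r w, G w))"
proof -
  have "continuous_map W (top_of_set {0..1}) r"
    using assms(2,3) by (auto simp: continuous_map_in_subtopology)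
  then have "continuous_map W (prod_topology (top_of_set {0..1}) Y) (\<lambda>w. (r w, G w))"
    using assms(4) by (rule continuous_map_pairedI)
  from continuous_map_compose[OF this assms(1)] show ?thesis
    by (simp add: o_def)
qed

abbreviation hcube :: "nat \<Rightarrow> (real \<times> (nat \<Rightarrow> real)) topology" where
  "hcube m \<equiv> prod_topology (top_of_set {0..1}) (cube m)"

lemma continuous_map_hcube_fst: "continuous_map (hcube m) euclideanreal fst"
  using continuous_map_fst continuous_map_in_subtopology by blast

lemma continuous_map_hcube_coord: "i < m \<Longrightarrow> continuous_map (hcube m) euclideanreal (\<lambda>w. snd w i)"
  by (intro continuous_map_cube_coord[OF continuous_map_snd])

section \<open>Homotopies and classes of cubes\<close>

text \<open>Representatives of classes are extensional, but the slices and ends of a homotopy have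
  arbitrary values off the cube. This property lets a boundary condition ignore those
  values.\<close>

definition cube_cond :: "nat \<Rightarrow> (((nat \<Rightarrow> real) \<Rightarrow> 'z) \<Rightarrow> bool) \<Rightarrow> bool" where
  "cube_cond m P \<longleftrightarrow> (\<forall>h k. (\<forall>x\<in>topspace (cube m). h x = k x) \<longrightarrow> P h \<longrightarrow> P k)"

lemma cube_homotopyI:
  assumes "cube_cond m P" "continuous_map (hcube m) Z h"
    and "\<And>x. x \<in> topspace (cube m) \<Longrightarrow> h (0, x) = f x"
    and "\<And>x. x \<in> topspace (cube m) \<Longrightarrow> h (1, x) = g x"
    and "\<And>t. 0 \<le> t \<Longrightarrow> t \<le> 1 \<Longrightarrow> P (\<lambda>x. h (t, x))"
  shows "homotopic_with P (cube m) Z f g"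
proof (subst homotopic_with)
  show "P h = P k" if "\<And>x. x \<in> topspace (cube m) \<Longrightarrow> h x = k x" for h k
    using assms(1) that unfolding cube_cond_def by metis
  show "\<exists>h. continuous_map (hcube m) Z h \<and> (\<forall>x\<in>topspace (cube m). h (0, x) = f x) \<and>
      (\<forall>x\<in>topspace (cube m). h (1, x) = g x) \<and> (\<forall>t\<in>{0..1}. P (\<lambda>x. h (t, x)))"
    using assms(2-) by (intro exI[of _ h]) simp
qed

lemma cube_homotopyE:
  assumes "homotopic_with P (cube m) Z f g"
  obtains h where "continuous_map (hcube m) Z h" "\<And>x. h (0, x) = f x" "\<And>x. h (1, x) = g x"
    "\<And>t. 0 \<le> t \<Longrightarrow> t \<le> 1 \<Longrightarrow> P (\<lambda>x. h (t, x))"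
  using assms unfolding homotopic_with_def by auto

abbreviation cube_restrict :: "nat \<Rightarrow> ((nat \<Rightarrow> real) \<Rightarrow> 'z) \<Rightarrow> (nat \<Rightarrow> real) \<Rightarrow> 'z" where
  "cube_restrict m f \<equiv> restrict f (topspace (cube m))"

lemma homotopic_cube_restrict:
  assumes "cube_cond m P" "continuous_map (cube m) Z f" "P f"
  shows "homotopic_with P (cube m) Z f (cube_restrict m f)"
proof (rule homotopic_with_equal)
  show "P (cube_restrict m f)"
    using assms(1,3) unfolding cube_cond_def by (metis restrict_apply')
qed (use assms in auto)

lemma homotopic_cube_restrict2:
  assumes "cube_cond m P" "homotopic_with P (cube m) Z f g"
  shows "homotopic_with P (cube m) Z (cube_restrict m f) (cube_restrict m g)"
proof -
  have "homotopic_with P (cube m) Z f (cube_restrict m f)" "homotopic_with P (cube m) Z g (cube_restrict m g)"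
    using assms homotopic_with_imp_continuous_maps[OF assms(2)] homotopic_with_imp_property[OF assms(2)]
    by (auto intro!: homotopic_cube_restrict)
  with assms(2) show ?thesis
    by (meson homotopic_with_symD homotopic_with_trans)
qed

lemma homotopic_cube_restrict_right:
  assumes "cube_cond m P" "homotopic_with P (cube m) Z f g"
  shows "homotopic_with P (cube m) Z f (cube_restrict m g)"
proof -
  have "homotopic_with P (cube m) Z g (cube_restrict m g)"
    using assms homotopic_with_imp_continuous_maps[OF assms(2)] homotopic_with_imp_property[OF assms(2)]
    by (intro homotopic_cube_restrict) simp_all
  then show ?thesis
    by (rule homotopic_with_trans[OF assms(2)])
qed

text \<open>A function is homotopic to itself exactly when it is continuous and satisfies
  \<open>P\<close>. In this form, closure of cube maps under an operation is the special case of
  homotopy invariance with equal ends.\<close>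

lemma cube_maps_iff:
  "f \<in> cube_maps m Z P \<longleftrightarrow> f \<in> extensional (topspace (cube m)) \<and> homotopic_with P (cube m) Z f f"
  by (simp add: cube_maps_def)

lemma cube_maps_homotopic_ext:
  assumes "homotopic_with P (cube m) Z f g"
  shows "f \<in> extensional (topspace (cube m)) \<Longrightarrow> f \<in> cube_maps m Z P"
    and "g \<in> extensional (topspace (cube m)) \<Longrightarrow> g \<in> cube_maps m Z P"
  using homotopic_with_imp_continuous_maps[OF assms] homotopic_with_imp_property[OF assms]
  by (auto simp: cube_maps_def)

lemma cube_maps_homotopic:
  assumes "cube_cond m P" "homotopic_with P (cube m) Z f g"
  shows "cube_restrict m f \<in> cube_maps m Z P" "cube_restrict m g \<in> cube_maps m Z P"
  using cube_maps_homotopic_ext[OF homotopic_cube_restrict2[OF assms]] by simp_all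

lemma cube_maps_restrictI:
  "\<lbrakk>cube_cond m P; continuous_map (cube m) Z f; P f\<rbrakk> \<Longrightarrow> cube_restrict m f \<in> cube_maps m Z P"
  using cube_maps_homotopic(1)[of m P Z f f] by simp

lemma cube_class_self: "f \<in> cube_maps m Z P \<Longrightarrow> f \<in> cube_class m Z P f"
  by (simp add: cube_class_def cube_maps_def)

lemma cube_class_eqI: "homotopic_with P (cube m) Z f g \<Longrightarrow> cube_class m Z P f = cube_class m Z P g"
  unfolding cube_class_def by (auto dest: homotopic_with_symD homotopic_with_trans)

lemma cube_class_eq_iff:
  assumes "g \<in> cube_maps m Z P"
  shows "cube_class m Z P f = cube_class m Z P g \<longleftrightarrow> homotopic_with P (cube m) Z f g"
proof
  assume "cube_class m Z P f = cube_class m Z P g"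
  then have "g \<in> cube_class m Z P f"
    using cube_class_self[OF assms] by simp
  then show "homotopic_with P (cube m) Z f g"
    by (simp add: cube_class_def)
qed (rule cube_class_eqI)

lemma cube_class_mem:
  "f' \<in> cube_class m Z P f \<longleftrightarrow> f' \<in> cube_maps m Z P \<and> homotopic_with P (cube m) Z f f'"
  by (simp add: cube_class_def)

lemma cube_class_sym: "f' \<in> cube_class m Z P f \<Longrightarrow> homotopic_with P (cube m) Z f' f"
  unfolding cube_class_mem by (elim conjE) (rule homotopic_with_symD)

lemma homotopy_setE:
  assumes "a \<in> homotopy_set m Z P"
  obtains f where "f \<in> cube_maps m Z P" "a = cube_class m Z P f"
  using assms by (auto simp: homotopy_set_def)

lemma homotopy_setI: "f \<in> cube_maps m Z P \<Longrightarrow> cube_class m Z P f \<in> homotopy_set m Z P"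
  by (auto simp: homotopy_set_def)

section \<open>Maps induced on classes\<close>

text \<open>One predicate for the three ways in which a map acts on classes: absolute to absolute,
  relative to relative, and absolute to relative.\<close>

definition cube_push ::
  "nat \<Rightarrow> 'y topology \<Rightarrow> (((nat \<Rightarrow> real) \<Rightarrow> 'y) \<Rightarrow> bool) \<Rightarrow> 'z topology
     \<Rightarrow> (((nat \<Rightarrow> real) \<Rightarrow> 'z) \<Rightarrow> bool) \<Rightarrow> ('y \<Rightarrow> 'z) \<Rightarrow> bool" where
  "cube_push m Y Q Z P \<phi> \<longleftrightarrow> cube_cond m P \<and> continuous_map Y Z \<phi> \<and> (\<forall>h. Q h \<longrightarrow> P (\<phi> \<circ> h))"

lemma cube_push_homotopic:
  assumes "cube_push m Y Q Z P \<phi>" "homotopic_with Q (cube m) Y f g"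
  shows "homotopic_with P (cube m) Z (\<phi> \<circ> f) (\<phi> \<circ> g)"
  using assms homotopic_with_compose_continuous_map_left[of Q "cube m" Y f g Z \<phi> P]
  by (auto simp: cube_push_def)

lemma cube_push_maps:
  assumes "cube_push m Y Q Z P \<phi>" "f \<in> cube_maps m Y Q"
  shows "cube_restrict m (\<phi> \<circ> f) \<in> cube_maps m Z P"
proof (rule cube_maps_homotopic(1))
  show "cube_cond m P" using assms(1) by (simp add: cube_push_def)
  show "homotopic_with P (cube m) Z (\<phi> \<circ> f) (\<phi> \<circ> f)"
    using assms(2) by (intro cube_push_homotopic[OF assms(1)]) (simp add: cube_maps_iff)
qed

text \<open>Homotopic representatives have homotopic images, so the union defining
  \<open>class_map\<close> has only one member. Concatenation and restriction to the face are
  evaluated on representatives by the same argument.\<close>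

lemma class_map_class:
  assumes "cube_push m Y Q Z P \<phi>" "f \<in> cube_maps m Y Q"
  shows "class_map m Z P \<phi> (cube_class m Y Q f) = cube_class m Z P (cube_restrict m (\<phi> \<circ> f))"
proof -
  have "cube_class m Z P (cube_restrict m (\<phi> \<circ> g)) = cube_class m Z P (cube_restrict m (\<phi> \<circ> f))"
    if "g \<in> cube_class m Y Q f" for g
  proof (intro cube_class_eqI homotopic_cube_restrict2)
    show "cube_cond m P" using assms(1) by (simp add: cube_push_def)
    show "homotopic_with P (cube m) Z (\<phi> \<circ> g) (\<phi> \<circ> f)"
      using that by (intro cube_push_homotopic[OF assms(1)] cube_class_sym)
  qed
  then show ?thesis
    using cube_class_self[OF assms(2)] unfolding class_map_def o_def
    by (intro SUP_eq_const) blast+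
qed

lemma class_map_in:
  assumes "cube_push m Y Q Z P \<phi>" "a \<in> homotopy_set m Y Q"
  shows "class_map m Z P \<phi> a \<in> homotopy_set m Z P"
  using assms by (auto elim!: homotopy_setE simp: class_map_class intro!: homotopy_setI cube_push_maps)

text \<open>Cubes take their values in \<open>topspace Y\<close>, so agreement of
  \<open>\<theta>\<close> with the composite is asked for only there.\<close>

lemma class_map_compose:
  assumes "cube_push m Y Q Z P \<phi>" "cube_push m Z P W R \<psi>" "cube_push m Y Q W R \<theta>"
    and "a \<in> homotopy_set m Y Q" and eq: "\<And>y. y \<in> topspace Y \<Longrightarrow> \<theta> y = \<psi> (\<phi> y)"
  shows "class_map m W R \<psi> (class_map m Z P \<phi> a) = class_map m W R \<theta> a"
proof -
  obtain f where f: "f \<in> cube_maps m Y Q" "a = cube_class m Y Q f"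
    using assms(4) by (rule homotopy_setE)
  have "f x \<in> topspace Y" if "x \<in> topspace (cube m)" for x
    using f(1) that continuous_map_funspace by (fastforce simp: cube_maps_def)
  then have "cube_restrict m (\<psi> \<circ> cube_restrict m (\<phi> \<circ> f)) = cube_restrict m (\<theta> \<circ> f)"
    by (auto simp: restrict_def eq)
  then show ?thesis
    using f assms by (simp add: class_map_class cube_push_maps)
qed

text \<open>\<open>cube_push\<close> quantifies over all functions, also those leaving the space,
  and cannot be derived for a \<open>\<phi>\<close> known to be the identity only on the space. The
  union is therefore evaluated directly.\<close>

lemma class_map_ident:
  assumes "cube_cond m P" "a \<in> homotopy_set m Z P" and eq: "\<And>y. y \<in> topspace Z \<Longrightarrow> \<phi> y = y"
  shows "class_map m Z P \<phi> a = a"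
proof -
  have eq': "cube_restrict m (\<phi> \<circ> f) = f" if "f \<in> cube_maps m Z P" for f
  proof
    fix x
    show "cube_restrict m (\<phi> \<circ> f) x = f x"
    proof (cases "x \<in> topspace (cube m)")
      case True
      then have "f x \<in> topspace Z"
        using that continuous_map_funspace by (fastforce simp: cube_maps_def)
      then show ?thesis using True eq by simp
    next
      case False
      then show ?thesis using that by (auto simp: cube_maps_def extensional_def)
    qed
  qed
  obtain f where f: "f \<in> cube_maps m Z P" "a = cube_class m Z P f"
    using assms(2) by (rule homotopy_setE)
  have "cube_class m Z P (cube_restrict m (\<phi> \<circ> g)) = a" if "g \<in> a" for g
  proof -
    have "g \<in> cube_maps m Z P" and hom: "homotopic_with P (cube m) Z f g"
      using that f by (simp_all add: cube_class_mem)
    then show ?thesis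
      using f eq'[of g] cube_class_eqI[OF hom] by simp
  qed
  moreover have "f \<in> a" using f cube_class_self by simp
  ultimately show ?thesis
    unfolding class_map_def o_def by (intro SUP_eq_const) blast+
qed

section \<open>Concatenation of cubes and its laws up to homotopy\<close>

text \<open>The conditions are kept apart because loops act on relative paths: there the factors
  satisfy different conditions, and the result is again relative.\<close>

definition concatenable where
  "concatenable m P1 P2 P \<longleftrightarrow> 0 < m \<and> (\<forall>f g. P1 f \<and> P2 g \<longrightarrow> P (cube_concat m f g) \<and>
     (\<forall>x\<in>topspace (cube m). f (x(0 := 1)) = g (x(0 := 0))))"

text \<open>The two homotopies are concatenated slice by slice. They match where the first
  coordinate is \<open>1/2\<close>, by the second half of \<open>concatenable\<close>.\<close>

lemma homotopic_cube_concat: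
  assumes "concatenable m P1 P2 P"
    and "homotopic_with P1 (cube m) Z f f'" "homotopic_with P2 (cube m) Z g g'"
  shows "homotopic_with P (cube m) Z (cube_concat m f g) (cube_concat m f' g')"
proof -
  have m: "0 < m" and C: "\<And>f g. P1 f \<Longrightarrow> P2 g \<Longrightarrow> P (cube_concat m f g)"
    "\<And>f g x. P1 f \<Longrightarrow> P2 g \<Longrightarrow> x \<in> topspace (cube m) \<Longrightarrow> f (x(0 := 1)) = g (x(0 := 0))"
    using assms(1) unfolding concatenable_def by blast+
  obtain h where h: "continuous_map (hcube m) Z h" "\<And>x. h (0, x) = f x" "\<And>x. h (1, x) = f' x"
    "\<And>t. 0 \<le> t \<Longrightarrow> t \<le> 1 \<Longrightarrow> P1 (\<lambda>x. h (t, x))"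
    using cube_homotopyE[OF assms(2)] by blast
  obtain k where k: "continuous_map (hcube m) Z k" "\<And>x. k (0, x) = g x" "\<And>x. k (1, x) = g' x"
    "\<And>t. 0 \<le> t \<Longrightarrow> t \<le> 1 \<Longrightarrow> P2 (\<lambda>x. k (t, x))"
    using cube_homotopyE[OF assms(3)] by blast
  let ?H = "\<lambda>w. if snd w 0 \<le> 1/2 then h (fst w, (snd w)(0 := 2 * snd w 0))
      else k (fst w, (snd w)(0 := 2 * snd w 0 - 1))"
  \<comment> \<open>\<open>?H\<close> and \<open>?K\<close> agree over the cube. Continuity is shown
    for \<open>?H\<close> by pasting; the boundary condition is read off from \<open>?K\<close>,
    whose slices are literally concatenations.\<close>
  let ?K = "\<lambda>w. cube_concat m (\<lambda>x. h (fst w, x)) (\<lambda>x. k (fst w, x)) (snd w)"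
  have c: "continuous_map (subtopology (hcube m) S) euclideanreal fst"
    "continuous_map (subtopology (hcube m) S) (cube m) snd"
    "continuous_map (subtopology (hcube m) S) euclideanreal (\<lambda>w. snd w 0)" for S
    using continuous_map_hcube_fst continuous_map_hcube_coord[OF m] continuous_map_snd
    by (blast intro: continuous_map_from_subtopology)+
  have "continuous_map (hcube m) Z ?H"
  proof (rule continuous_map_cases_le)
    show "continuous_map (hcube m) euclideanreal (\<lambda>w. snd w 0)"
      by (rule continuous_map_hcube_coord[OF m])
    show "continuous_map (subtopology (hcube m) {w \<in> topspace (hcube m). snd w 0 \<le> 1/2}) Z
        (\<lambda>w. h (fst w, (snd w)(0 := 2 * snd w 0)))"
      by (intro continuous_map_homotopy_compose[OF h(1)] continuous_map_cube_fun_upd c m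
          continuous_intros) (auto dest: cube_coord[OF _ m])
    show "continuous_map (subtopology (hcube m) {w \<in> topspace (hcube m). 1/2 \<le> snd w 0}) Z
        (\<lambda>w. k (fst w, (snd w)(0 := 2 * snd w 0 - 1)))"
      by (intro continuous_map_homotopy_compose[OF k(1)] continuous_map_cube_fun_upd c m
          continuous_intros) (auto dest: cube_coord[OF _ m])
    show "h (fst w, (snd w)(0 := 2 * snd w 0)) = k (fst w, (snd w)(0 := 2 * snd w 0 - 1))"
      if "w \<in> topspace (hcube m)" "snd w 0 = 1/2" for w
    proof -
      have "2 * snd w 0 = 1" "2 * snd w 0 - 1 = 0" using that(2) by simp_all
      then show ?thesis
        using that(1) C(2)[OF h(4) k(4), of "fst w" "fst w" "snd w"]
        by (simp add: topspace_prod_topology mem_Times_iff)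
    qed
  qed simp
  then have "continuous_map (hcube m) Z ?K"
    by (rule continuous_map_eq) (auto simp: cube_concat_def)
  then show ?thesis
    unfolding homotopic_with_def by (intro exI[of _ ?K]) (auto simp: h k C)
qed

lemma cube_concat_maps:
  assumes "concatenable m P1 P2 P" "f \<in> cube_maps m Z P1" "g \<in> cube_maps m Z P2"
  shows "cube_concat m f g \<in> cube_maps m Z P"
proof (rule cube_maps_homotopic_ext(1))
  show "homotopic_with P (cube m) Z (cube_concat m f g) (cube_concat m f g)"
    using assms(2,3) by (intro homotopic_cube_concat[OF assms(1)]) (simp_all add: cube_maps_iff)
qed (simp add: cube_concat_def)

lemma class_concat_class:
  assumes C: "concatenable m P1 P2 P" and f: "f \<in> cube_maps m Z P1" and g: "g \<in> cube_maps m Z P2"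
  shows "class_concat m Z P (cube_class m Z P1 f) (cube_class m Z P2 g) = cube_class m Z P (cube_concat m f g)"
proof -
  have "cube_class m Z P (cube_concat m f' g') = cube_class m Z P (cube_concat m f g)"
    if "f' \<in> cube_class m Z P1 f" "g' \<in> cube_class m Z P2 g" for f' g'
    using that by (intro cube_class_eqI homotopic_cube_concat[OF C] cube_class_sym)
  moreover have "f \<in> cube_class m Z P1 f" "g \<in> cube_class m Z P2 g"
    using f g by (auto intro: cube_class_self)
  ultimately show ?thesis
    unfolding class_concat_def by (intro SUP_eq_const) blast+
qed

lemma cube_concat_push:
  "0 < m \<Longrightarrow> cube_restrict m (\<phi> \<circ> cube_concat m f g) =
     cube_concat m (cube_restrict m (\<phi> \<circ> f)) (cube_restrict m (\<phi> \<circ> g))"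
  by (auto simp: cube_concat_def fun_eq_iff intro!: arg_cong[where f = \<phi>] cube_fun_upd dest: cube_coord)

lemma class_map_concat:
  assumes "concatenable m Q1 Q2 Q" "concatenable m P1 P2 P"
    and "cube_push m Y Q1 Z P1 \<phi>" "cube_push m Y Q2 Z P2 \<phi>" "cube_push m Y Q Z P \<phi>"
    and "a \<in> homotopy_set m Y Q1" "b \<in> homotopy_set m Y Q2"
  shows "class_map m Z P \<phi> (class_concat m Y Q a b) =
    class_concat m Z P (class_map m Z P1 \<phi> a) (class_map m Z P2 \<phi> b)"
proof -
  obtain f g where fg: "f \<in> cube_maps m Y Q1" "a = cube_class m Y Q1 f"
    "g \<in> cube_maps m Y Q2" "b = cube_class m Y Q2 g"
    using assms(6,7) by (metis homotopy_setE)
  have "0 < m" using assms(1) by (simp add: concatenable_def)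
  then show ?thesis
    using fg assms(1-5)
    by (simp add: class_concat_class class_map_class cube_push_maps cube_concat_maps cube_concat_push)
qed

text \<open>Both the absolute and the relative boundary conditions constrain the two faces on which cubes
  are concatenated by \<open>C\<close> and \<open>{z}\<close>, and the remaining faces independently of the first coordinate.\<close>

definition pcond :: "nat \<Rightarrow> 'z set \<Rightarrow> ((nat \<Rightarrow> real) \<Rightarrow> 'z set) \<Rightarrow> 'z \<Rightarrow> ((nat \<Rightarrow> real) \<Rightarrow> 'z) \<Rightarrow> bool" where
  "pcond m C D z f \<longleftrightarrow> (\<forall>x\<in>topspace (cube m).
     f x \<in> D x \<and> (x 0 = 0 \<longrightarrow> f x \<in> C) \<and> (x 0 = 1 \<longrightarrow> f x = z))"

lemma cube_cond_pcond: "cube_cond m (pcond m C D z)"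
  by (auto simp: cube_cond_def pcond_def)

text \<open>\<open>C\<close> is not fixed by the locale: relative paths and loops share one
  \<open>D\<close> but differ in \<open>C\<close>, and the action mixes both. Independence of
  \<open>D\<close> from the first coordinate makes reparametrizations of that coordinate
  admissible.\<close>

locale cube_layer =
  fixes m :: nat and D :: "(nat \<Rightarrow> real) \<Rightarrow> 'z set" and z :: 'z and Z :: "'z topology"
  assumes m: "0 < m" and D_upd: "D (x(0 := s)) = D x" and z_in: "z \<in> D x"
    and z_top: "z \<in> topspace Z"
begin

lemma concatenable_pcond: "concatenable m (pcond m C D z) (pcond m {z} D z) (pcond m C D z)"
  unfolding concatenable_def
proof (intro conjI allI impI m)
  fix f g assume "pcond m C D z f \<and> pcond m {z} D z g"
  then have f: "pcond m C D z f" and g: "pcond m {z} D z g" by auto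
  have f': "f (x(0 := s)) \<in> D x" "s = 0 \<Longrightarrow> f (x(0 := s)) \<in> C" "s = 1 \<Longrightarrow> f (x(0 := s)) = z"
    if "x \<in> topspace (cube m)" "0 \<le> s" "s \<le> 1" for x s
    using f cube_fun_upd[OF that(1) m that(2,3)] by (auto simp: pcond_def D_upd)
  have g': "g (x(0 := s)) \<in> D x" "s = 0 \<Longrightarrow> g (x(0 := s)) = z" "s = 1 \<Longrightarrow> g (x(0 := s)) = z"
    if "x \<in> topspace (cube m)" "0 \<le> s" "s \<le> 1" for x s
    using g cube_fun_upd[OF that(1) m that(2,3)] by (auto simp: pcond_def D_upd)
  show "\<forall>x\<in>topspace (cube m). f (x(0 := 1)) = g (x(0 := 0))"
    using f' g' by auto
  show "pcond m C D z (cube_concat m f g)"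
    unfolding pcond_def cube_concat_def
    using cube_coord[OF _ m] by (auto intro!: f' g')
qed

text \<open>A time-dependent change of the first coordinate leaves the constraint \<open>D\<close>
  intact, so only the two end faces have to be watched. The unit, associativity and inverse laws are
  instances with explicit \<open>H\<close>.\<close>

lemma homotopic_reparam:
  assumes f: "continuous_map (cube m) Z f" "pcond m C D z f"
    and H: "continuous_on UNIV (\<lambda>p. H (fst p) (snd p))"
    and H01: "\<And>t s. \<lbrakk>0 \<le> t; t \<le> 1; 0 \<le> s; s \<le> 1\<rbrakk> \<Longrightarrow> 0 \<le> H t s \<and> H t s \<le> (1::real)"
    and H0: "\<And>t x. \<lbrakk>0 \<le> t; t \<le> (1::real); x \<in> topspace (cube m)\<rbrakk> \<Longrightarrow> f (x(0 := H t 0)) \<in> C"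
    and H1: "\<And>t x. \<lbrakk>0 \<le> t; t \<le> 1; x \<in> topspace (cube m)\<rbrakk> \<Longrightarrow> f (x(0 := H t 1)) = z"
    and f0: "\<And>x. x \<in> topspace (cube m) \<Longrightarrow> f (x(0 := H 0 (x 0))) = f0 x"
    and f1: "\<And>x. x \<in> topspace (cube m) \<Longrightarrow> f (x(0 := H 1 (x 0))) = f1 x"
  shows "homotopic_with (pcond m C D z) (cube m) Z f0 f1"
proof (rule cube_homotopyI)
  let ?h = "\<lambda>w. f ((snd w)(0 := H (fst w) (snd w 0)))"
  have "continuous_map (hcube m) euclidean (\<lambda>w. (fst w, snd w 0))"
    using continuous_map_pairedI[OF continuous_map_hcube_fst continuous_map_hcube_coord[OF m]]
    by simp
  then have "continuous_map (hcube m) euclideanreal (\<lambda>w. H (fst w) (snd w 0))"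
    using continuous_map_compose[of "hcube m" euclidean "\<lambda>w. (fst w, snd w 0)" euclideanreal
        "\<lambda>p. H (fst p) (snd p)"] H
    by (simp add: o_def)
  then have "continuous_map (hcube m) (cube m) (\<lambda>w. (snd w)(0 := H (fst w) (snd w 0)))"
    using cube_coord[OF _ m] by (intro continuous_map_cube_fun_upd continuous_map_snd m) (auto simp: H01)
  then show "continuous_map (hcube m) Z ?h"
    using continuous_map_compose[OF _ f(1)] by (auto simp: o_def)
  show "cube_cond m (pcond m C D z)" by (rule cube_cond_pcond)
  show "pcond m C D z (\<lambda>x. ?h (t, x))" if t: "0 \<le> t" "t \<le> 1" for t
    unfolding pcond_def
  proof (intro ballI conjI impI)
    fix x assume x: "x \<in> topspace (cube m)"
    have "x(0 := H t (x 0)) \<in> topspace (cube m)"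
      using x t cube_coord[OF x m] H01 by (intro cube_fun_upd m) auto
    then show "?h (t, x) \<in> D x"
      using f(2) D_upd[of x] unfolding pcond_def by fastforce
  qed (use t H0 H1 in auto)
qed (use f0 f1 in auto)

text \<open>\<open>H\<close> is the straight line from the identity to \<open>\<phi>\<close>. It
  fixes 0 and 1 throughout, so the end faces never move.\<close>

lemma homotopic_reparam_fix:
  assumes f: "continuous_map (cube m) Z f" "pcond m C D z f"
    and \<phi>: "continuous_on UNIV \<phi>" "\<phi> 0 = 0" "\<phi> 1 = 1"
    and \<phi>01: "\<And>s. 0 \<le> s \<Longrightarrow> s \<le> 1 \<Longrightarrow> 0 \<le> \<phi> s \<and> \<phi> s \<le> (1::real)"
    and g: "\<And>x. x \<in> topspace (cube m) \<Longrightarrow> f (x(0 := \<phi> (x 0))) = g x"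
  shows "homotopic_with (pcond m C D z) (cube m) Z f g"
proof (rule homotopic_reparam[OF f, where H = "\<lambda>t s. (1 - t) * s + t * \<phi> s"])
  show "continuous_on UNIV (\<lambda>p. (1 - fst p) * snd p + fst p * \<phi> (snd p))"
    using continuous_on_compose2[OF \<phi>(1) continuous_on_snd[OF continuous_on_id], of UNIV]
    by (intro continuous_intros) auto
  show "0 \<le> (1 - t) * s + t * \<phi> s \<and> (1 - t) * s + t * \<phi> s \<le> 1"
    if "0 \<le> t" "t \<le> 1" "0 \<le> s" "s \<le> 1" for t s
    using that \<phi>01[of s] by (simp add: convex_bound_le)
qed (use f(2) \<phi> g cube_fun_upd[OF _ m] in \<open>auto simp: pcond_def\<close>)

lemma concat_assoc:
  assumes f: "f \<in> cube_maps m Z (pcond m C D z)"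
    and g: "g \<in> cube_maps m Z (pcond m {z} D z)" and h: "h \<in> cube_maps m Z (pcond m {z} D z)"
  shows "homotopic_with (pcond m C D z) (cube m) Z
    (cube_concat m f (cube_concat m g h)) (cube_concat m (cube_concat m f g) h)"
proof -
  have "cube_concat m f (cube_concat m g h) \<in> cube_maps m Z (pcond m C D z)"
    using f g h cube_concat_maps concatenable_pcond by metis
  then have F: "continuous_map (cube m) Z (cube_concat m f (cube_concat m g h))"
    "pcond m C D z (cube_concat m f (cube_concat m g h))"
    by (auto simp: cube_maps_def)
  show ?thesis
  \<comment> \<open>\<open>\<phi>\<close> carries the quarter, quarter and half of one bracketing
    onto the half, quarter and quarter of the other. The slopes 2, 1, 1/2 decrease, so this concave
    function is the minimum of its three linear pieces.\<close>
  proof (rule homotopic_reparam_fix[OF F, where \<phi> = "\<lambda>s. min (2 * s) (min (s + 1/4) ((s + 1) / 2))"])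
    show "continuous_on UNIV (\<lambda>s::real. min (2 * s) (min (s + 1/4) ((s + 1) / 2)))"
      by (intro continuous_intros) auto
    fix x assume x: "x \<in> topspace (cube m)"
    have x0: "0 \<le> x 0" "x 0 \<le> 1" using cube_coord[OF x m] by auto
    let ?\<phi> = "min (2 * x 0) (min (x 0 + 1/4) ((x 0 + 1) / 2))"
    have in_cube: "x(0 := s) \<in> topspace (cube m)" if "0 \<le> s" "s \<le> 1" for s
      using cube_fun_upd[OF x m that] .
    consider "x 0 \<le> 1/4" | "1/4 < x 0" "x 0 \<le> 1/2" | "1/2 < x 0" by linarith
    then show "cube_concat m f (cube_concat m g h) (x(0 := ?\<phi>)) = cube_concat m (cube_concat m f g) h x"
    proof cases
      case 1
      then have "?\<phi> = 2 * x 0" by auto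
      then show ?thesis using 1 x x0 by (simp add: cube_concat_def in_cube)
    next
      case 2
      then have "?\<phi> = x 0 + 1/4" by auto
      then show ?thesis using 2 x x0 by (simp add: cube_concat_def in_cube algebra_simps)
    next
      case 3
      define p where "p = (x 0 + 1) / 2"
      have p: "2 * p - 1 = x 0" "0 \<le> p" "p \<le> 1" "\<not> p \<le> 1/2"
        using 3 x0 by (simp_all add: p_def field_simps)
      have eq: "?\<phi> = p" using 3 by (auto simp: p_def)
      show ?thesis unfolding eq using 3 x p by (simp add: cube_concat_def in_cube)
    qed
  qed (auto simp: min_le_iff_disj)
qed

lemma const_cube_maps: "z \<in> C \<Longrightarrow> const_cube m z \<in> cube_maps m Z (pcond m C D z)"
proof -
  assume "z \<in> C"
  have "continuous_map (cube m) Z (const_cube m z)"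
    by (rule continuous_map_eq[of _ _ "\<lambda>_. z"]) (auto simp: const_cube_def z_top)
  then show ?thesis
    using \<open>z \<in> C\<close> by (auto simp: cube_maps_def pcond_def const_cube_def z_in)
qed

lemma concat_const_right:
  assumes f: "f \<in> cube_maps m Z (pcond m C D z)"
  shows "homotopic_with (pcond m C D z) (cube m) Z f (cube_concat m f (const_cube m z))"
proof -
  have F: "continuous_map (cube m) Z f" "pcond m C D z f"
    using f by (auto simp: cube_maps_def)
  show ?thesis
  \<comment> \<open>Run through \<open>f\<close> at double speed, then wait on the end face, where
    \<open>f\<close> is \<open>z\<close>.\<close>
  proof (rule homotopic_reparam_fix[OF F, where \<phi> = "\<lambda>s. min (2 * s) 1"])
    show "continuous_on UNIV (\<lambda>s::real. min (2 * s) 1)"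
      by (intro continuous_intros)
    fix x assume x: "x \<in> topspace (cube m)"
    have x0: "0 \<le> x 0" "x 0 \<le> 1" using cube_coord[OF x m] by auto
    have "f (x(0 := 1)) = z" "x(0 := 2 * x 0 - 1) \<in> topspace (cube m)" if "1/2 < x 0"
      using F(2) cube_fun_upd[OF x m] x0 that by (auto simp: pcond_def)
    then show "f (x(0 := min (2 * x 0) 1)) = cube_concat m f (const_cube m z) x"
      using x by (auto simp: cube_concat_def const_cube_def min_def)
  qed auto
qed

text \<open>Waiting at the beginning requires the start face to go to \<open>z\<close>. So this unit
  law concerns loops, whereas the right one holds for every \<open>C\<close>.\<close>

lemma concat_const_left:
  assumes f: "f \<in> cube_maps m Z (pcond m {z} D z)"
  shows "homotopic_with (pcond m {z} D z) (cube m) Z f (cube_concat m (const_cube m z) f)"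
proof -
  have F: "continuous_map (cube m) Z f" "pcond m {z} D z f"
    using f by (auto simp: cube_maps_def)
  show ?thesis
  proof (rule homotopic_reparam_fix[OF F, where \<phi> = "\<lambda>s. max 0 (2 * s - 1)"])
    show "continuous_on UNIV (\<lambda>s::real. max 0 (2 * s - 1))"
      by (intro continuous_intros)
    fix x assume x: "x \<in> topspace (cube m)"
    have x0: "0 \<le> x 0" "x 0 \<le> 1" using cube_coord[OF x m] by auto
    have "f (x(0 := 0)) = z" "x(0 := 2 * x 0) \<in> topspace (cube m)" if "x 0 \<le> 1/2"
      using F(2) cube_fun_upd[OF x m] x0 that by (auto simp: pcond_def)
    moreover have "max 0 (2 * x 0 - 1) = (if x 0 \<le> 1/2 then 0 else 2 * x 0 - 1)"
      by simp
    ultimately show "f (x(0 := max 0 (2 * x 0 - 1))) = cube_concat m (const_cube m z) f x"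
      using x by (simp add: cube_concat_def const_cube_def)
  qed auto
qed

lemma concat_inverse:
  assumes f: "f \<in> cube_maps m Z (pcond m {z} D z)"
  defines "g \<equiv> cube_restrict m (\<lambda>x. f (x(0 := 1 - x 0)))"
  shows "g \<in> cube_maps m Z (pcond m {z} D z)"
    and "homotopic_with (pcond m {z} D z) (cube m) Z (cube_concat m g f) (const_cube m z)"
proof -
  have F: "continuous_map (cube m) Z f" "pcond m {z} D z f"
    using f by (auto simp: cube_maps_def)
  have f0: "f (x(0 := 0)) = z" "f (x(0 := 1)) = z" if "x \<in> topspace (cube m)" for x
    using F(2) cube_fun_upd[OF that m] by (auto simp: pcond_def)
  have "homotopic_with (pcond m {z} D z) (cube m) Z g g"
    \<comment> \<open>A reparametrization that is constant in time: the homotopy of \<open>g\<close>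
      to itself encodes that \<open>g\<close> is an admissible cube.\<close>
    by (rule homotopic_reparam[OF F, where H = "\<lambda>t s. 1 - s"])
      (auto simp: f0 g_def intro!: continuous_intros)
  then show "g \<in> cube_maps m Z (pcond m {z} D z)"
    by (auto simp: cube_maps_iff g_def)
  show "homotopic_with (pcond m {z} D z) (cube m) Z (cube_concat m g f) (const_cube m z)"
  \<comment> \<open>The absolute value of \<open>2 * s - 1\<close> runs from 1 down to 0 and back,
    which traces \<open>g\<close> followed by \<open>f\<close>. Moving it linearly to the constant 1
    keeps both ends at 1, where \<open>f\<close> is \<open>z\<close>.\<close>
  proof (rule homotopic_reparam[OF F, where H = "\<lambda>t s. (1 - t) * \<bar>2 * s - 1\<bar> + t * 1"])
    show "continuous_on UNIV (\<lambda>p::real \<times> real. (1 - fst p) * \<bar>2 * snd p - 1\<bar> + fst p * 1)"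
      by (intro continuous_intros)
    show "0 \<le> (1 - t) * \<bar>2 * s - 1\<bar> + t * 1 \<and> (1 - t) * \<bar>2 * s - 1\<bar> + t * 1 \<le> 1"
      if "0 \<le> t" "t \<le> 1" "0 \<le> s" "s \<le> 1" for t s :: real
    proof
      show "0 \<le> (1 - t) * \<bar>2 * s - 1\<bar> + t * 1" using that by simp
      show "(1 - t) * \<bar>2 * s - 1\<bar> + t * 1 \<le> 1"
        using that by (intro convex_bound_le) (auto simp: abs_le_iff)
    qed
    fix x assume x: "x \<in> topspace (cube m)"
    have x0: "0 \<le> x 0" "x 0 \<le> 1" using cube_coord[OF x m] by auto
    show "f (x(0 := (1 - 1) * \<bar>2 * x 0 - 1\<bar> + 1 * 1)) = const_cube m z x"
      using x by (simp add: f0 const_cube_def)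
    have "x(0 := 2 * x 0) \<in> topspace (cube m)" if "x 0 \<le> 1/2"
      using x0 that by (intro cube_fun_upd x m) auto
    moreover have "\<bar>2 * x 0 - 1\<bar> = (if x 0 \<le> 1/2 then 1 - 2 * x 0 else 2 * x 0 - 1)"
      by simp
    ultimately show "f (x(0 := (1 - 0) * \<bar>2 * x 0 - 1\<bar> + 0 * 1)) = cube_concat m g f x"
      using x by (simp add: cube_concat_def g_def del: abs_minus_commute)
  qed (auto simp: f0)
qed

lemma class_concat_closed:
  assumes "a \<in> homotopy_set m Z (pcond m C D z)" "b \<in> homotopy_set m Z (pcond m {z} D z)"
  shows "class_concat m Z (pcond m C D z) a b \<in> homotopy_set m Z (pcond m C D z)"
  using assms class_concat_class[OF concatenable_pcond] cube_concat_maps[OF concatenable_pcond]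
  by (fastforce elim!: homotopy_setE intro: homotopy_setI)

lemma class_concat_assoc:
  assumes "a \<in> homotopy_set m Z (pcond m C D z)" "b \<in> homotopy_set m Z (pcond m {z} D z)"
    "c \<in> homotopy_set m Z (pcond m {z} D z)"
  shows "class_concat m Z (pcond m C D z) a (class_concat m Z (pcond m {z} D z) b c) =
    class_concat m Z (pcond m C D z) (class_concat m Z (pcond m C D z) a b) c"
proof -
  obtain f g h where "f \<in> cube_maps m Z (pcond m C D z)" "a = cube_class m Z (pcond m C D z) f"
    "g \<in> cube_maps m Z (pcond m {z} D z)" "b = cube_class m Z (pcond m {z} D z) g"
    "h \<in> cube_maps m Z (pcond m {z} D z)" "c = cube_class m Z (pcond m {z} D z) h"
    using assms by (metis homotopy_setE)
  then show ?thesis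
    using cube_class_eqI[OF concat_assoc[of f C g h]]
    by (simp add: class_concat_class[OF concatenable_pcond] cube_concat_maps[OF concatenable_pcond])
qed

lemma class_concat_one_right:
  assumes "a \<in> homotopy_set m Z (pcond m C D z)"
  shows "class_concat m Z (pcond m C D z) a (cube_class m Z (pcond m {z} D z) (const_cube m z)) = a"
proof -
  obtain f where "f \<in> cube_maps m Z (pcond m C D z)" "a = cube_class m Z (pcond m C D z) f"
    using assms by (metis homotopy_setE)
  then show ?thesis
    using cube_class_eqI[OF concat_const_right[of f C]] const_cube_maps[of "{z}"]
    by (metis class_concat_class[OF concatenable_pcond] singletonI)
qed

text \<open>A homotopy through loops is also one under the weaker start condition \<open>C\<close>.
  With \<open>C = B\<close> this computes the base point acted on by a loop: it is the loop regarded
  as a relative path.\<close>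

lemma class_concat_const_left:
  assumes "f \<in> cube_maps m Z (pcond m {z} D z)" "z \<in> C"
  shows "class_concat m Z (pcond m C D z) (cube_class m Z (pcond m C D z) (const_cube m z))
      (cube_class m Z (pcond m {z} D z) f) = cube_class m Z (pcond m C D z) f"
proof -
  have "homotopic_with (pcond m C D z) (cube m) Z f (cube_concat m (const_cube m z) f)"
    using concat_const_left[OF assms(1)]
    by (rule homotopic_with_mono) (use assms(2) in \<open>auto simp: pcond_def\<close>)
  then show ?thesis
    using assms by (simp add: class_concat_class[OF concatenable_pcond] const_cube_maps cube_class_eqI)
qed

text \<open>A left unit and left inverses suffice, so only the reversed cube followed by the cube
  itself has to be contracted.\<close>

lemma group_homotopy_group: "group (homotopy_group m Z (pcond m {z} D z) z)"
proof (rule groupI)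
  let ?G = "homotopy_group m Z (pcond m {z} D z) z"
  show "\<one>\<^bsub>?G\<^esub> \<in> carrier ?G"
    by (simp add: homotopy_group_def homotopy_setI const_cube_maps)
  show "\<one>\<^bsub>?G\<^esub> \<otimes>\<^bsub>?G\<^esub> x = x" if "x \<in> carrier ?G" for x
    using that class_concat_const_left[of _ "{z}"] by (auto simp: homotopy_group_def elim!: homotopy_setE)
  show "\<exists>y\<in>carrier ?G. y \<otimes>\<^bsub>?G\<^esub> x = \<one>\<^bsub>?G\<^esub>" if x: "x \<in> carrier ?G" for x
  proof -
    obtain f where f: "f \<in> cube_maps m Z (pcond m {z} D z)" "x = cube_class m Z (pcond m {z} D z) f"
      using x by (auto simp: homotopy_group_def elim: homotopy_setE)
    show ?thesis
      using concat_inverse[OF f(1)] f class_concat_class[OF concatenable_pcond concat_inverse(1)[OF f(1)] f(1)]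
      by (auto simp: homotopy_group_def cube_class_eqI intro!: bexI[OF _ homotopy_setI])
  qed
qed (auto simp: homotopy_group_def class_concat_closed class_concat_assoc)

end

section \<open>Compression of cubes in a pointed pair\<close>

lemma cube_Suc_fun_upd:
  "\<lbrakk>x \<in> topspace (cube k); 0 \<le> r; r \<le> 1\<rbrakk> \<Longrightarrow> x(k := r) \<in> topspace (cube (Suc k))"
  by (auto simp: topspace_cube PiE_iff extensional_def less_Suc_eq)

text \<open>Points of a cube are extensional, so the projection that forgets the last coordinate has
  to reset it to \<open>undefined\<close>.\<close>

lemma cube_Suc_drop: "x \<in> topspace (cube (Suc k)) \<Longrightarrow> x(k := undefined) \<in> topspace (cube k)"
  by (auto simp: topspace_cube PiE_iff extensional_def)

lemma continuous_map_cube_Suc_fun_upd: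
  assumes "continuous_map X (cube k) F" "continuous_map X euclideanreal r"
    and "\<And>x. x \<in> topspace X \<Longrightarrow> 0 \<le> r x \<and> r x \<le> 1"
  shows "continuous_map X (cube (Suc k)) (\<lambda>x. (F x)(k := r x))"
proof (rule continuous_map_cubeI)
  show "continuous_map X euclideanreal (\<lambda>x. ((F x)(k := r x)) i)" if "i < Suc k" for i
    using assms continuous_map_cube_coord[OF assms(1), of i] that by (cases "i = k") auto
  show "(F x)(k := r x) \<in> topspace (cube (Suc k))" if "x \<in> topspace X" for x
    using assms(3) that continuous_map_funspace[OF assms(1)] by (intro cube_Suc_fun_upd) auto
qed

lemma continuous_map_cube_Suc_drop:
  assumes "continuous_map X (cube (Suc k)) F"
  shows "continuous_map X (cube k) (\<lambda>x. (F x)(k := undefined))"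
proof (rule continuous_map_cubeI)
  show "continuous_map X euclideanreal (\<lambda>x. ((F x)(k := undefined)) i)" if "i < k" for i
    using continuous_map_cube_coord[OF assms, of i] that by simp
  show "(F x)(k := undefined) \<in> topspace (cube k)" if "x \<in> topspace X" for x
    using that continuous_map_funspace[OF assms] by (intro cube_Suc_drop) auto
qed

text \<open>The explicit set is closed and contains the boundary minus the bottom face. Conversely,
  a point of it on the bottom also lies on a side face, and raising its last coordinate slightly
  gives boundary points off the bottom that converge to it.\<close>

lemma cube_J_Suc:
  "cube_J (Suc k) = {x \<in> topspace (cube (Suc k)). x k = 1 \<or> (\<exists>i<k. x i = 0 \<or> x i = 1)}" (is "_ = ?T")
proof
  let ?S = "cube_boundary (Suc k) - cube_face (Suc k)"
  have closed: "closedin (cube (Suc k)) {x \<in> topspace (cube (Suc k)). x i \<in> {c}}" if "i < Suc k" for i and c :: real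
    using continuous_map_cube_coord[OF continuous_map_id[unfolded id_def] that]
    by (rule closedin_continuous_map_preimage) simp
  have "?T = {x \<in> topspace (cube (Suc k)). x k \<in> {1}} \<union>
     (\<Union>i<k. {x \<in> topspace (cube (Suc k)). x i \<in> {0}} \<union> {x \<in> topspace (cube (Suc k)). x i \<in> {1}})"
    by auto
  moreover have "closedin (cube (Suc k)) \<dots>"
    by (intro closedin_Un closedin_Union) (auto intro!: closed[simplified])
  ultimately have "closedin (cube (Suc k)) ?T"
    by simp
  moreover have "?S \<subseteq> ?T"
    by (auto simp: cube_boundary_def cube_face_def less_Suc_eq)
  ultimately show "cube_J (Suc k) \<subseteq> ?T"
    unfolding cube_J_def by (simp add: closure_of_minimal)
  show "?T \<subseteq> cube_J (Suc k)"
  proof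
    fix x assume x: "x \<in> ?T"
    show "x \<in> cube_J (Suc k)"
    proof (cases "x k = 0")
      case False
      then have "x \<in> ?S"
        using x by (auto simp: cube_boundary_def cube_face_def less_Suc_eq)
      then show ?thesis
        using closure_of_subset[of ?S "cube (Suc k)"] by (auto simp: cube_J_def cube_boundary_def)
    next
      case True
      let ?c = "\<lambda>t. x(k := t)"
      have "continuous_map (top_of_set {0..1}) (cube (Suc k)) (\<lambda>t. (x)(k := t))"
        using x by (intro continuous_map_cube_fun_upd) auto
      then have "?c ` (top_of_set {0..1} closure_of {0<..1}) \<subseteq> cube (Suc k) closure_of (?c ` {0<..1})"
        by (rule continuous_map_image_closure_subset)
      moreover have "0 \<in> top_of_set {0..1} closure_of {0<..1::real}"
      proof -
        have "\<exists>y. y \<in> {0<..1} \<and> y \<in> T" if T: "0 \<in> T" "openin (top_of_set {0..1::real}) T" for T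
        proof -
          obtain e where e: "0 < e" "\<And>y. y \<in> {0..1} \<Longrightarrow> dist y 0 < e \<Longrightarrow> y \<in> T"
            using T unfolding openin_euclidean_subtopology_iff by metis
          then have "min (e/2) 1 \<in> {0<..1} \<and> min (e/2) 1 \<in> T"
            by (auto simp: min_def intro!: e(2))
          then show ?thesis by blast
        qed
        then show ?thesis by (auto simp: in_closure_of)
      qed
      moreover have "?c ` {0<..1} \<subseteq> ?S"
        using x True by (auto simp: cube_boundary_def cube_face_def less_Suc_eq intro!: cube_fun_upd)
      then have "cube (Suc k) closure_of (?c ` {0<..1}) \<subseteq> cube_J (Suc k)"
        unfolding cube_J_def by (rule closure_of_mono)
      ultimately have "?c 0 \<in> cube_J (Suc k)" by blast
      then show ?thesis using True by (metis fun_upd_triv)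
    qed
  qed
qed

lemma abs_cond_iff:
  "abs_cond m z f \<longleftrightarrow> (\<forall>x\<in>topspace (cube m). (\<exists>i<m. x i = 0 \<or> x i = 1) \<longrightarrow> f x = z)"
  by (auto simp: abs_cond_def cube_boundary_def)

text \<open>Because \<open>z \<in> B\<close>, landing in \<open>B\<close> is a genuine condition on
  the distinguished face only: the remaining faces already go to \<open>z\<close>.\<close>

lemma rel_cond_iff:
  assumes "z \<in> B"
  shows "rel_cond (Suc k) B z f \<longleftrightarrow> (\<forall>x\<in>topspace (cube (Suc k)).
    (x k = 0 \<longrightarrow> f x \<in> B) \<and> (x k = 1 \<or> (\<exists>i<k. x i = 0 \<or> x i = 1) \<longrightarrow> f x = z))"
  using assms unfolding rel_cond_def cube_J_Suc cube_boundary_def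
  by (fastforce simp: less_Suc_eq image_subset_iff)

lemma cube_cond_abs_cond: "cube_cond m (abs_cond m z)"
  by (auto simp: cube_cond_def abs_cond_iff)

lemma cube_cond_rel_cond: "z \<in> B \<Longrightarrow> cube_cond (Suc k) (rel_cond (Suc k) B z)"
  by (auto simp: cube_cond_def rel_cond_iff)

lemma abs_cond_imp_rel_cond: "z \<in> B \<Longrightarrow> abs_cond (Suc k) z f \<Longrightarrow> rel_cond (Suc k) B z f"
  by (auto simp: abs_cond_iff rel_cond_iff less_Suc_eq)

locale pointed_pair =
  fixes Z :: "'z topology" and B :: "'z set" and z :: 'z
  assumes z_B: "z \<in> B" and B_Z: "B \<subseteq> topspace Z"
begin

abbreviation "ZB \<equiv> subtopology Z B"
abbreviation "rel k \<equiv> rel_cond (Suc k) B z"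
abbreviation "restrict_face k \<equiv> class_restrict_face (Suc k) ZB (abs_cond k z)"

lemma z_Z: "z \<in> topspace Z" and z_ZB: "z \<in> topspace ZB"
  using z_B B_Z by auto

lemma continuous_map_ZB: "continuous_map X ZB f \<longleftrightarrow> continuous_map X Z f \<and> f \<in> topspace X \<rightarrow> B"
  by (auto simp: continuous_map_in_subtopology)

lemmas rel_iff = rel_cond_iff[OF z_B]

text \<open>Slide the last coordinate up to 1. A cube lying entirely in \<open>B\<close> keeps its
  bottom face in \<open>B\<close> all the time, and its sides and top stay at
  \<open>z\<close>.\<close>

lemma rel_null_if_in_subspace:
  assumes "g \<in> cube_maps (Suc k) ZB (abs_cond (Suc k) z)"
  shows "homotopic_with (rel k) (cube (Suc k)) Z g (const_cube (Suc k) z)"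
proof (rule cube_homotopyI[OF cube_cond_rel_cond[OF z_B]])
  let ?h = "\<lambda>w. g ((snd w)(k := (1 - fst w) * snd w k + fst w))"
  have g: "continuous_map (cube (Suc k)) Z g" "g \<in> topspace (cube (Suc k)) \<rightarrow> B"
    "\<And>x i. x \<in> topspace (cube (Suc k)) \<Longrightarrow> i \<le> k \<Longrightarrow> x i = 0 \<or> x i = 1 \<Longrightarrow> g x = z"
    using assms by (auto simp: cube_maps_def continuous_map_ZB abs_cond_iff less_Suc_eq_le)
  have bd: "0 \<le> (1 - t) * s + t \<and> (1 - t) * s + t \<le> 1" if "0 \<le> s" "s \<le> 1" "0 \<le> t" "t \<le> 1" for s t :: real
    using that convex_bound_le[of s 1 1 "1 - t" t] by simp
  have "continuous_map (hcube (Suc k)) (cube (Suc k)) (\<lambda>w. (snd w)(k := (1 - fst w) * snd w k + fst w))"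
    using bd cube_coord
    by (intro continuous_map_cube_fun_upd continuous_map_snd continuous_intros continuous_map_hcube_fst
        continuous_map_hcube_coord) auto
  then show "continuous_map (hcube (Suc k)) Z ?h"
    using continuous_map_compose[OF _ g(1)] by (auto simp: o_def)
  show "?h (0, x) = g x" if "x \<in> topspace (cube (Suc k))" for x
    by simp
  show "?h (1, x) = const_cube (Suc k) z x" if "x \<in> topspace (cube (Suc k))" for x
    using that g(3)[of "x(k := 1)" k] by (simp add: const_cube_def cube_fun_upd)
  show "rel k (\<lambda>x. ?h (t, x))" if t: "0 \<le> t" "t \<le> 1" for t
    unfolding rel_iff
  proof (intro ballI conjI impI)
    fix x assume x: "x \<in> topspace (cube (Suc k))"
    then have x': "x(k := (1 - t) * x k + t) \<in> topspace (cube (Suc k))"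
      using t cube_coord[OF x, of k] bd by (intro cube_fun_upd) auto
    then show "?h (t, x) \<in> B" using g(2) by auto
    assume "x k = 1 \<or> (\<exists>i<k. x i = 0 \<or> x i = 1)"
    then show "?h (t, x) = z"
    proof
      assume "x k = 1"
      then show ?thesis using g(3)[OF x', of k] by simp
    next
      assume "\<exists>i<k. x i = 0 \<or> x i = 1"
      then obtain i where "i < k" "x i = 0 \<or> x i = 1" by blast
      then show ?thesis using g(3)[OF x', of i] by simp
    qed
  qed
qed

text \<open>Inside the square spanned by the homotopy parameter and the last coordinate, the segment from
  the corner \<open>(0, 0)\<close> to \<open>(0, 1)\<close> is rotated, its end point running along the two sides where
  the null homotopy is constant, into the segment to \<open>(1, 0)\<close>, which is mapped into \<open>B\<close>.\<close>

lemma rel_null_compress: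
  assumes f: "f \<in> cube_maps (Suc k) Z (abs_cond (Suc k) z)"
    and null: "homotopic_with (rel k) (cube (Suc k)) Z f (const_cube (Suc k) z)"
  shows "\<exists>g\<in>cube_maps (Suc k) ZB (abs_cond (Suc k) z).
    homotopic_with (abs_cond (Suc k) z) (cube (Suc k)) Z f g"
proof -
  let ?m = "Suc k"
  obtain H where H: "continuous_map (hcube ?m) Z H" "\<And>x. H (0, x) = f x"
    "\<And>x. H (1, x) = const_cube ?m z x" "\<And>t. 0 \<le> t \<Longrightarrow> t \<le> 1 \<Longrightarrow> rel_cond ?m B z (\<lambda>x. H (t, x))"
    using cube_homotopyE[OF null] by blast
  have HB: "H (t, x) \<in> B" if "0 \<le> t" "t \<le> 1" "x \<in> topspace (cube ?m)" "x k = 0" for t x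
    using H(4)[OF that(1,2)] that(3,4) by (simp add: rel_iff)
  have Hz: "H (t, x) = z" if "0 \<le> t" "t \<le> 1" "x \<in> topspace (cube ?m)" "x k = 1 \<or> (\<exists>i<k. x i = 0 \<or> x i = 1)" for t x
    using H(4)[OF that(1,2)] that(3,4) unfolding rel_iff by blast
  \<comment> \<open>The moving end point is \<open>(min 1 (2 * s), min 1 (2 - 2 * s))\<close>: it
    goes from \<open>(0, 1)\<close> to \<open>(1, 1)\<close> in the first half of the deformation
    and on to \<open>(1, 0)\<close> in the second. Scaling it by the last coordinate of the cube
    gives the segment.\<close>
  let ?p = "\<lambda>w. snd w k * min 1 (2 * fst w)" and ?q = "\<lambda>w. snd w k * min 1 (2 - 2 * fst w)"
  define F where "F = (\<lambda>w. H (?p w, (snd w)(k := ?q w)))"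
  have bd: "0 \<le> s * min 1 r \<and> s * min 1 r \<le> 1" if "0 \<le> s" "s \<le> 1" "0 \<le> r" for s r :: real
    using that by (auto intro!: mult_le_one simp: min_def)
  have contF: "continuous_map (hcube ?m) Z F"
    unfolding F_def using bd cube_coord
    by (intro continuous_map_homotopy_compose[OF H(1)] continuous_map_cube_fun_upd continuous_map_snd
        continuous_intros continuous_map_hcube_fst continuous_map_hcube_coord) auto
  have Fz: "abs_cond ?m z (\<lambda>x. F (s, x))" if s: "0 \<le> s" "s \<le> 1" for s
    unfolding abs_cond_iff
  proof (intro ballI impI, elim exE conjE)
    fix x i assume x: "x \<in> topspace (cube ?m)" and i: "i < ?m" "x i = 0 \<or> x i = 1"
    have pq: "0 \<le> x k * min 1 (2 * s)" "x k * min 1 (2 * s) \<le> 1"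
      "0 \<le> x k * min 1 (2 - 2 * s)" "x k * min 1 (2 - 2 * s) \<le> 1"
      using bd[of "x k" "2 * s"] bd[of "x k" "2 - 2 * s"] s cube_coord[OF x, of k] by auto
    have x': "x(k := x k * min 1 (2 - 2 * s)) \<in> topspace (cube ?m)"
      by (intro cube_fun_upd x pq) simp
    \<comment> \<open>Side faces are sent to \<open>z\<close> by \<open>H\<close> itself. The bottom
      is the fixed corner, where \<open>f\<close> is \<open>z\<close>. The top is the moving end
      point, which changes from one side of the square to the other at \<open>1/2\<close>.\<close>
    consider "i < k" | "x k = 0" | "x k = 1" using i less_Suc_eq by auto
    then show "F (s, x) = z"
    proof cases
      case 1
      then show ?thesis unfolding F_def using i(2) by (auto intro!: Hz pq x')
    next
      case 2
      then have "F (s, x) = f x" using H(2) by (simp add: F_def fun_upd_idem)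
      then show ?thesis using f x 2 by (auto simp: cube_maps_def abs_cond_iff)
    next
      case 3
      show ?thesis
      proof (cases "s \<le> 1/2")
        case True
        then have "min 1 (2 - 2 * s) = 1" by simp
        then show ?thesis unfolding F_def using pq x' 3 by (auto intro!: Hz)
      next
        case False
        then have "min 1 (2 * s) = 1" by simp
        then show ?thesis unfolding F_def using x' 3 H(3) by (simp add: const_cube_def)
      qed
    qed
  qed
  have F0: "F (0, x) = f x" for x
    using H(2) by (simp add: F_def)
  have "homotopic_with (abs_cond ?m z) (cube ?m) Z f (\<lambda>x. F (1, x))"
    unfolding homotopic_with_def using contF Fz F0 by (intro exI[of _ F]) auto
  then have hom: "homotopic_with (abs_cond ?m z) (cube ?m) Z f (cube_restrict ?m (\<lambda>x. F (1, x)))"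
    by (rule homotopic_cube_restrict_right[OF cube_cond_abs_cond])
  moreover have "cube_restrict ?m (\<lambda>x. F (1, x)) \<in> cube_maps ?m ZB (abs_cond ?m z)"
  proof -
    \<comment> \<open>At the end the segment has second coordinate 0, so only the bottom face of
      \<open>H\<close> is visited.\<close>
    have "F (1, x) \<in> B" if "x \<in> topspace (cube ?m)" for x
      unfolding F_def using cube_coord[OF that, of k] by (auto intro!: HB cube_fun_upd that)
    then show ?thesis
      using homotopic_with_imp_continuous_maps[OF hom] homotopic_with_imp_property[OF hom]
      by (auto simp: cube_maps_def continuous_map_ZB)
  qed
  ultimately show ?thesis by blast
qed

section \<open>Faces of relative cubes and null homotopies\<close>

definition face :: "nat \<Rightarrow> ((nat \<Rightarrow> real) \<Rightarrow> 'z) \<Rightarrow> (nat \<Rightarrow> real) \<Rightarrow> 'z" where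
  "face k f = cube_restrict k (\<lambda>x. f (x(k := 0)))"

text \<open>Every slice of a relative homotopy maps the bottom face into \<open>B\<close>, so its
  restriction is continuous into the subspace.\<close>

lemma face_homotopic:
  assumes "homotopic_with (rel k) (cube (Suc k)) Z f g"
  shows "homotopic_with (abs_cond k z) (cube k) ZB (face k f) (face k g)"
proof -
  obtain H where H: "continuous_map (hcube (Suc k)) Z H" "\<And>x. H (0, x) = f x" "\<And>x. H (1, x) = g x"
     "\<And>t. 0 \<le> t \<Longrightarrow> t \<le> 1 \<Longrightarrow> rel k (\<lambda>x. H (t, x))"
    using cube_homotopyE[OF assms] by blast
  let ?h = "\<lambda>w. H (fst w, (snd w)(k := 0))"
  show ?thesis
  proof (rule cube_homotopyI[OF cube_cond_abs_cond])
    have "continuous_map (hcube k) Z ?h"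
      by (intro continuous_map_homotopy_compose[OF H(1)] continuous_map_cube_Suc_fun_upd
          continuous_map_snd continuous_map_hcube_fst) auto
    then show "continuous_map (hcube k) ZB ?h"
      unfolding continuous_map_ZB using H(4) by (auto simp: rel_iff cube_Suc_fun_upd)
    show "abs_cond k z (\<lambda>x. ?h (t, x))" if "0 \<le> t" "t \<le> 1" for t
      unfolding abs_cond_iff
    proof (intro ballI impI)
      fix x assume "x \<in> topspace (cube k)" "\<exists>i<k. x i = 0 \<or> x i = 1"
      then have "x(k := 0) \<in> topspace (cube (Suc k))" "\<exists>i<k. (x(k := 0)) i = 0 \<or> (x(k := 0)) i = 1"
        by (auto intro: cube_Suc_fun_upd)
      then show "?h (t, x) = z" using H(4)[OF that] unfolding rel_iff fst_conv snd_conv by blast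
    qed
  qed (auto simp: face_def H)
qed

lemma face_maps:
  assumes "f \<in> cube_maps (Suc k) Z (rel k)"
  shows "face k f \<in> cube_maps k ZB (abs_cond k z)"
  using face_homotopic[of k f f] assms by (auto simp: cube_maps_iff face_def)

lemma class_restrict_face_class:
  assumes "f \<in> cube_maps (Suc k) Z (rel k)"
  shows "restrict_face k (cube_class (Suc k) Z (rel k) f) =
    cube_class k ZB (abs_cond k z) (face k f)"
proof -
  have "cube_class k ZB (abs_cond k z) (face k g) = cube_class k ZB (abs_cond k z) (face k f)"
    if "g \<in> cube_class (Suc k) Z (rel k) f" for g
    using that by (intro cube_class_eqI face_homotopic cube_class_sym)
  then show ?thesis
    using cube_class_self[OF assms] unfolding class_restrict_face_def diff_Suc_1 face_def[symmetric]
    by (intro SUP_eq_const) blast+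
qed

lemma face_abs:
  assumes "g \<in> cube_maps (Suc k) Z (abs_cond (Suc k) z)"
  shows "face k g = const_cube k z"
proof -
  have "g (x(k := 0)) = z" if "x \<in> topspace (cube k)" for x
  proof -
    have "\<exists>i<Suc k. (x(k := 0)) i = 0 \<or> (x(k := 0)) i = 1"
      by (intro exI[of _ k]) simp
    then show ?thesis
      using assms cube_Suc_fun_upd[OF that, of 0] by (simp add: cube_maps_def abs_cond_iff del: fun_upd_apply)
  qed
  then show ?thesis by (auto simp: face_def const_cube_def)
qed

text \<open>The null homotopy of the face, which runs inside \<open>B\<close>, is attached below the
  cube as a collar. Growing the collar moves the bottom face through \<open>B\<close> to the
  constant map; hence the deformation is relative and its end is absolute.\<close>

lemma face_null_absolute:
  assumes f: "f \<in> cube_maps (Suc k) Z (rel k)"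
    and null: "homotopic_with (abs_cond k z) (cube k) ZB (face k f) (const_cube k z)"
  shows "\<exists>g\<in>cube_maps (Suc k) Z (abs_cond (Suc k) z).
    homotopic_with (rel k) (cube (Suc k)) Z f g"
proof -
  let ?m = "Suc k"
  have fc: "continuous_map (cube ?m) Z f"
    and fB: "\<And>x. x \<in> topspace (cube ?m) \<Longrightarrow> x k = 0 \<Longrightarrow> f x \<in> B"
    and fz: "\<And>x. x \<in> topspace (cube ?m) \<Longrightarrow> x k = 1 \<or> (\<exists>i<k. x i = 0 \<or> x i = 1) \<Longrightarrow> f x = z"
    using f unfolding cube_maps_def rel_iff by blast+
  obtain K where K: "continuous_map (hcube k) ZB K" "\<And>x. K (0, x) = face k f x"
    "\<And>x. K (1, x) = const_cube k z x" "\<And>t. 0 \<le> t \<Longrightarrow> t \<le> 1 \<Longrightarrow> abs_cond k z (\<lambda>x. K (t, x))"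
    using cube_homotopyE[OF null] by blast
  have KZ: "continuous_map (hcube k) Z K" and KB: "\<And>t x. \<lbrakk>0 \<le> t; t \<le> 1; x \<in> topspace (cube k)\<rbrakk> \<Longrightarrow> K (t, x) \<in> B"
    using K(1) by (auto simp: continuous_map_ZB)
  have Kz: "K (t, x) = z" if "0 \<le> t" "t \<le> 1" "x \<in> topspace (cube k)" "\<exists>i<k. x i = 0 \<or> x i = 1" for t x
    using K(4)[OF that(1,2)] that(3,4) unfolding abs_cond_iff by blast
  let ?r = "\<lambda>w. (1 + fst w) * snd w k - fst w"
  \<comment> \<open>At time \<open>t\<close> the last coordinate is stretched onto
    \<open>[-t, 1]\<close>. Nonnegative values are read in \<open>f\<close>, negative ones as times
    of the null homotopy in the collar; at 0 both give the face of \<open>f\<close>.\<close>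
  define G where "G = (\<lambda>w. if 0 \<le> ?r w then f ((snd w)(k := ?r w)) else K (- ?r w, (snd w)(k := undefined)))"
  have bd: "- 1 \<le> (1 + t) * s - t" "(1 + t) * s - t \<le> 1" if "0 \<le> t" "t \<le> 1" "0 \<le> s" "s \<le> 1" for s t :: real
  proof -
    have "0 \<le> (1 + t) * s" using that by simp
    then show "- 1 \<le> (1 + t) * s - t" using that by linarith
    have "(1 + t) * s \<le> (1 + t) * 1" using that by (intro mult_left_mono) auto
    then show "(1 + t) * s - t \<le> 1" by simp
  qed
  have c: "continuous_map (subtopology (hcube ?m) S) euclideanreal fst"
    "continuous_map (subtopology (hcube ?m) S) (cube ?m) snd"
    "continuous_map (subtopology (hcube ?m) S) euclideanreal (\<lambda>w. snd w k)" for S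
    using continuous_map_hcube_fst continuous_map_hcube_coord[of k ?m] continuous_map_snd
    by (auto intro: continuous_map_from_subtopology)
  have contG: "continuous_map (hcube ?m) Z G"
    unfolding G_def
  proof (rule continuous_map_cases_le)
    show "continuous_map (hcube ?m) euclideanreal ?r"
      by (intro continuous_intros continuous_map_hcube_fst continuous_map_hcube_coord) simp
    have "continuous_map (subtopology (hcube ?m) {w \<in> topspace (hcube ?m). 0 \<le> ?r w}) (cube ?m)
        (\<lambda>w. (snd w)(k := ?r w))"
      by (intro continuous_map_cube_fun_upd c continuous_intros) (auto intro!: bd dest: cube_coord)
    then show "continuous_map (subtopology (hcube ?m) {w \<in> topspace (hcube ?m). 0 \<le> ?r w}) Z
        (\<lambda>w. f ((snd w)(k := ?r w)))"
      using continuous_map_compose[OF _ fc] by (auto simp: o_def)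
    show "continuous_map (subtopology (hcube ?m) {w \<in> topspace (hcube ?m). ?r w \<le> 0}) Z
        (\<lambda>w. K (- ?r w, (snd w)(k := undefined)))"
    proof (intro continuous_map_homotopy_compose[OF KZ] continuous_map_cube_Suc_drop c continuous_intros)
      fix w assume "w \<in> topspace (subtopology (hcube ?m) {w \<in> topspace (hcube ?m). ?r w \<le> 0})"
      then show "0 \<le> - ?r w \<and> - ?r w \<le> 1"
        using bd(1)[of "fst w" "snd w k"] cube_coord[of "snd w" ?m k] by auto
    qed simp
    show "f ((snd w)(k := ?r w)) = K (- ?r w, (snd w)(k := undefined))"
      if "w \<in> topspace (hcube ?m)" "0 = ?r w" for w
    proof -
      have "(snd w)(k := undefined) \<in> topspace (cube k)" using that(1) by (auto intro: cube_Suc_drop)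
      then show ?thesis using K(2) by (simp add: that(2)[symmetric] face_def)
    qed
  qed simp
  have Gz: "G (t, x) = z" if "0 \<le> t" "t \<le> 1" "x \<in> topspace (cube ?m)" "x k = 1 \<or> (\<exists>i<k. x i = 0 \<or> x i = 1)" for t x
  proof -
    have xk: "0 \<le> x k" "x k \<le> 1" using cube_coord[OF that(3), of k] by auto
    show ?thesis
    proof (cases "0 \<le> (1 + t) * x k - t")
      case True
      then have "x(k := (1 + t) * x k - t) \<in> topspace (cube ?m)"
        using that bd xk by (intro cube_fun_upd) auto
      then have "f (x(k := (1 + t) * x k - t)) = z"
        using that(4) by (intro fz) auto
      then show ?thesis using True by (simp add: G_def)
    next
      case False
      then have "\<exists>i<k. (x(k := undefined)) i = 0 \<or> (x(k := undefined)) i = 1"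
        using that(4) by auto
      then have "K (- ((1 + t) * x k - t), x(k := undefined)) = z"
        using that bd(1)[OF that(1,2) xk] False by (intro Kz cube_Suc_drop) auto
      then show ?thesis using False by (simp add: G_def)
    qed
  qed
  \<comment> \<open>On the bottom face the stretched coordinate is \<open>-t\<close>, so the slice
    is the null homotopy at time \<open>t\<close>, or \<open>f\<close> itself when
    \<open>t = 0\<close>.\<close>
  have GB: "G (t, x) \<in> B" if "0 \<le> t" "t \<le> 1" "x \<in> topspace (cube ?m)" "x k = 0" for t x
    using that by (auto simp: G_def intro!: fB KB cube_Suc_drop cube_fun_upd)
  have G1: "abs_cond ?m z (\<lambda>x. G (1, x))"
    unfolding abs_cond_iff
  proof (intro ballI impI, elim exE conjE)
    fix x i assume x: "x \<in> topspace (cube ?m)" and i: "i < ?m" "x i = 0 \<or> x i = 1"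
    show "G (1, x) = z"
    proof (cases "x k = 0")
      case True
      then show ?thesis using K(3) x by (simp add: G_def const_cube_def cube_Suc_drop)
    next
      case False
      then show ?thesis using Gz[of 1 x] x i less_Suc_eq by auto
    qed
  qed
  have G0: "G (0, x) = f x" if "x \<in> topspace (cube ?m)" for x
    using cube_coord[OF that, of k] by (simp add: G_def)
  have cond: "cube_cond ?m (rel_cond ?m B z)" by (rule cube_cond_rel_cond[OF z_B])
  have hom: "homotopic_with (rel_cond ?m B z) (cube ?m) Z f (\<lambda>x. G (1, x))"
    using G0 Gz GB by (intro cube_homotopyI[OF cond contG]) (auto simp: rel_iff)
  then have "homotopic_with (rel_cond ?m B z) (cube ?m) Z f (cube_restrict ?m (\<lambda>x. G (1, x)))"
    by (rule homotopic_cube_restrict_right[OF cond])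
  moreover have "cube_restrict ?m (\<lambda>x. G (1, x)) \<in> cube_maps ?m Z (abs_cond ?m z)"
    using G1 homotopic_with_imp_continuous_maps[OF hom]
    by (intro cube_maps_restrictI[OF cube_cond_abs_cond]) simp
  ultimately show ?thesis by blast
qed

text \<open>The relative cube is itself the null homotopy, with its last coordinate as time: it
  starts at the face and ends on the top, which goes to \<open>z\<close>.\<close>

lemma face_null:
  assumes "g \<in> cube_maps (Suc k) Z (rel k)"
  shows "homotopic_with (abs_cond k z) (cube k) Z (face k g) (const_cube k z)"
proof -
  have gc: "continuous_map (cube (Suc k)) Z g"
    and gz: "\<And>x. x \<in> topspace (cube (Suc k)) \<Longrightarrow> x k = 1 \<or> (\<exists>i<k. x i = 0 \<or> x i = 1) \<Longrightarrow> g x = z"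
    using assms unfolding cube_maps_def rel_iff by blast+
  let ?h = "\<lambda>w. g ((snd w)(k := fst w))"
  show ?thesis
  proof (rule cube_homotopyI[OF cube_cond_abs_cond])
    have "continuous_map (hcube k) (cube (Suc k)) (\<lambda>w. (snd w)(k := fst w))"
      by (intro continuous_map_cube_Suc_fun_upd continuous_map_snd continuous_map_hcube_fst) auto
    then show "continuous_map (hcube k) Z ?h"
      using continuous_map_compose[OF _ gc] by (auto simp: o_def)
    show "?h (1, x) = const_cube k z x" if "x \<in> topspace (cube k)" for x
      using that by (simp add: const_cube_def gz cube_Suc_fun_upd)
    show "abs_cond k z (\<lambda>x. ?h (t, x))" if "0 \<le> t" "t \<le> 1" for t
      unfolding abs_cond_iff using that by (auto intro!: gz cube_Suc_fun_upd)
  qed (auto simp: face_def)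
qed

text \<open>The correspondence read backwards: a null homotopy in the ambient space, with time as
  last coordinate, is a relative cube. Its face is \<open>f\<close> on the nose because both are
  extensional.\<close>

lemma null_imp_face:
  assumes f: "f \<in> cube_maps k ZB (abs_cond k z)"
    and null: "homotopic_with (abs_cond k z) (cube k) Z f (const_cube k z)"
  shows "\<exists>g\<in>cube_maps (Suc k) Z (rel k). face k g = f"
proof -
  let ?m = "Suc k"
  obtain H where H: "continuous_map (hcube k) Z H" "\<And>x. H (0, x) = f x"
    "\<And>x. H (1, x) = const_cube k z x" "\<And>t. 0 \<le> t \<Longrightarrow> t \<le> 1 \<Longrightarrow> abs_cond k z (\<lambda>x. H (t, x))"
    using cube_homotopyE[OF null] by blast
  have Hz: "H (t, x) = z" if "0 \<le> t" "t \<le> 1" "x \<in> topspace (cube k)" "\<exists>i<k. x i = 0 \<or> x i = 1" for t x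
    using H(4)[OF that(1,2)] that(3,4) unfolding abs_cond_iff by blast
  let ?g = "\<lambda>x. H (x k, x(k := undefined))"
  have "continuous_map (cube ?m) (cube ?m) (\<lambda>x. x)"
    using continuous_map_id[unfolded id_def] .
  then have cont: "continuous_map (cube ?m) Z ?g"
    using cube_coord by (intro continuous_map_homotopy_compose[OF H(1)] continuous_map_cube_Suc_drop
        continuous_map_cube_coord) auto
  have "rel_cond ?m B z ?g"
    unfolding rel_iff
  proof (intro ballI conjI impI)
    fix x assume x: "x \<in> topspace (cube ?m)"
    have d: "x(k := undefined) \<in> topspace (cube k)" using x by (rule cube_Suc_drop)
    have xk: "0 \<le> x k" "x k \<le> 1" using cube_coord[OF x, of k] by auto
    show "?g x \<in> B" if "x k = 0"
      using that d f H(2) by (auto simp: cube_maps_def continuous_map_ZB)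
    show "?g x = z" if "x k = 1 \<or> (\<exists>i<k. x i = 0 \<or> x i = 1)"
      using that
    proof
      assume "x k = 1"
      then show ?thesis using d H(3) by (simp add: const_cube_def)
    next
      assume "\<exists>i<k. x i = 0 \<or> x i = 1"
      then show ?thesis using d xk by (intro Hz) auto
    qed
  qed
  then have "cube_restrict ?m ?g \<in> cube_maps ?m Z (rel_cond ?m B z)"
    using cont by (intro cube_maps_restrictI[OF cube_cond_rel_cond[OF z_B]]) simp
  moreover have "face k (cube_restrict ?m ?g) = f"
  proof
    fix x
    show "face k (cube_restrict ?m ?g) x = f x"
    proof (cases "x \<in> topspace (cube k)")
      case True
      then have "x(k := undefined) = x"
        by (auto simp: topspace_cube PiE_iff extensional_def)
      then show ?thesis using True H(2) by (simp add: face_def cube_Suc_fun_upd)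
    next
      case False
      then show ?thesis using f by (auto simp: face_def cube_maps_def extensional_def)
    qed
  qed
  ultimately show ?thesis by blast
qed

end

section \<open>The exact sequence of a pointed pair\<close>

text \<open>The faces of all coordinates but the first go into \<open>D\<close>; the first is left
  to the two end conditions of \<open>pcond\<close>.\<close>

lemma abs_cond_pcond:
  assumes "0 < m"
  shows "abs_cond m z = pcond m {z} (\<lambda>x. if \<exists>i. 0 < i \<and> i < m \<and> (x i = 0 \<or> x i = 1) then {z} else UNIV) z"
proof
  fix f
  have "(\<exists>i<m. x i = 0 \<or> x i = 1) \<longleftrightarrow> x 0 = 0 \<or> x 0 = 1 \<or> (\<exists>i. 0 < i \<and> i < m \<and> (x i = 0 \<or> x i = 1))"
    for x :: "nat \<Rightarrow> real"
    using assms by (metis neq0_conv)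
  then show "abs_cond m z f = pcond m {z} (\<lambda>x. if \<exists>i. 0 < i \<and> i < m \<and> (x i = 0 \<or> x i = 1) then {z} else UNIV) z f"
    unfolding abs_cond_iff pcond_def by auto
qed

text \<open>\<open>D\<close> is the same as for relative paths, so loops and relative paths live in
  one \<open>cube_layer\<close>.\<close>

lemma abs_cond_1_pcond: "abs_cond (Suc 0) z = pcond (Suc 0) {z} (\<lambda>_. UNIV) z"
  by (auto simp: abs_cond_iff pcond_def fun_eq_iff)

lemma rel_cond_1_pcond: "z \<in> B \<Longrightarrow> rel_cond (Suc 0) B z = pcond (Suc 0) B (\<lambda>_. UNIV) z"
  by (auto simp: rel_cond_iff pcond_def fun_eq_iff)

text \<open>For \<open>0 < k\<close> the distinguished coordinate \<open>k\<close> differs from the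
  concatenation coordinate 0, so the bottom face belongs to \<open>D\<close> and both end faces go
  to \<open>z\<close>. In degree one the two coordinates coincide and \<open>B\<close> becomes the
  start condition.\<close>

lemma rel_cond_pcond:
  assumes "0 < k" "z \<in> B"
  shows "rel_cond (Suc k) B z = pcond (Suc k) {z} (\<lambda>x. {y. (x k = 0 \<longrightarrow> y \<in> B) \<and>
    (x k = 1 \<or> (\<exists>i. 0 < i \<and> i < k \<and> (x i = 0 \<or> x i = 1)) \<longrightarrow> y = z)}) z"
proof
  fix f
  have *: "(\<exists>i<k. x i = 0 \<or> x i = 1) \<longleftrightarrow> x 0 = 0 \<or> x 0 = 1 \<or> (\<exists>i. 0 < i \<and> i < k \<and> (x i = 0 \<or> x i = 1))"
    for x :: "nat \<Rightarrow> real"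
    using assms(1) by (metis neq0_conv)
  show "rel_cond (Suc k) B z f = pcond (Suc k) {z} (\<lambda>x. {y. (x k = 0 \<longrightarrow> y \<in> B) \<and>
    (x k = 1 \<or> (\<exists>i. 0 < i \<and> i < k \<and> (x i = 0 \<or> x i = 1)) \<longrightarrow> y = z)}) z f"
    unfolding rel_cond_iff[OF assms(2)] pcond_def
  proof (rule ball_cong[OF refl])
    fix x
    show "((x k = 0 \<longrightarrow> f x \<in> B) \<and> (x k = 1 \<or> (\<exists>i<k. x i = 0 \<or> x i = 1) \<longrightarrow> f x = z)) =
      (f x \<in> {y. (x k = 0 \<longrightarrow> y \<in> B) \<and>
         (x k = 1 \<or> (\<exists>i. 0 < i \<and> i < k \<and> (x i = 0 \<or> x i = 1)) \<longrightarrow> y = z)} \<and>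
       (x 0 = 0 \<longrightarrow> f x \<in> {z}) \<and> (x 0 = 1 \<longrightarrow> f x = z))"
      unfolding *[of x] mem_Collect_eq singleton_iff by argo
  qed
qed

lemma cube_layer_abs:
  "\<lbrakk>0 < m; z \<in> topspace Z\<rbrakk> \<Longrightarrow>
    cube_layer m (\<lambda>x. if \<exists>i. 0 < i \<and> i < m \<and> (x i = 0 \<or> x i = 1) then {z} else UNIV) z Z"
  by unfold_locales auto

lemma cube_layer_UNIV: "z \<in> topspace Z \<Longrightarrow> cube_layer (Suc 0) (\<lambda>_. UNIV) z Z"
  by unfold_locales auto

lemma cube_layer_rel:
  "\<lbrakk>0 < k; z \<in> B; z \<in> topspace Z\<rbrakk> \<Longrightarrow> cube_layer (Suc k) (\<lambda>x. {y. (x k = 0 \<longrightarrow> y \<in> B) \<and>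
    (x k = 1 \<or> (\<exists>i. 0 < i \<and> i < k \<and> (x i = 0 \<or> x i = 1)) \<longrightarrow> y = z)}) z Z"
  by unfold_locales auto

text \<open>\<open>concatenable\<close> mentions no space, but \<open>cube_layer\<close> asks for
  one containing the base point; the discrete space on the whole type serves for every
  \<open>z\<close>.\<close>

lemma concatenable_abs: "0 < m \<Longrightarrow> concatenable m (abs_cond m z) (abs_cond m z) (abs_cond m z)"
  unfolding abs_cond_pcond
  by (rule cube_layer.concatenable_pcond[OF cube_layer_abs[of _ _ "discrete_topology UNIV"]]) auto

lemma concatenable_rel:
  "\<lbrakk>0 < k; z \<in> B\<rbrakk> \<Longrightarrow> concatenable (Suc k) (rel_cond (Suc k) B z) (rel_cond (Suc k) B z) (rel_cond (Suc k) B z)"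
  unfolding rel_cond_pcond
  by (rule cube_layer.concatenable_pcond[OF cube_layer_rel[of _ _ _ "discrete_topology UNIV"]]) auto

lemma concatenable_rel_abs:
  "z \<in> B \<Longrightarrow> concatenable (Suc 0) (rel_cond (Suc 0) B z) (abs_cond (Suc 0) z) (rel_cond (Suc 0) B z)"
  unfolding rel_cond_1_pcond abs_cond_1_pcond
  by (rule cube_layer.concatenable_pcond[OF cube_layer_UNIV[of _ "discrete_topology UNIV"]]) auto

lemma group_homotopy_group_abs:
  "\<lbrakk>0 < m; z \<in> topspace Z\<rbrakk> \<Longrightarrow> group (homotopy_group m Z (abs_cond m z) z)"
  unfolding abs_cond_pcond by (rule cube_layer.group_homotopy_group[OF cube_layer_abs])

lemma group_homotopy_group_rel:
  "\<lbrakk>0 < k; z \<in> B; z \<in> topspace Z\<rbrakk> \<Longrightarrow> group (homotopy_group (Suc k) Z (rel_cond (Suc k) B z) z)"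
  unfolding rel_cond_pcond by (rule cube_layer.group_homotopy_group[OF cube_layer_rel])

lemma const_cube_abs: "z \<in> topspace Z \<Longrightarrow> const_cube m z \<in> cube_maps m Z (abs_cond m z)"
  unfolding const_cube_def
  by (rule cube_maps_restrictI[OF cube_cond_abs_cond]) (auto simp: abs_cond_iff)

lemma const_cube_rel:
  "\<lbrakk>z \<in> B; z \<in> topspace Z\<rbrakk> \<Longrightarrow> const_cube (Suc k) z \<in> cube_maps (Suc k) Z (rel_cond (Suc k) B z)"
  unfolding const_cube_def
  by (rule cube_maps_restrictI[OF cube_cond_rel_cond]) (auto simp: rel_cond_iff)

lemma cube_restrict_const: "cube_restrict m (\<phi> \<circ> const_cube m y) = const_cube m (\<phi> y)"
  by (auto simp: const_cube_def)

lemma pset_homotopy_action [simp]: "pset (homotopy_action m Z z) = homotopy_set m Z (abs_cond m z)"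
  and bpt_homotopy_action [simp]:
    "bpt (homotopy_action m Z z) = cube_class m Z (abs_cond m z) (const_cube m z)"
  by (auto simp: homotopy_action_def pset_action_def group_action_of_def homotopy_group_def)

lemma pset_rel_homotopy_action [simp]: "pset (rel_homotopy_action m Z B z) = homotopy_set m Z (rel_cond m B z)"
  and bpt_rel_homotopy_action [simp]:
    "bpt (rel_homotopy_action m Z B z) = cube_class m Z (rel_cond m B z) (const_cube m z)"
  by (auto simp: rel_homotopy_action_def group_action_of_def homotopy_group_def)

text \<open>In degree 0 the group is trivial and carried by the base point; in higher degrees its
  carrier is the set acted on. Either way facts about classes apply to group elements.\<close>

lemma grp_homotopy_action_subset:
  "z \<in> topspace Z \<Longrightarrow> carrier (grp (homotopy_action m Z z)) \<subseteq> homotopy_set m Z (abs_cond m z)"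
  by (auto simp: homotopy_action_def pset_action_def group_action_of_def homotopy_group_def
      singleton_group_def const_cube_abs intro: homotopy_setI)

lemma homotopy_action_pos:
  "0 < m \<Longrightarrow> homotopy_action m Z z = group_action_of (homotopy_group m Z (abs_cond m z) z)"
  by (simp add: homotopy_action_def)

lemma rel_homotopy_action_Suc:
  "0 < k \<Longrightarrow> rel_homotopy_action (Suc k) Z B z = group_action_of (homotopy_group (Suc k) Z (rel_cond (Suc k) B z) z)"
  by (simp add: rel_homotopy_action_def)

lemma is_action_homotopy_action:
  assumes "z \<in> topspace Z"
  shows "is_action (homotopy_action m Z z)"
proof (cases "m = 0")
  case True
  then show ?thesis
    using assms by (auto simp: homotopy_action_def const_cube_abs intro!: is_action_pset_action homotopy_setI)
next
  case False
  then show ?thesis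
    using assms by (auto simp: homotopy_action_def intro!: is_action_group_action_of group_homotopy_group_abs)
qed

lemma is_action_rel_homotopy_action:
  assumes "z \<in> B" "z \<in> topspace Z"
  shows "is_action (rel_homotopy_action (Suc k) Z B z)"
proof (cases "k = 0")
  case True
  \<comment> \<open>Both conditions have \<open>D = UNIV\<close> here: the set acted on has
    \<open>C = B\<close>, the acting loops have \<open>C = {z}\<close>.\<close>
  interpret cube_layer "Suc 0" "\<lambda>_. UNIV" z Z
    by (rule cube_layer_UNIV) fact
  have "group (homotopy_group (Suc 0) Z (abs_cond (Suc 0) z) z)"
    using assms by (intro group_homotopy_group_abs) auto
  then show ?thesis
    unfolding True rel_homotopy_action_def is_action_def
    using const_cube_maps[OF assms(1)] class_concat_closed[of _ B] class_concat_assoc[of _ B]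
      class_concat_one_right[of _ B]
    by (simp add: homotopy_group_def abs_cond_1_pcond rel_cond_1_pcond[OF assms(1)] homotopy_setI)
next
  case False
  then show ?thesis
    using assms by (auto simp: rel_homotopy_action_Suc intro!: is_action_group_action_of group_homotopy_group_rel)
qed

section \<open>Morphisms induced by maps of pointed pairs\<close>

lemma is_action_mor_group:
  assumes "group G" "group H" "k \<in> hom G H"
  shows "is_action_mor (mk_action_mor (group_action_of G) (group_action_of H) k k)"
  using assms hom_one[OF assms(3,1,2)] assms(1,2)[THEN is_action_group_action_of]
  unfolding is_action_mor_mk_iff by (auto simp: group_action_of_def hom_def)

lemma is_action_mor_pset:
  assumes "z \<in> S" "w \<in> T" "k \<in> S \<rightarrow> T" "k z = w"
  shows "is_action_mor (mk_action_mor (pset_action S z) (pset_action T w) k k)"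
  using assms assms(1,2)[THEN is_action_pset_action]
  unfolding is_action_mor_mk_iff by (auto simp: pset_action_def hom_def singleton_group_def)

lemma class_map_hom:
  assumes "concatenable m Q Q Q" "concatenable m P P P" "cube_push m Y Q Z P \<phi>"
  shows "class_map m Z P \<phi> \<in> hom (homotopy_group m Y Q y) (homotopy_group m Z P z)"
  using class_map_concat[OF assms(1,2) assms(3) assms(3) assms(3)] class_map_in[OF assms(3)]
  by (auto simp: hom_def homotopy_group_def)

lemma cube_push_abs:
  "\<lbrakk>continuous_map Y Z \<phi>; \<phi> y = z\<rbrakk> \<Longrightarrow> cube_push m Y (abs_cond m y) Z (abs_cond m z) \<phi>"
  by (auto simp: cube_push_def cube_cond_abs_cond abs_cond_iff)

lemma cube_push_rel:
  "\<lbrakk>continuous_map Y Z \<phi>; \<phi> y = z; \<phi> ` C \<subseteq> B; y \<in> C; z \<in> B\<rbrakk>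
    \<Longrightarrow> cube_push (Suc k) Y (rel_cond (Suc k) C y) Z (rel_cond (Suc k) B z) \<phi>"
  by (fastforce simp: cube_push_def cube_cond_rel_cond rel_cond_iff)

lemma cube_push_abs_rel:
  "\<lbrakk>continuous_map Y Z \<phi>; \<phi> y = z; z \<in> B\<rbrakk>
    \<Longrightarrow> cube_push (Suc k) Y (abs_cond (Suc k) y) Z (rel_cond (Suc k) B z) \<phi>"
  by (auto simp: cube_push_def cube_cond_rel_cond rel_cond_iff abs_cond_iff less_Suc_eq)

lemma class_map_const:
  assumes "cube_push m Y Q Z P \<phi>" "const_cube m y \<in> cube_maps m Y Q" "\<phi> y = z"
  shows "class_map m Z P \<phi> (cube_class m Y Q (const_cube m y)) = cube_class m Z P (const_cube m z)"
  using class_map_class[OF assms(1,2)] assms(3) by (simp add: cube_restrict_const)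

text \<open>Covers the inclusion of the subspace as well as the arrows of the absolute systems, so
  one composition law yields both functoriality and naturality.\<close>

definition induced_abs ::
  "nat \<Rightarrow> 'y topology \<Rightarrow> 'y \<Rightarrow> 'z topology \<Rightarrow> 'z \<Rightarrow> ('y \<Rightarrow> 'z)
    \<Rightarrow> ('y cubes, 'y cubes, 'z cubes, 'z cubes) action_mor" where
  "induced_abs m Y y Z z \<phi> = mk_action_mor (homotopy_action m Y y) (homotopy_action m Z z)
     (class_map m Z (abs_cond m z) \<phi>) (class_map m Z (abs_cond m z) \<phi>)"

definition induced_rel ::
  "nat \<Rightarrow> 'y topology \<Rightarrow> 'y set \<Rightarrow> 'y \<Rightarrow> 'z topology \<Rightarrow> 'z set \<Rightarrow> 'z \<Rightarrow> ('y \<Rightarrow> 'z)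
    \<Rightarrow> ('y cubes, 'y cubes, 'z cubes, 'z cubes) action_mor" where
  "induced_rel m Y C y Z B z \<phi> =
     mk_action_mor (rel_homotopy_action m Y C y) (rel_homotopy_action m Z B z)
       (class_map m Z (rel_cond m B z) \<phi>)
       (if m = 1 then class_map m Z (abs_cond m z) \<phi> else class_map m Z (rel_cond m B z) \<phi>)"

lemma is_action_mor_induced_abs:
  assumes "continuous_map Y Z \<phi>" "\<phi> y = z" "y \<in> topspace Y"
  shows "is_action_mor (induced_abs m Y y Z z \<phi>)"
proof -
  have z: "z \<in> topspace Z" using assms continuous_map_funspace by fastforce
  have push: "cube_push m Y (abs_cond m y) Z (abs_cond m z) \<phi>"
    by (rule cube_push_abs) fact+
  show ?thesis
  proof (cases "m = 0")
    case True
    have "cube_class 0 Z (abs_cond 0 z) (const_cube 0 z) \<in> homotopy_set 0 Z (abs_cond 0 z)"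
      "cube_class 0 Y (abs_cond 0 y) (const_cube 0 y) \<in> homotopy_set 0 Y (abs_cond 0 y)"
      using assms z by (auto intro!: homotopy_setI const_cube_abs)
    then show ?thesis
      using push class_map_const[OF push const_cube_abs[OF assms(3)] assms(2)] True
      by (auto simp: induced_abs_def homotopy_action_def intro!: is_action_mor_pset class_map_in)
  next
    case False
    then show ?thesis
      using push assms z
      by (auto simp: induced_abs_def homotopy_action_def intro!: is_action_mor_group
          group_homotopy_group_abs class_map_hom concatenable_abs)
  qed
qed

lemma is_action_mor_induced_rel:
  assumes "continuous_map Y Z \<phi>" "\<phi> y = z" "\<phi> ` C \<subseteq> B" "y \<in> C" "y \<in> topspace Y"
  shows "is_action_mor (induced_rel (Suc k) Y C y Z B z \<phi>)"
proof -
  have z: "z \<in> B" "z \<in> topspace Z" using assms continuous_map_funspace by fastforce+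
  have push: "cube_push (Suc k) Y (rel_cond (Suc k) C y) Z (rel_cond (Suc k) B z) \<phi>"
    by (rule cube_push_rel) fact+
  show ?thesis
  proof (cases "k = 0")
    case True
    have apush: "cube_push (Suc 0) Y (abs_cond (Suc 0) y) Z (abs_cond (Suc 0) z) \<phi>"
      by (rule cube_push_abs) fact+
    have push': "cube_push (Suc 0) Y (rel_cond (Suc 0) C y) Z (rel_cond (Suc 0) B z) \<phi>"
      using push True by simp
    have "class_map (Suc 0) Z (abs_cond (Suc 0) z) \<phi> \<in>
        hom (homotopy_group (Suc 0) Y (abs_cond (Suc 0) y) y) (homotopy_group (Suc 0) Z (abs_cond (Suc 0) z) z)"
      by (rule class_map_hom[OF concatenable_abs concatenable_abs apush]) auto
    then show ?thesis
      using is_action_rel_homotopy_action[OF assms(4,5), of 0] is_action_rel_homotopy_action[OF z, of 0]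
        class_map_in[OF push'] class_map_const[OF push' const_cube_rel[OF assms(4,5)] assms(2)]
        class_map_concat[OF concatenable_rel_abs[OF assms(4)] concatenable_rel_abs[OF z(1)] push' apush push']
      unfolding True induced_rel_def is_action_mor_mk_iff
      by (simp add: rel_homotopy_action_def homotopy_group_def Pi_iff)
  next
    case False
    then show ?thesis
      using push assms z
      by (auto simp: induced_rel_def rel_homotopy_action_Suc intro!: is_action_mor_group
          group_homotopy_group_rel class_map_hom concatenable_rel)
  qed
qed

lemma action_comp_mk_mor:
  assumes "is_action_mor (mk_action_mor S T a b)"
    and "\<And>s. s \<in> pset S \<Longrightarrow> a' (a s) = c s" "\<And>g. g \<in> carrier (grp S) \<Longrightarrow> b' (b g) = d g"
  shows "action_comp (mk_action_mor S T a b) (mk_action_mor T U a' b') = mk_action_mor S U c d"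
  using assms unfolding is_action_mor_mk_iff
  by (subst action_comp_mk) (auto simp: hom_def intro!: mk_action_mor_cong)

lemma action_comp_mk_mor_eq:
  assumes "is_action_mor (mk_action_mor S T a b)" "is_action_mor (mk_action_mor S T' c d)"
    and "\<And>s. s \<in> pset S \<Longrightarrow> a' (a s) = c' (c s)" "\<And>g. g \<in> carrier (grp S) \<Longrightarrow> b' (b g) = d' (d g)"
  shows "action_comp (mk_action_mor S T a b) (mk_action_mor T U a' b') =
    action_comp (mk_action_mor S T' c d) (mk_action_mor T' U c' d')"
  using action_comp_mk_mor[OF assms(1), of a' "\<lambda>s. c' (c s)" b' "\<lambda>g. d' (d g)"]
    action_comp_mk_mor[OF assms(2), of c' "\<lambda>s. c' (c s)" d' "\<lambda>g. d' (d g)"] assms(3,4)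
  by simp

text \<open>\<open>\<theta>\<close> is compared with the composite on the space only, because
  pushing along a composite factorization is known to be the composite of the pushes on traces
  alone.\<close>

lemma induced_abs_comp:
  assumes "continuous_map Y Z \<phi>" "\<phi> y = z" "y \<in> topspace Y" "continuous_map Z W \<psi>" "\<psi> z = w"
    and "\<And>p. p \<in> topspace Y \<Longrightarrow> \<theta> p = \<psi> (\<phi> p)"
  shows "action_comp (induced_abs m Y y Z z \<phi>) (induced_abs m Z z W w \<psi>) = induced_abs m Y y W w \<theta>"
proof -
  have "continuous_map Y W \<theta>"
    by (rule continuous_map_eq[OF continuous_map_compose[OF assms(1,4)]]) (simp add: assms(6))
  moreover have "\<theta> y = w" using assms by simp
  ultimately have *: "class_map m W (abs_cond m w) \<psi> (class_map m Z (abs_cond m z) \<phi> a) =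
      class_map m W (abs_cond m w) \<theta> a" if "a \<in> homotopy_set m Y (abs_cond m y)" for a
    by (intro class_map_compose[OF cube_push_abs[OF assms(1,2)] cube_push_abs[OF assms(4,5)] cube_push_abs that assms(6)])
  show ?thesis
    using is_action_mor_induced_abs[OF assms(1-3), of m] * grp_homotopy_action_subset[OF assms(3)]
    unfolding induced_abs_def by (intro action_comp_mk_mor) auto
qed

lemma induced_abs_ident:
  assumes "z \<in> topspace Z" "\<And>p. p \<in> topspace Z \<Longrightarrow> \<phi> p = p"
  shows "induced_abs m Z z Z z \<phi> = action_id (homotopy_action m Z z)"
  unfolding induced_abs_def action_id_def
  using class_map_ident[OF cube_cond_abs_cond _ assms(2)] grp_homotopy_action_subset[OF assms(1), of m]
  by (intro mk_action_mor_cong) auto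

lemma induced_rel_comp:
  assumes "continuous_map Y Z \<phi>" "\<phi> y = z" "\<phi> ` C \<subseteq> B" "y \<in> C" "y \<in> topspace Y"
    and "continuous_map Z W \<psi>" "\<psi> z = w" "\<psi> ` B \<subseteq> D" and C: "C \<subseteq> topspace Y"
    and eq: "\<And>p. p \<in> topspace Y \<Longrightarrow> \<theta> p = \<psi> (\<phi> p)"
  shows "action_comp (induced_rel (Suc k) Y C y Z B z \<phi>) (induced_rel (Suc k) Z B z W D w \<psi>) =
    induced_rel (Suc k) Y C y W D w \<theta>"
proof -
  have "\<theta> p \<in> D" if "p \<in> C" for p
    using that assms(3,8) C eq[of p] by blast
  then have \<theta>: "continuous_map Y W \<theta>" "\<theta> y = w" "\<theta> ` C \<subseteq> D"
    using assms(2,5,7) eq by (auto intro: continuous_map_eq[OF continuous_map_compose[OF assms(1,6)]])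
  have zw: "z \<in> B" "w \<in> D" using assms by auto
  have abs: "class_map m W (abs_cond m w) \<psi> (class_map m Z (abs_cond m z) \<phi> a) =
      class_map m W (abs_cond m w) \<theta> a" if "a \<in> homotopy_set m Y (abs_cond m y)" for a m
    by (rule class_map_compose[OF cube_push_abs[OF assms(1,2)] cube_push_abs[OF assms(6,7)]
          cube_push_abs[OF \<theta>(1,2)] that eq])
  have rel: "class_map (Suc k) W (rel_cond (Suc k) D w) \<psi> (class_map (Suc k) Z (rel_cond (Suc k) B z) \<phi> a) =
      class_map (Suc k) W (rel_cond (Suc k) D w) \<theta> a" if "a \<in> homotopy_set (Suc k) Y (rel_cond (Suc k) C y)" for a
    by (rule class_map_compose[OF cube_push_rel[OF assms(1-4) zw(1)] cube_push_rel[OF assms(6-8) zw]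
          cube_push_rel[OF \<theta> assms(4) zw(2)] that eq])
  show ?thesis
    unfolding induced_rel_def
  proof (rule action_comp_mk_mor)
    show "is_action_mor (mk_action_mor (rel_homotopy_action (Suc k) Y C y) (rel_homotopy_action (Suc k) Z B z)
       (class_map (Suc k) Z (rel_cond (Suc k) B z) \<phi>)
       (if Suc k = 1 then class_map (Suc k) Z (abs_cond (Suc k) z) \<phi>
        else class_map (Suc k) Z (rel_cond (Suc k) B z) \<phi>))"
      using is_action_mor_induced_rel[OF assms(1-5), of k] unfolding induced_rel_def .
    \<comment> \<open>The acting group consists of absolute classes in degree one and of relative
      classes above, hence the case distinction on \<open>k\<close>.\<close>
    show "(if Suc k = 1 then class_map (Suc k) W (abs_cond (Suc k) w) \<psi> else class_map (Suc k) W (rel_cond (Suc k) D w) \<psi>)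
        ((if Suc k = 1 then class_map (Suc k) Z (abs_cond (Suc k) z) \<phi> else class_map (Suc k) Z (rel_cond (Suc k) B z) \<phi>) g) =
        (if Suc k = 1 then class_map (Suc k) W (abs_cond (Suc k) w) \<theta> else class_map (Suc k) W (rel_cond (Suc k) D w) \<theta>) g"
      if "g \<in> carrier (grp (rel_homotopy_action (Suc k) Y C y))" for g
      using that rel[of g] abs[of g "Suc k"]
      by (cases "k = 0") (simp_all add: rel_homotopy_action_def homotopy_group_def group_action_of_def)
  qed (simp add: rel)
qed

lemma induced_rel_ident:
  assumes "z \<in> B" "\<And>p. p \<in> topspace Z \<Longrightarrow> \<phi> p = p"
  shows "induced_rel (Suc k) Z B z Z B z \<phi> = action_id (rel_homotopy_action (Suc k) Z B z)"
  unfolding induced_rel_def action_id_def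
  using class_map_ident[OF cube_cond_abs_cond _ assms(2)]
    class_map_ident[OF cube_cond_rel_cond[OF assms(1)] _ assms(2)]
  by (intro mk_action_mor_cong)
    (auto simp: rel_homotopy_action_def homotopy_group_def group_action_of_def split: if_splits)

lemma homotopy_incl_induced: "homotopy_incl m Z B z = induced_abs m (subtopology Z B) z Z z id"
  by (simp add: homotopy_incl_def induced_abs_def)

section \<open>The morphisms of the sequence for one pointed pair\<close>

context pointed_pair
begin

lemma is_action_mor_homotopy_incl: "is_action_mor (homotopy_incl m Z B z)"
  unfolding homotopy_incl_induced using z_ZB
  by (intro is_action_mor_induced_abs) (auto simp: continuous_map_from_subtopology)

lemma push_rel: "cube_push (Suc k) Z (abs_cond (Suc k) z) Z (rel k) id"
  using z_B by (intro cube_push_abs_rel) auto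

lemma push_incl: "cube_push m ZB (abs_cond m z) Z (abs_cond m z) id"
  by (intro cube_push_abs) (auto simp: continuous_map_from_subtopology)

text \<open>Cubes are extensional, so a cube represents its own image under an inclusion without
  being restricted again.\<close>

lemma class_map_id_class:
  assumes "cube_push m Y Q Z' P id" "f \<in> cube_maps m Y Q"
  shows "class_map m Z' P id (cube_class m Y Q f) = cube_class m Z' P f"
  using class_map_class[OF assms] assms(2) by (simp add: cube_maps_def extensional_restrict)

lemma is_action_mor_homotopy_rel:
  assumes "0 < k"
  shows "is_action_mor (homotopy_rel (Suc k) Z B z)"
proof -
  have "class_map (Suc k) Z (rel k) id \<in>
      hom (homotopy_group (Suc k) Z (abs_cond (Suc k) z) z) (homotopy_group (Suc k) Z (rel k) z)"
    using assms z_B by (intro class_map_hom push_rel concatenable_abs concatenable_rel) auto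
  then show ?thesis
    unfolding homotopy_rel_def using assms z_B z_Z
    by (auto simp: homotopy_action_pos rel_homotopy_action_Suc intro!: is_action_mor_group
        group_homotopy_group_abs group_homotopy_group_rel)
qed

text \<open>Concatenation uses coordinate 0 and the face uses coordinate \<open>k\<close>; for
  \<open>0 < k\<close> these are different coordinates and the operations commute.\<close>

lemma face_concat:
  "0 < k \<Longrightarrow> face k (cube_concat (Suc k) f g) = cube_concat k (face k f) (face k g)"
  by (auto simp: face_def cube_concat_def fun_eq_iff fun_upd_twist cube_Suc_fun_upd
      intro!: cube_fun_upd dest: cube_coord)

lemma class_restrict_face_in:
  "a \<in> homotopy_set (Suc k) Z (rel k)
    \<Longrightarrow> restrict_face k a \<in> homotopy_set k ZB (abs_cond k z)"
  by (auto elim!: homotopy_setE simp: class_restrict_face_class intro!: homotopy_setI face_maps)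

lemma face_const: "face k (const_cube (Suc k) z) = const_cube k z"
  by (rule face_abs[OF const_cube_abs[OF z_Z]])

lemma class_restrict_face_const:
  "restrict_face k (cube_class (Suc k) Z (rel k) (const_cube (Suc k) z)) =
    cube_class k ZB (abs_cond k z) (const_cube k z)"
  using class_restrict_face_class[OF const_cube_rel[OF z_B z_Z]] by (simp add: face_const)

lemma is_action_mor_homotopy_boundary:
  assumes "0 < k"
  shows "is_action_mor (homotopy_boundary (Suc k) Z B z)"
proof -
  let ?R = "rel k"
  have "restrict_face k (class_concat (Suc k) Z ?R a b) =
      class_concat k ZB (abs_cond k z) (restrict_face k a)
        (restrict_face k b)"
    if ab: "a \<in> homotopy_set (Suc k) Z ?R" "b \<in> homotopy_set (Suc k) Z ?R" for a b
  proof -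
    obtain f g where "f \<in> cube_maps (Suc k) Z ?R" "a = cube_class (Suc k) Z ?R f"
      "g \<in> cube_maps (Suc k) Z ?R" "b = cube_class (Suc k) Z ?R g"
      using ab by (metis homotopy_setE)
    then show ?thesis
      using concatenable_rel[OF assms z_B] concatenable_abs[OF assms, of z]
      by (simp add: class_concat_class class_restrict_face_class cube_concat_maps face_maps face_concat assms)
  qed
  then have "restrict_face k \<in>
      hom (homotopy_group (Suc k) Z ?R z) (homotopy_group k ZB (abs_cond k z) z)"
    using class_restrict_face_in by (auto simp: hom_def homotopy_group_def)
  then show ?thesis
    unfolding homotopy_boundary_def using assms z_B z_Z z_ZB
    by (auto simp: homotopy_action_pos rel_homotopy_action_Suc intro!: is_action_mor_group
        group_homotopy_group_abs group_homotopy_group_rel)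
qed

text \<open>By the left unit law, acting on the base point by a loop means regarding the loop as a
  relative path. In this form the orbit map falls under the image statements for the map from
  absolute to relative classes.\<close>

lemma orbit_map_eq:
  "orbit_map Z B z = mk_action_mor (homotopy_action 1 Z z) (rel_homotopy_action 1 Z B z)
     (class_map 1 Z (rel_cond 1 B z) id) (\<lambda>\<sigma>. \<sigma>)"
  unfolding orbit_map_def Let_def
proof (rule mk_action_mor_cong)
  fix s assume "s \<in> pset (homotopy_action 1 Z z)"
  then obtain f where f: "f \<in> cube_maps (Suc 0) Z (abs_cond (Suc 0) z)" "s = cube_class (Suc 0) Z (abs_cond (Suc 0) z) f"
    by (auto elim: homotopy_setE)
  interpret cube_layer "Suc 0" "\<lambda>_. UNIV" z Z
    by (rule cube_layer_UNIV[OF z_Z])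
  have "class_concat (Suc 0) Z (rel_cond (Suc 0) B z) (cube_class (Suc 0) Z (rel_cond (Suc 0) B z) (const_cube (Suc 0) z)) s =
      cube_class (Suc 0) Z (rel_cond (Suc 0) B z) f"
    using class_concat_const_left[of f B] f z_B by (simp add: abs_cond_1_pcond rel_cond_1_pcond)
  then show "ract (rel_homotopy_action 1 Z B z) (bpt (rel_homotopy_action 1 Z B z)) s =
      class_map 1 Z (rel_cond 1 B z) id s"
    using class_map_id_class[OF push_rel[of 0] f(1)] f(2) by (simp add: rel_homotopy_action_def)
qed simp

text \<open>A general fact about actions: the action law says that
  \<open>g \<mapsto> 0 \<cdot> g\<close> is equivariant for right translation.\<close>

lemma is_action_mor_orbit_map: "is_action_mor (orbit_map Z B z)"
proof -
  let ?R = "rel_homotopy_action (Suc 0) Z B z"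
  have R: "is_action ?R" by (rule is_action_rel_homotopy_action[OF z_B z_Z])
  have H: "is_action (homotopy_action (Suc 0) Z z)" by (rule is_action_homotopy_action[OF z_Z])
  have grp: "grp (homotopy_action (Suc 0) Z z) = grp ?R" "ract (homotopy_action (Suc 0) Z z) = mult (grp ?R)"
    "pset (homotopy_action (Suc 0) Z z) = carrier (grp ?R)" "bpt (homotopy_action (Suc 0) Z z) = \<one>\<^bsub>grp ?R\<^esub>"
    by (auto simp: homotopy_action_def rel_homotopy_action_def group_action_of_def homotopy_group_def)
  have act: "bpt ?R \<in> pset ?R" "\<And>s g. s \<in> pset ?R \<Longrightarrow> g \<in> carrier (grp ?R) \<Longrightarrow> ract ?R s g \<in> pset ?R"
    "\<And>s. s \<in> pset ?R \<Longrightarrow> ract ?R s \<one>\<^bsub>grp ?R\<^esub> = s"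
    "\<And>s g h. \<lbrakk>s \<in> pset ?R; g \<in> carrier (grp ?R); h \<in> carrier (grp ?R)\<rbrakk>
      \<Longrightarrow> ract ?R s (g \<otimes>\<^bsub>grp ?R\<^esub> h) = ract ?R (ract ?R s g) h"
    using R unfolding is_action_def by simp_all
  show ?thesis
    unfolding orbit_map_def Let_def is_action_mor_mk_iff One_nat_def grp
    using R H act(2-)[OF act(1)] by (simp add: hom_def Pi_iff del: pset_rel_homotopy_action bpt_rel_homotopy_action)
qed

lemma start_component_map_eq:
  "start_component_map Z B z = mk_action_mor (rel_homotopy_action 1 Z B z) (homotopy_action 0 ZB z)
     (class_restrict_face 1 ZB (abs_cond 0 z)) (\<lambda>_. cube_class 0 ZB (abs_cond 0 z) (const_cube 0 z))"
  by (simp add: start_component_map_def Let_def homotopy_action_def pset_action_def singleton_group_def)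

text \<open>Composing a relative path with a loop at its end does not move its starting point, in
  agreement with the trivial action on components.\<close>

lemma is_action_mor_start_component_map: "is_action_mor (start_component_map Z B z)"
proof -
  have face: "class_restrict_face (Suc 0) ZB (abs_cond 0 z) (class_concat (Suc 0) Z (rel_cond (Suc 0) B z) a b) =
      class_restrict_face (Suc 0) ZB (abs_cond 0 z) a"
    if ab: "a \<in> homotopy_set (Suc 0) Z (rel_cond (Suc 0) B z)" "b \<in> homotopy_set (Suc 0) Z (abs_cond (Suc 0) z)" for a b
  proof -
    obtain f g where fg: "f \<in> cube_maps (Suc 0) Z (rel_cond (Suc 0) B z)" "a = cube_class (Suc 0) Z (rel_cond (Suc 0) B z) f"
      "g \<in> cube_maps (Suc 0) Z (abs_cond (Suc 0) z)" "b = cube_class (Suc 0) Z (abs_cond (Suc 0) z) g"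
      using ab by (metis homotopy_setE)
    have "face 0 (cube_concat (Suc 0) f g) = face 0 f"
      by (auto simp: face_def cube_concat_def fun_eq_iff cube_Suc_fun_upd)
    then show ?thesis
      using fg concatenable_rel_abs[OF z_B]
      by (simp add: class_concat_class class_restrict_face_class cube_concat_maps)
  qed
  have "is_action (rel_homotopy_action (Suc 0) Z B z)" "is_action (homotopy_action 0 ZB z)"
    by (rule is_action_rel_homotopy_action[OF z_B z_Z] is_action_homotopy_action[OF z_ZB])+
  then show ?thesis
    unfolding start_component_map_eq is_action_mor_mk_iff
    using class_restrict_face_in[of _ 0] class_restrict_face_const[of 0]
    by (auto simp: face rel_homotopy_action_def homotopy_group_def homotopy_action_def pset_action_def
        singleton_group_def hom_def)
qed

section \<open>Exactness on homotopy classes\<close>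

text \<open>One inclusion slides a cube of \<open>B\<close> to the top, the other is compression.
  The comparison is made on sets with \<open>k = 0\<close> included, so it serves both the groups
  and the action of loops on relative paths.\<close>

lemma image_incl:
  "class_map (Suc k) Z (abs_cond (Suc k) z) id ` homotopy_set (Suc k) ZB (abs_cond (Suc k) z) =
   {a \<in> homotopy_set (Suc k) Z (abs_cond (Suc k) z). class_map (Suc k) Z (rel k) id a =
      cube_class (Suc k) Z (rel k) (const_cube (Suc k) z)}" (is "?L = ?R")
proof (intro equalityI subsetI)
  fix a assume "a \<in> ?L"
  then obtain g where g: "g \<in> cube_maps (Suc k) ZB (abs_cond (Suc k) z)"
    and a: "a = class_map (Suc k) Z (abs_cond (Suc k) z) id (cube_class (Suc k) ZB (abs_cond (Suc k) z) g)"
    by (auto elim: homotopy_setE)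
  have a': "a = cube_class (Suc k) Z (abs_cond (Suc k) z) g"
    using a class_map_id_class[OF push_incl g] by simp
  have g': "g \<in> cube_maps (Suc k) Z (abs_cond (Suc k) z)"
    using g by (auto simp: cube_maps_def continuous_map_ZB)
  then show "a \<in> ?R"
    using a' class_map_id_class[OF push_rel g'] cube_class_eqI[OF rel_null_if_in_subspace[OF g]]
    by (simp add: homotopy_setI)
next
  fix a assume "a \<in> ?R"
  then obtain f where f: "f \<in> cube_maps (Suc k) Z (abs_cond (Suc k) z)"
    and a: "a = cube_class (Suc k) Z (abs_cond (Suc k) z) f"
    and eq: "class_map (Suc k) Z (rel k) id a =
      cube_class (Suc k) Z (rel k) (const_cube (Suc k) z)"
    by (auto elim: homotopy_setE)
  have "homotopic_with (rel k) (cube (Suc k)) Z f (const_cube (Suc k) z)"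
    using eq class_map_id_class[OF push_rel f] a cube_class_eq_iff[OF const_cube_rel[OF z_B z_Z]] by simp
  then obtain g where g: "g \<in> cube_maps (Suc k) ZB (abs_cond (Suc k) z)"
    and hom: "homotopic_with (abs_cond (Suc k) z) (cube (Suc k)) Z f g"
    using rel_null_compress[OF f] by blast
  have "a = class_map (Suc k) Z (abs_cond (Suc k) z) id (cube_class (Suc k) ZB (abs_cond (Suc k) z) g)"
    using a cube_class_eqI[OF hom] class_map_id_class[OF push_incl g] by simp
  then show "a \<in> ?L"
    using g homotopy_setI by blast
qed

text \<open>An absolute cube has constant face; conversely the collar turns a relative cube with
  null face into an absolute one.\<close>

lemma image_rel:
  "class_map (Suc k) Z (rel k) id ` homotopy_set (Suc k) Z (abs_cond (Suc k) z) =
   {a \<in> homotopy_set (Suc k) Z (rel k). restrict_face k a =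
      cube_class k ZB (abs_cond k z) (const_cube k z)}" (is "?L = ?R")
proof (intro equalityI subsetI)
  fix a assume "a \<in> ?L"
  then obtain g where g: "g \<in> cube_maps (Suc k) Z (abs_cond (Suc k) z)"
    and a: "a = class_map (Suc k) Z (rel k) id (cube_class (Suc k) Z (abs_cond (Suc k) z) g)"
    by (auto elim: homotopy_setE)
  have a': "a = cube_class (Suc k) Z (rel k) g"
    using a class_map_id_class[OF push_rel g] by simp
  have g': "g \<in> cube_maps (Suc k) Z (rel k)"
    using g abs_cond_imp_rel_cond[OF z_B] by (auto simp: cube_maps_def)
  then show "a \<in> ?R"
    using a' class_restrict_face_class[OF g'] face_abs[OF g] by (simp add: homotopy_setI)
next
  fix a assume "a \<in> ?R"
  then obtain f where f: "f \<in> cube_maps (Suc k) Z (rel k)"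
    and a: "a = cube_class (Suc k) Z (rel k) f"
    and eq: "restrict_face k a = cube_class k ZB (abs_cond k z) (const_cube k z)"
    by (auto elim: homotopy_setE)
  have "homotopic_with (abs_cond k z) (cube k) ZB (face k f) (const_cube k z)"
    using eq class_restrict_face_class[OF f] a cube_class_eq_iff[OF const_cube_abs[OF z_ZB]] by simp
  then obtain g where g: "g \<in> cube_maps (Suc k) Z (abs_cond (Suc k) z)"
    and hom: "homotopic_with (rel k) (cube (Suc k)) Z f g"
    using face_null_absolute[OF f] by blast
  have "a = class_map (Suc k) Z (rel k) id (cube_class (Suc k) Z (abs_cond (Suc k) z) g)"
    using a cube_class_eqI[OF hom] class_map_id_class[OF push_rel g] by simp
  then show "a \<in> ?L"
    using g homotopy_setI by blast
qed

text \<open>A relative cube and a null homotopy of its face in the ambient space are the same data.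
  For \<open>k = 0\<close> this says that a component of \<open>B\<close> lies in the component of
  \<open>z\<close> in \<open>Z\<close> exactly when a path of \<open>Z\<close> joins it to
  \<open>z\<close>.\<close>

lemma image_boundary:
  "restrict_face k ` homotopy_set (Suc k) Z (rel k) =
   {a \<in> homotopy_set k ZB (abs_cond k z). class_map k Z (abs_cond k z) id a =
      cube_class k Z (abs_cond k z) (const_cube k z)}" (is "?L = ?R")
proof (intro equalityI subsetI)
  fix a assume "a \<in> ?L"
  then obtain g where g: "g \<in> cube_maps (Suc k) Z (rel k)"
    and a: "a = restrict_face k (cube_class (Suc k) Z (rel k) g)"
    by (auto elim: homotopy_setE)
  then show "a \<in> ?R"
    using class_restrict_face_class[OF g] class_map_id_class[OF push_incl face_maps[OF g]]
      cube_class_eqI[OF face_null[OF g]] face_maps[OF g] by (simp add: homotopy_setI)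
next
  fix a assume "a \<in> ?R"
  then obtain f where f: "f \<in> cube_maps k ZB (abs_cond k z)" and a: "a = cube_class k ZB (abs_cond k z) f"
    and eq: "class_map k Z (abs_cond k z) id a = cube_class k Z (abs_cond k z) (const_cube k z)"
    by (auto elim: homotopy_setE)
  have "homotopic_with (abs_cond k z) (cube k) Z f (const_cube k z)"
    using eq class_map_id_class[OF push_incl f] a cube_class_eq_iff[OF const_cube_abs[OF z_Z]] by simp
  then obtain g where g: "g \<in> cube_maps (Suc k) Z (rel k)" "face k g = f"
    using null_imp_face[OF f] by blast
  then have "a = restrict_face k (cube_class (Suc k) Z (rel k) g)"
    using a class_restrict_face_class[OF g(1)] by simp
  then show "a \<in> ?L"
    using g(1) homotopy_setI by blast
qed

lemma action_exact_incl_rel: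
  "0 < k \<Longrightarrow> action_exact (homotopy_incl (Suc k) Z B z) (homotopy_rel (Suc k) Z B z)"
  by (rule action_exactI[OF is_action_mor_homotopy_incl is_action_mor_homotopy_rel])
    (auto simp: homotopy_incl_def homotopy_rel_def smap_mk_action_mor image_incl)

lemma action_exact_rel_boundary:
  "0 < k \<Longrightarrow> action_exact (homotopy_rel (Suc k) Z B z) (homotopy_boundary (Suc k) Z B z)"
  by (rule action_exactI[OF is_action_mor_homotopy_rel is_action_mor_homotopy_boundary])
    (auto simp: homotopy_boundary_def homotopy_rel_def smap_mk_action_mor image_rel)

lemma action_exact_boundary_incl:
  "0 < k \<Longrightarrow> action_exact (homotopy_boundary (Suc k) Z B z) (homotopy_incl k Z B z)"
  by (rule action_exactI[OF is_action_mor_homotopy_boundary is_action_mor_homotopy_incl])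
    (auto simp: homotopy_boundary_def homotopy_incl_def smap_mk_action_mor image_boundary)

lemma action_exact_incl_orbit: "action_exact (homotopy_incl 1 Z B z) (orbit_map Z B z)"
  by (rule action_exactI[OF is_action_mor_homotopy_incl is_action_mor_orbit_map])
    (auto simp: homotopy_incl_def orbit_map_eq smap_mk_action_mor image_incl[of 0, simplified])

lemma action_exact_orbit_start: "action_exact (orbit_map Z B z) (start_component_map Z B z)"
  by (rule action_exactI[OF is_action_mor_orbit_map is_action_mor_start_component_map])
    (auto simp: start_component_map_eq orbit_map_eq smap_mk_action_mor image_rel[of 0, simplified])

lemma action_exact_start_incl: "action_exact (start_component_map Z B z) (homotopy_incl 0 Z B z)"
  by (rule action_exactI[OF is_action_mor_start_component_map is_action_mor_homotopy_incl])
    (auto simp: start_component_map_eq homotopy_incl_def smap_mk_action_mor image_boundary[of 0, simplified])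

end

section \<open>Naturality of the morphisms in the pair\<close>

locale pair_map = Y: pointed_pair Y C y + Z: pointed_pair Z B z
  for Y :: "'y topology" and C y and Z :: "'z topology" and B z +
  fixes \<phi> :: "'y \<Rightarrow> 'z"
  assumes cont: "continuous_map Y Z \<phi>" and \<phi>_C: "\<phi> ` C \<subseteq> B" and \<phi>_y: "\<phi> y = z"
begin

abbreviation "induced_sub m \<equiv> induced_abs m Y.ZB y Z.ZB z \<phi>"
abbreviation "induced_amb m \<equiv> induced_abs m Y y Z z \<phi>"
abbreviation "induced_pair m \<equiv> induced_rel m Y C y Z B z \<phi>"

lemma cont_sub: "continuous_map Y.ZB Z.ZB \<phi>"
  using cont \<phi>_C by (auto simp: Z.continuous_map_ZB continuous_map_from_subtopology)

lemma is_action_mor_sub: "is_action_mor (induced_sub m)"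
  by (rule is_action_mor_induced_abs[OF cont_sub \<phi>_y Y.z_ZB])

lemma is_action_mor_amb: "is_action_mor (induced_amb m)"
  by (rule is_action_mor_induced_abs[OF cont \<phi>_y Y.z_Z])

lemma is_action_mor_pair: "is_action_mor (induced_pair (Suc k))"
  by (rule is_action_mor_induced_rel[OF cont \<phi>_y \<phi>_C Y.z_B Y.z_Z])

text \<open>Both composites are the morphism induced by \<open>\<phi>\<close> from the subspace of
  \<open>Y\<close> into all of \<open>Z\<close>.\<close>

lemma naturality_incl:
  "action_comp (induced_sub m) (homotopy_incl m Z B z) = action_comp (homotopy_incl m Y C y) (induced_amb m)"
proof -
  have "action_comp (induced_sub m) (homotopy_incl m Z B z) = induced_abs m Y.ZB y Z z \<phi>"
    unfolding homotopy_incl_induced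
    by (rule induced_abs_comp[OF cont_sub \<phi>_y Y.z_ZB]) (auto simp: continuous_map_from_subtopology)
  also have "\<dots> = action_comp (homotopy_incl m Y C y) (induced_amb m)"
    unfolding homotopy_incl_induced
    by (rule induced_abs_comp[symmetric, OF _ _ Y.z_ZB cont \<phi>_y]) (auto simp: continuous_map_from_subtopology)
  finally show ?thesis .
qed

lemma push_pair: "cube_push (Suc k) Y (rel_cond (Suc k) C y) Z (rel_cond (Suc k) B z) \<phi>"
  by (rule cube_push_rel[OF cont \<phi>_y \<phi>_C Y.z_B Z.z_B])

lemma push_amb: "cube_push m Y (abs_cond m y) Z (abs_cond m z) \<phi>"
  by (rule cube_push_abs[OF cont \<phi>_y])

lemma push_sub: "cube_push m Y.ZB (abs_cond m y) Z.ZB (abs_cond m z) \<phi>"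
  by (rule cube_push_abs[OF cont_sub \<phi>_y])

lemma class_map_rel_natural:
  assumes "a \<in> homotopy_set (Suc k) Y (abs_cond (Suc k) y)"
  shows "class_map (Suc k) Z (rel_cond (Suc k) B z) id (class_map (Suc k) Z (abs_cond (Suc k) z) \<phi> a) =
    class_map (Suc k) Z (rel_cond (Suc k) B z) \<phi> (class_map (Suc k) Y (rel_cond (Suc k) C y) id a)"
proof -
  have push: "cube_push (Suc k) Y (abs_cond (Suc k) y) Z (rel_cond (Suc k) B z) \<phi>"
    by (rule cube_push_abs_rel[OF cont \<phi>_y Z.z_B])
  show ?thesis
    using class_map_compose[OF push_amb Z.push_rel push assms]
      class_map_compose[OF Y.push_rel push_pair push assms] by simp
qed

text \<open>Pushing forward and restricting to the face commute already on cubes, before passing to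
  classes.\<close>

lemma class_restrict_face_natural:
  assumes "a \<in> homotopy_set (Suc k) Y (rel_cond (Suc k) C y)"
  shows "class_restrict_face (Suc k) Z.ZB (abs_cond k z) (class_map (Suc k) Z (rel_cond (Suc k) B z) \<phi> a) =
    class_map k Z.ZB (abs_cond k z) \<phi> (class_restrict_face (Suc k) Y.ZB (abs_cond k y) a)"
proof -
  obtain f where f: "f \<in> cube_maps (Suc k) Y (rel_cond (Suc k) C y)"
    "a = cube_class (Suc k) Y (rel_cond (Suc k) C y) f"
    using assms by (rule homotopy_setE)
  have "Z.face k (cube_restrict (Suc k) (\<phi> \<circ> f)) = cube_restrict k (\<phi> \<circ> Y.face k f)"
    by (auto simp: Z.face_def Y.face_def fun_eq_iff cube_Suc_fun_upd)
  then show ?thesis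
    using f Z.class_restrict_face_class[OF cube_push_maps[OF push_pair f(1)]]
      class_map_class[OF push_sub Y.face_maps[OF f(1)]]
    by (simp add: Y.class_restrict_face_class class_map_class[OF push_pair])
qed

lemma naturality_rel:
  assumes "0 < k"
  shows "action_comp (induced_amb (Suc k)) (homotopy_rel (Suc k) Z B z) =
    action_comp (homotopy_rel (Suc k) Y C y) (induced_pair (Suc k))"
  using is_action_mor_amb[of "Suc k"] Y.is_action_mor_homotopy_rel[OF assms]
    class_map_rel_natural[of _ k] grp_homotopy_action_subset[OF Y.z_Z] assms
  unfolding homotopy_rel_def induced_rel_def induced_abs_def
  by (intro action_comp_mk_mor_eq) auto

lemma naturality_boundary:
  assumes "0 < k"
  shows "action_comp (induced_pair (Suc k)) (homotopy_boundary (Suc k) Z B z) =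
    action_comp (homotopy_boundary (Suc k) Y C y) (induced_sub k)"
  using is_action_mor_pair[of k] Y.is_action_mor_homotopy_boundary[OF assms]
    class_restrict_face_natural[of _ k] assms
  unfolding homotopy_boundary_def induced_rel_def induced_abs_def diff_Suc_1
  by (intro action_comp_mk_mor_eq) (auto simp: rel_homotopy_action_Suc group_action_of_def homotopy_group_def)

lemma naturality_orbit:
  "action_comp (induced_amb 1) (orbit_map Z B z) = action_comp (orbit_map Y C y) (induced_pair 1)"
  using is_action_mor_amb[of 1] Y.is_action_mor_orbit_map class_map_rel_natural[of _ 0]
  unfolding Y.orbit_map_eq Z.orbit_map_eq induced_rel_def induced_abs_def
  by (intro action_comp_mk_mor_eq) auto

text \<open>On groups both composites are constant, since the push sends the class of the constant
  0-cube at \<open>y\<close> to the one at \<open>z\<close>. On points it is the naturality of the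
  face.\<close>

lemma naturality_start:
  "action_comp (induced_pair 1) (start_component_map Z B z) =
    action_comp (start_component_map Y C y) (induced_sub 0)"
  using is_action_mor_pair[of 0] Y.is_action_mor_start_component_map class_restrict_face_natural[of _ 0]
    class_map_const[OF push_sub const_cube_abs[OF Y.z_ZB] \<phi>_y, of 0]
  unfolding Y.start_component_map_eq Z.start_component_map_eq induced_rel_def induced_abs_def
  by (intro action_comp_mk_mor_eq) auto

end

section \<open>Traces\<close>

definition unit_reparam :: "(real \<Rightarrow> real) \<Rightarrow> bool" where
  "unit_reparam \<phi> \<longleftrightarrow> continuous_on {0..1} \<phi> \<and> mono_on {0..1} \<phi> \<and> \<phi> 0 = 0 \<and> \<phi> 1 = 1"

text \<open>A non-decreasing map onto the interval must fix the end points, and a continuous one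
  fixing them is onto by the intermediate value theorem. Fixed end points are easier to verify for
  explicit reparametrizations.\<close>

lemma unit_reparam_iff:
  "unit_reparam \<phi> \<longleftrightarrow> continuous_on {0..1} \<phi> \<and> mono_on {0..1} \<phi> \<and> \<phi> ` {0..1} = {0..1}"
proof -
  have "\<phi> ` {0..1} = {0..1} \<longleftrightarrow> \<phi> 0 = 0 \<and> \<phi> 1 = 1"
    if c: "continuous_on {0..1} \<phi>" and m: "mono_on {0..1} \<phi>"
  proof
    assume im: "\<phi> ` {0..1} = {0..1}"
    have "0 \<in> \<phi> ` {0..1}" "1 \<in> \<phi> ` {0..1}" using im by simp_all
    then obtain a b where ab: "a \<in> {0..1}" "\<phi> a = 0" "b \<in> {0..1}" "\<phi> b = 1"
      by (elim imageE) simp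
    have "\<phi> 0 \<in> {0..1}" "\<phi> 1 \<in> {0..1}" using im by auto
    then show "\<phi> 0 = 0 \<and> \<phi> 1 = 1"
      using mono_onD[OF m, of 0 a] mono_onD[OF m, of b 1] ab by auto
  next
    assume e: "\<phi> 0 = 0 \<and> \<phi> 1 = 1"
    show "\<phi> ` {0..1} = {0..1}"
    proof (intro equalityI subsetI)
      fix y assume "y \<in> \<phi> ` {0..1}"
      then show "y \<in> {0..1}"
        using mono_onD[OF m, of 0] mono_onD[OF m, of _ 1] e by fastforce
    next
      fix y :: real assume "y \<in> {0..1}"
      then show "y \<in> \<phi> ` {0..1}"
        using IVT'[of \<phi> 0 y 1] e c by (auto simp: image_iff)
    qed
  qed
  then show ?thesis unfolding unit_reparam_def by blast
qed

lemma unit_reparam_bounds: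
  assumes "unit_reparam \<phi>" "0 \<le> t" "t \<le> 1"
  shows "0 \<le> \<phi> t" "\<phi> t \<le> 1"
proof -
  have "\<phi> t \<in> \<phi> ` {0..1}" using assms(2,3) by simp
  then show "0 \<le> \<phi> t" "\<phi> t \<le> 1" using assms(1) unfolding unit_reparam_iff by auto
qed

lemma reparam_step_iff:
  "(f, g) \<in> reparam_step X \<longleftrightarrow> f \<in> dipaths X \<and> (\<exists>\<phi>. unit_reparam \<phi> \<and> g = path_reparam f \<phi>)"
  unfolding reparam_step_def unit_reparam_iff by blast

text \<open>Squeezes \<open>\<phi>\<close> into the first half. Reparametrizing one factor of a
  concatenation thus becomes a reparametrization of the whole, which is why concatenation descends
  to traces.\<close>

lemma unit_reparam_left:
  assumes "unit_reparam \<phi>"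
  shows "unit_reparam (\<lambda>t. if t \<le> 1/2 then \<phi> (2 * t) / 2 else t)"
  unfolding unit_reparam_def
proof (intro conjI)
  have "continuous_on {0..1/2} (\<lambda>t. \<phi> (2 * t))"
    by (rule continuous_on_compose2[of "{0..1}" \<phi> _ "\<lambda>t. 2 * t"])
      (use assms in \<open>auto simp: unit_reparam_def intro!: continuous_intros\<close>)
  then have "continuous_on {0..1/2} (\<lambda>t. \<phi> (2 * t) / 2)"
    by (intro continuous_intros) auto
  moreover have half: "\<phi> (2 * t) / 2 = t" if "t \<in> {1/2..1}" "t \<le> 1/2" for t
  proof -
    have t: "t = 1/2" using that by simp
    show ?thesis unfolding t using assms by (simp add: unit_reparam_def)
  qed
  ultimately have "continuous_on ({0..1/2} \<union> {1/2..1}) (\<lambda>t. if t \<le> 1/2 then \<phi> (2 * t) / 2 else t)"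
    using half by (intro continuous_on_If continuous_on_id) auto
  then show "continuous_on {0..1} (\<lambda>t. if t \<le> 1/2 then \<phi> (2 * t) / 2 else t)"
    by (simp add: ivl_disj_un_two_touch)
  show "mono_on {0..1} (\<lambda>t. if t \<le> 1/2 then \<phi> (2 * t) / 2 else t)"
  proof (rule mono_onI)
    fix r s :: real assume rs: "r \<in> {0..1}" "s \<in> {0..1}" "r \<le> s"
    have "\<phi> (2 * r) \<le> \<phi> (2 * s)" if "s \<le> 1/2"
      using assms rs that by (auto simp: unit_reparam_def intro: mono_onD)
    moreover have "\<phi> (2 * r) \<le> 1" if "r \<le> 1/2"
      using rs that by (intro unit_reparam_bounds[OF assms]) auto
    ultimately show "(if r \<le> 1/2 then \<phi> (2 * r) / 2 else r) \<le> (if s \<le> 1/2 then \<phi> (2 * s) / 2 else s)"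
      using rs(3) by force
  qed
qed (use assms in \<open>auto simp: unit_reparam_def\<close>)

lemma unit_reparam_right:
  assumes "unit_reparam \<phi>"
  shows "unit_reparam (\<lambda>t. if t \<le> 1/2 then t else (1 + \<phi> (2 * t - 1)) / 2)"
  unfolding unit_reparam_def
proof (intro conjI)
  have "continuous_on {1/2..1} (\<lambda>t. \<phi> (2 * t - 1))"
    by (rule continuous_on_compose2[of "{0..1}" \<phi> _ "\<lambda>t. 2 * t - 1"])
      (use assms in \<open>auto simp: unit_reparam_def intro!: continuous_intros\<close>)
  then have "continuous_on {1/2..1} (\<lambda>t. (1 + \<phi> (2 * t - 1)) / 2)"
    by (intro continuous_intros) auto
  moreover have half: "(1 + \<phi> (2 * t - 1)) / 2 = t" if "t \<in> {1/2..1}" "t \<le> 1/2" for t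
  proof -
    have t: "t = 1/2" using that by simp
    show ?thesis unfolding t using assms by (simp add: unit_reparam_def)
  qed
  ultimately have "continuous_on ({0..1/2} \<union> {1/2..1}) (\<lambda>t. if t \<le> 1/2 then t else (1 + \<phi> (2 * t - 1)) / 2)"
    using half by (intro continuous_on_If continuous_on_id) auto
  then show "continuous_on {0..1} (\<lambda>t. if t \<le> 1/2 then t else (1 + \<phi> (2 * t - 1)) / 2)"
    by (simp add: ivl_disj_un_two_touch)
  show "mono_on {0..1} (\<lambda>t. if t \<le> 1/2 then t else (1 + \<phi> (2 * t - 1)) / 2)"
  proof (rule mono_onI)
    fix r s :: real assume rs: "r \<in> {0..1}" "s \<in> {0..1}" "r \<le> s"
    have "\<phi> (2 * r - 1) \<le> \<phi> (2 * s - 1)" if "1/2 \<le> r"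
      using assms rs that by (auto simp: unit_reparam_def intro: mono_onD)
    moreover have "0 \<le> \<phi> (2 * s - 1)" if "1/2 \<le> s"
      using rs that by (intro unit_reparam_bounds[OF assms]) auto
    ultimately show "(if r \<le> 1/2 then r else (1 + \<phi> (2 * r - 1)) / 2) \<le> (if s \<le> 1/2 then s else (1 + \<phi> (2 * s - 1)) / 2)"
      using rs(3) by force
  qed
qed (use assms in \<open>auto simp: unit_reparam_def\<close>)

lemma path_concat_reparam_left:
  assumes "unit_reparam \<phi>"
  shows "path_concat (path_reparam f \<phi>) g =
    path_reparam (path_concat f g) (\<lambda>t. if t \<le> 1/2 then \<phi> (2 * t) / 2 else t)"
proof
  fix t
  show "path_concat (path_reparam f \<phi>) g t =
    path_reparam (path_concat f g) (\<lambda>t. if t \<le> 1/2 then \<phi> (2 * t) / 2 else t) t"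
    using unit_reparam_bounds[OF assms, of "2 * t"] by (auto simp: path_concat_def path_reparam_def)
qed

text \<open>The factors must match: while \<open>\<phi>\<close> is still 0 after \<open>1/2\<close>,
  the reparametrized concatenation is evaluated at \<open>1/2\<close>, where the definition reads
  the end of \<open>f\<close> and not the start of \<open>g\<close>.\<close>

lemma path_concat_reparam_right:
  assumes "unit_reparam \<phi>" "f 1 = g 0"
  shows "path_concat f (path_reparam g \<phi>) =
    path_reparam (path_concat f g) (\<lambda>t. if t \<le> 1/2 then t else (1 + \<phi> (2 * t - 1)) / 2)"
proof
  fix t
  have *: "path_concat f g ((1 + s) / 2) = g s" if "0 \<le> s" "s \<le> 1" for s
    using that assms(2) by (cases "s = 0") (auto simp: path_concat_def field_simps)
  show "path_concat f (path_reparam g \<phi>) t =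
    path_reparam (path_concat f g) (\<lambda>t. if t \<le> 1/2 then t else (1 + \<phi> (2 * t - 1)) / 2) t"
  proof (cases "t \<in> {0..1} \<and> 1/2 < t")
    case True
    then have "0 \<le> \<phi> (2 * t - 1)" "\<phi> (2 * t - 1) \<le> 1"
      using unit_reparam_bounds[OF assms(1), of "2 * t - 1"] by auto
    then have "path_concat f g ((1 + \<phi> (2 * t - 1)) / 2) = g (\<phi> (2 * t - 1))"
      by (rule *)
    moreover have "path_concat f (path_reparam g \<phi>) t = g (\<phi> (2 * t - 1))"
      using True by (simp add: path_concat_def path_reparam_def)
    ultimately show ?thesis
      using True by (simp add: path_reparam_def[of "path_concat f g"])
  next
    case False
    then show ?thesis by (auto simp: path_concat_def path_reparam_def)
  qed
qed

text \<open>The same concave piecewise linear map as in the associativity law for cubes.\<close>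

lemma path_concat_assoc:
  "path_concat (path_concat f g) h =
    path_reparam (path_concat f (path_concat g h)) (\<lambda>s. min (2 * s) (min (s + 1/4) ((s + 1) / 2)))"
proof
  fix s :: real
  let ?\<phi> = "min (2 * s) (min (s + 1/4) ((s + 1) / 2))"
  consider "s \<notin> {0..1}" | "0 \<le> s" "s \<le> 1/4" | "1/4 < s" "s \<le> 1/2" | "1/2 < s" "s \<le> 1"
    by force
  then show "path_concat (path_concat f g) h s =
      path_reparam (path_concat f (path_concat g h)) (\<lambda>s. min (2 * s) (min (s + 1/4) ((s + 1) / 2))) s"
  proof cases
    case 1
    then show ?thesis by (auto simp: path_concat_def path_reparam_def)
  next
    case 2
    then have "?\<phi> = 2 * s" by auto
    then show ?thesis using 2 by (simp add: path_concat_def path_reparam_def)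
  next
    case 3
    then have "?\<phi> = s + 1/4" by auto
    then show ?thesis using 3 by (simp add: path_concat_def path_reparam_def algebra_simps)
  next
    case 4
    define p where "p = (s + 1) / 2"
    have p: "2 * p - 1 = s" "0 \<le> p" "p \<le> 1" "\<not> p \<le> 1/2"
      using 4 by (simp_all add: p_def field_simps)
    have eq: "?\<phi> = p" using 4 by (auto simp: p_def)
    have "path_reparam (path_concat f (path_concat g h)) (\<lambda>s. min (2 * s) (min (s + 1/4) ((s + 1) / 2))) s =
        path_concat f (path_concat g h) p"
      using 4 unfolding eq[symmetric] by (simp add: path_reparam_def)
    then show ?thesis using 4 p by (simp add: path_concat_def)
  qed
qed

lemma path_concat_const_left:
  assumes "f \<in> extensional {0..1}" "f 0 = x"
  shows "path_concat (\<lambda>t\<in>{0..1}. x) f = path_reparam f (\<lambda>s. max 0 (2 * s - 1))"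
proof
  fix t :: real
  have "max 0 (2 * t - 1) = (if t \<le> 1/2 then 0 else 2 * t - 1)" by simp
  then show "path_concat (\<lambda>t\<in>{0..1}. x) f t = path_reparam f (\<lambda>s. max 0 (2 * s - 1)) t"
    using assms by (auto simp: path_concat_def path_reparam_def)
qed

lemma path_concat_const_right:
  assumes "f \<in> extensional {0..1}" "f 1 = x"
  shows "path_concat f (\<lambda>t\<in>{0..1}. x) = path_reparam f (\<lambda>s. min (2 * s) 1)"
  using assms by (auto simp: path_concat_def path_reparam_def fun_eq_iff min_def)

lemma path_concat_endpoints [simp]: "path_concat f g 0 = f 0" "path_concat f g 1 = g 1"
  by (simp_all add: path_concat_def)

lemma trace_of_self: "f \<in> trace_of X f"
  by (simp add: trace_of_def)

lemma trace_of_eq: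
  assumes "g \<in> trace_of X f"
  shows "trace_of X g = trace_of X f"
proof -
  let ?E = "(reparam_step X \<union> (reparam_step X)\<inverse>)\<^sup>*"
  have sym: "sym ?E" by (intro sym_rtrancl) (auto simp: sym_def)
  have fg: "(f, g) \<in> ?E" using assms by (simp add: trace_of_def)
  then have gf: "(g, f) \<in> ?E" using sym by (rule symD[rotated])
  show ?thesis
  proof (intro equalityI subsetI)
    show "h \<in> trace_of X f" if "h \<in> trace_of X g" for h
      using rtrancl_trans[OF fg] that by (simp add: trace_of_def)
    show "h \<in> trace_of X g" if "h \<in> trace_of X f" for h
      using rtrancl_trans[OF gf] that by (simp add: trace_of_def)
  qed
qed

lemma trace_of_reparam:
  assumes "f \<in> dipaths X" "unit_reparam \<phi>"
  shows "trace_of X (path_reparam f \<phi>) = trace_of X f"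
proof (rule trace_of_eq)
  have "(f, path_reparam f \<phi>) \<in> reparam_step X \<union> (reparam_step X)\<inverse>"
    using assms unfolding reparam_step_iff Un_iff by blast
  then show "path_reparam f \<phi> \<in> trace_of X f"
    unfolding trace_of_def mem_Collect_eq by (rule r_into_rtrancl)
qed

text \<open>The generated equivalence consists of zigzags of reparametrizations, so a property has
  to be carried along a step in both directions.\<close>

lemma trace_of_induct [consumes 1, case_names refl reparam unreparam]:
  assumes "g \<in> trace_of X f" and "P f"
    and "\<And>g \<phi>. P g \<Longrightarrow> g \<in> dipaths X \<Longrightarrow> unit_reparam \<phi> \<Longrightarrow> P (path_reparam g \<phi>)"
    and "\<And>g \<phi>. P (path_reparam g \<phi>) \<Longrightarrow> g \<in> dipaths X \<Longrightarrow> unit_reparam \<phi> \<Longrightarrow> P g"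
  shows "P g"
proof -
  have "(f, g) \<in> (reparam_step X \<union> (reparam_step X)\<inverse>)\<^sup>*"
    using assms(1) by (simp add: trace_of_def)
  then show ?thesis
  proof (induction rule: rtrancl_induct)
    case base
    show ?case by (rule assms(2))
  next
    case (step a b)
    then consider "(a, b) \<in> reparam_step X" | "(b, a) \<in> reparam_step X" by blast
    then show ?case
    proof cases
      case 1
      then obtain \<phi> where "a \<in> dipaths X" "unit_reparam \<phi>" "b = path_reparam a \<phi>"
        unfolding reparam_step_iff by blast
      then show ?thesis using assms(3)[OF step.IH] by simp
    next
      case 2
      then obtain \<phi> where "b \<in> dipaths X" "unit_reparam \<phi>" "a = path_reparam b \<phi>"
        unfolding reparam_step_iff by blast
      then show ?thesis using assms(4)[of b \<phi>] step.IH by simp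
    qed
  qed
qed

lemma path_reparam_endpoints [simp]:
  "unit_reparam \<phi> \<Longrightarrow> path_reparam f \<phi> 0 = f 0" "unit_reparam \<phi> \<Longrightarrow> path_reparam f \<phi> 1 = f 1"
  by (auto simp: path_reparam_def unit_reparam_def)

text \<open>Reparametrizations fix the end points; this gives the definite descriptions in
  \<open>trace_source\<close> and \<open>trace_target\<close> their meaning.\<close>

lemma trace_endpoints: "g \<in> trace_of X f \<Longrightarrow> g 0 = f 0 \<and> g 1 = f 1"
  by (induction rule: trace_of_induct) auto

lemma trace_source_of [simp]: "trace_source (trace_of X f) = f 0"
  unfolding trace_source_def
proof (rule the_equality)
  show "\<forall>g\<in>trace_of X f. g 0 = f 0" using trace_endpoints[of _ X f] by simp
  show "x = f 0" if "\<forall>g\<in>trace_of X f. g 0 = x" for x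
    using bspec[OF that trace_of_self] by simp
qed

lemma trace_target_of [simp]: "trace_target (trace_of X f) = f 1"
  unfolding trace_target_def
proof (rule the_equality)
  show "\<forall>g\<in>trace_of X f. g 1 = f 1" using trace_endpoints[of _ X f] by simp
  show "x = f 1" if "\<forall>g\<in>trace_of X f. g 1 = x" for x
    using bspec[OF that trace_of_self] by simp
qed

section \<open>The trace category of a dispace\<close>

locale dispace =
  fixes X :: "'a dispace"
  assumes is_dispace: "is_dispace X"
begin

lemma dipath_extensional: "f \<in> dipaths X \<Longrightarrow> f \<in> extensional {0..1}"
  and dipath_continuous: "f \<in> dipaths X \<Longrightarrow> continuous_map (top_of_set {0..1}) (dspace X) f"
  and dipath_const: "x \<in> topspace (dspace X) \<Longrightarrow> (\<lambda>t\<in>{0..1}. x) \<in> dipaths X"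
  and dipath_concat: "\<lbrakk>f \<in> dipaths X; g \<in> dipaths X; f 1 = g 0\<rbrakk> \<Longrightarrow> path_concat f g \<in> dipaths X"
  using is_dispace unfolding is_dispace_def pathin_def by blast+

lemma dipath_reparam: "\<lbrakk>f \<in> dipaths X; unit_reparam \<phi>\<rbrakk> \<Longrightarrow> path_reparam f \<phi> \<in> dipaths X"
  using is_dispace unfolding is_dispace_def unit_reparam_iff by blast

lemma dipath_endpoints:
  assumes "f \<in> dipaths X"
  shows "f 0 \<in> topspace (dspace X)" "f 1 \<in> topspace (dspace X)"
  using continuous_map_funspace[OF dipath_continuous[OF assms]] by auto

lemma trace_dipath: "g \<in> trace_of X f \<Longrightarrow> f \<in> dipaths X \<Longrightarrow> g \<in> dipaths X"
  by (induction rule: trace_of_induct) (simp_all add: dipath_reparam)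

text \<open>One factor is changed at a time, by induction along the zigzag. Matching of the end
  points is carried in the induction, since each step must form a dipath before reparametrizing
  it.\<close>

lemma trace_of_concat:
  assumes f: "f \<in> dipaths X" and g: "g \<in> dipaths X" and fg: "f 1 = g 0"
    and f': "f' \<in> trace_of X f" and g': "g' \<in> trace_of X g"
  shows "trace_of X (path_concat f' g') = trace_of X (path_concat f g)"
proof -
  have left: "trace_of X (path_concat f' g) = trace_of X (path_concat f g) \<and> f' 1 = g 0"
    using f'
  proof (induction rule: trace_of_induct)
    case (reparam a \<phi>)
    then have "path_concat a g \<in> dipaths X" using g by (simp add: dipath_concat)
    then show ?case
      using trace_of_reparam[OF _ unit_reparam_left[OF reparam(3)], of "path_concat a g"] reparam
      by (simp add: path_concat_reparam_left)
  next
    case (unreparam a \<phi>)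
    then have "path_concat a g \<in> dipaths X" using g by (simp add: dipath_concat)
    then show ?case
      using trace_of_reparam[OF _ unit_reparam_left[OF unreparam(3)], of "path_concat a g"] unreparam
      by (simp add: path_concat_reparam_left)
  qed (simp add: fg)
  have f'X: "f' \<in> dipaths X" by (rule trace_dipath[OF f' f])
  have "trace_of X (path_concat f' g') = trace_of X (path_concat f' g) \<and> f' 1 = g' 0"
    using g'
  proof (induction rule: trace_of_induct)
    case (reparam a \<phi>)
    then have "path_concat f' a \<in> dipaths X" using f'X by (simp add: dipath_concat)
    then show ?case
      using trace_of_reparam[OF _ unit_reparam_right[OF reparam(3)], of "path_concat f' a"] reparam
      by (simp add: path_concat_reparam_right)
  next
    case (unreparam a \<phi>)
    then have fa: "f' 1 = a 0" by simp
    then have "path_concat f' a \<in> dipaths X" using f'X unreparam by (simp add: dipath_concat)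
    then show ?case
      using trace_of_reparam[OF _ unit_reparam_right[OF unreparam(3)], of "path_concat f' a"] unreparam fa
        path_concat_reparam_right[where f = f' and g = a, OF unreparam(3) fa] by simp
  qed (simp add: left)
  then show ?thesis using left by simp
qed

lemma trace_concat_of:
  assumes "f \<in> dipaths X" "g \<in> dipaths X" "f 1 = g 0"
  shows "trace_concat X (trace_of X f) (trace_of X g) = trace_of X (path_concat f g)"
proof -
  have "(\<Union>g'\<in>trace_of X g. trace_of X (path_concat f' g')) = trace_of X (path_concat f g)"
    if "f' \<in> trace_of X f" for f'
  proof (rule SUP_eq_const)
    show "trace_of X g \<noteq> {}" using trace_of_self by blast
    show "trace_of X (path_concat f' g') = trace_of X (path_concat f g)" if g': "g' \<in> trace_of X g" for g'
      by (rule trace_of_concat[OF assms \<open>f' \<in> trace_of X f\<close> g'])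
  qed
  moreover have "trace_of X f \<noteq> {}" using trace_of_self by blast
  ultimately show ?thesis
    unfolding trace_concat_def by (rule SUP_eq_const[rotated])
qed

text \<open>The subbasic set given by empty \<open>K\<close> and empty \<open>U\<close> already
  contains every extensional continuous path, so the generated topology lives on all of
  them.\<close>

lemma topspace_dipath_space: "topspace (dipath_space X x y) = {f \<in> dipaths X. f 0 = x \<and> f 1 = y}"
proof -
  have "f \<in> topspace (compact_open_topology (top_of_set {0..1}) (dspace X))" if "f \<in> dipaths X" for f
  proof -
    have "f \<in> {f \<in> extensional (topspace (top_of_set {0..1})). continuous_map (top_of_set {0..1}) (dspace X) f \<and> f ` {} \<subseteq> {}}"
      using that dipath_extensional dipath_continuous by simp
    moreover have "compactin (top_of_set {0..1}) {}" "openin (dspace X) {}" by simp_all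
    ultimately show ?thesis
      unfolding compact_open_topology_def topology_generated_by_topspace by blast
  qed
  then show ?thesis by (auto simp: dipath_space_def)
qed

lemma topspace_trace_space:
  "topspace (trace_space X x y) = trace_of X ` {f \<in> dipaths X. f 0 = x \<and> f 1 = y}"
  by (simp add: trace_space_def topspace_quotient_topology topspace_dipath_space)

lemma Arr_trace_category: "Arr (trace_category X) = trace_of X ` dipaths X"
  using dipath_endpoints by (auto simp: trace_category_def topspace_trace_space)

text \<open>For dipaths the two sides of the associativity and unit laws differ by an explicit
  reparametrization, so the laws hold for traces.\<close>

lemma is_category_trace_category: "is_category (trace_category X)"
proof -
  have assoc: "trace_of X (path_concat (path_concat f g) h) = trace_of X (path_concat f (path_concat g h))"
    if "f \<in> dipaths X" "g \<in> dipaths X" "h \<in> dipaths X" "f 1 = g 0" "g 1 = h 0" for f g h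
  proof -
    have "unit_reparam (\<lambda>s. min (2 * s) (min (s + 1/4) ((s + 1) / 2)))"
      unfolding unit_reparam_def by (auto intro!: continuous_intros mono_onI min.mono)
    then show ?thesis
      unfolding path_concat_assoc using that by (intro trace_of_reparam dipath_concat) auto
  qed
  have unitl: "trace_of X (path_concat (\<lambda>t\<in>{0..1}. f 0) f) = trace_of X f" if "f \<in> dipaths X" for f
  proof -
    have "unit_reparam (\<lambda>s. max 0 (2 * s - 1))"
      unfolding unit_reparam_def by (auto intro!: continuous_intros mono_onI)
    then show ?thesis
      using path_concat_const_left[OF dipath_extensional[OF that] refl] trace_of_reparam[OF that] by simp
  qed
  have unitr: "trace_of X (path_concat f (\<lambda>t\<in>{0..1}. f 1)) = trace_of X f" if "f \<in> dipaths X" for f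
  proof -
    have "unit_reparam (\<lambda>s. min (2 * s) 1)"
      unfolding unit_reparam_def by (auto intro!: continuous_intros mono_onI)
    then show ?thesis
      using path_concat_const_right[OF dipath_extensional[OF that] refl] trace_of_reparam[OF that] by simp
  qed
  have sel: "Obj (trace_category X) = topspace (dspace X)" "Dom (trace_category X) = trace_source"
    "Cod (trace_category X) = trace_target" "Id (trace_category X) = (\<lambda>x. trace_of X (\<lambda>t\<in>{0..1}. x))"
    "Comp (trace_category X) = trace_concat X"
    by (simp_all add: trace_category_def)
  show ?thesis
    unfolding is_category_def Arr_trace_category sel ball_simps
    by (simp add: trace_concat_of dipath_concat dipath_endpoints dipath_const assoc unitl unitr)
qed

section \<open>Continuity of concatenation with fixed dipaths\<close>

lemma compact_open_subbasic:
  assumes "compactin (top_of_set {0..1}) K" "openin (dspace X) U"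
  shows "openin (dipath_space X x y) {f \<in> dipaths X. f 0 = x \<and> f 1 = y \<and> f ` K \<subseteq> U}"
proof -
  let ?W = "{f \<in> extensional (topspace (top_of_set {0..1})). continuous_map (top_of_set {0..1}) (dspace X) f \<and> f ` K \<subseteq> U}"
  have "openin (compact_open_topology (top_of_set {0..1}) (dspace X)) ?W"
    unfolding compact_open_topology_def using assms by (intro topology_generated_by_Basis) blast
  moreover have "{f \<in> dipaths X. f 0 = x \<and> f 1 = y \<and> f ` K \<subseteq> U} = ?W \<inter> {f \<in> dipaths X. f 0 = x \<and> f 1 = y}"
    using dipath_extensional dipath_continuous by auto
  ultimately show ?thesis
    unfolding dipath_space_def openin_subtopology by blast
qed

lemma continuous_map_into_dipath_space:
  assumes maps: "\<And>f. f \<in> topspace S \<Longrightarrow> G f \<in> dipaths X \<and> G f 0 = x \<and> G f 1 = y"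
    and pre: "\<And>K U. \<lbrakk>compactin (top_of_set {0..1::real}) K; openin (dspace X) U\<rbrakk>
      \<Longrightarrow> openin S {f \<in> topspace S. G f ` K \<subseteq> U}"
  shows "continuous_map S (dipath_space X x y) G"
  unfolding dipath_space_def
proof (rule continuous_map_into_subtopology)
  show "G \<in> topspace S \<rightarrow> {f \<in> dipaths X. f 0 = x \<and> f 1 = y}" using maps by auto
  show "continuous_map S (compact_open_topology (top_of_set {0..1::real}) (dspace X)) G"
    unfolding compact_open_topology_def
  proof (rule continuous_on_generated_topo)
    fix V :: "(real \<Rightarrow> 'a) set" assume "V \<in> {{f \<in> extensional (topspace (top_of_set {0..1::real})).
      continuous_map (top_of_set {0..1::real}) (dspace X) f \<and> f ` K \<subseteq> U} | K U.
          compactin (top_of_set {0..1::real}) K \<and> openin (dspace X) U}"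
    then obtain K U where KU: "compactin (top_of_set {0..1::real}) K" "openin (dspace X) U"
      and V: "V = {f \<in> extensional (topspace (top_of_set {0..1::real})). continuous_map (top_of_set {0..1::real}) (dspace X) f \<and> f ` K \<subseteq> U}"
      by blast
    have "G -` V \<inter> topspace S = {f \<in> topspace S. G f ` K \<subseteq> U}"
      unfolding V using maps dipath_extensional dipath_continuous by auto
    then show "openin S (G -` V \<inter> topspace S)" using pre[OF KU] by simp
  next
    show "G ` topspace S \<subseteq> \<Union>{{f \<in> extensional (topspace (top_of_set {0..1::real})).
      continuous_map (top_of_set {0..1::real}) (dspace X) f \<and> f ` K \<subseteq> U} | K U.
          compactin (top_of_set {0..1::real}) K \<and> openin (dspace X) U}"
    proof
      fix g assume "g \<in> G ` topspace S"
      then have "g \<in> topspace (dipath_space X x y)" using maps by (auto simp: topspace_dipath_space)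
      then show "g \<in> \<Union>{{f \<in> extensional (topspace (top_of_set {0..1::real})).
      continuous_map (top_of_set {0..1::real}) (dspace X) f \<and> f ` K \<subseteq> U} | K U.
          compactin (top_of_set {0..1::real}) K \<and> openin (dspace X) U}"
        by (simp add: dipath_space_def compact_open_topology_def)
    qed
  qed
qed

text \<open>\<open>L\<close> is the closed half of the interval on which the varying factor is read,
  and \<open>c\<close> rescales that half to the whole interval.\<close>

lemma compactin_unit_image:
  assumes "compactin (top_of_set {0..1::real}) K" "continuous_on UNIV c" "closed L"
    and "\<And>t. t \<in> K \<Longrightarrow> t \<in> L \<Longrightarrow> c t \<in> {0..1::real}"
  shows "compactin (top_of_set {0..1}) (c ` (K \<inter> L))"
proof -
  have "compact K" using assms(1) by (simp add: compactin_subtopology)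
  then have "compact (c ` (K \<inter> L))"
    using assms(2,3) by (intro compact_continuous_image compact_Int_closed continuous_on_subset[OF assms(2)]) auto
  then show ?thesis using assms(4) by (auto simp: compactin_subtopology)
qed

text \<open>The preimage of the subbasic set of \<open>K\<close> and \<open>U\<close> is empty or
  again subbasic: the part of \<open>K\<close> in the second half, rescaled, constrains
  \<open>f\<close>, while the part in the first half constrains the fixed \<open>p\<close>
  only.\<close>

lemma continuous_map_concat_left:
  assumes p: "p \<in> dipaths X" "p 1 = x"
  shows "continuous_map (dipath_space X x y) (dipath_space X (p 0) y) (path_concat p)"
proof (rule continuous_map_into_dipath_space)
  show "path_concat p f \<in> dipaths X \<and> path_concat p f 0 = p 0 \<and> path_concat p f 1 = y"
    if "f \<in> topspace (dipath_space X x y)" for f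
    using that p by (auto simp: topspace_dipath_space dipath_concat)
  fix K U assume K: "compactin (top_of_set {0..1::real}) K" and U: "openin (dspace X) U"
  have K01: "K \<subseteq> {0..1}" using K compactin_subset_topspace by fastforce
  \<comment> \<open>The half is taken closed to keep the set compact. The point \<open>1/2\<close>
    then counts for both factors, which is harmless because \<open>p\<close> ends where
    \<open>f\<close> starts.\<close>
  let ?K = "(\<lambda>t. 2 * t - 1) ` (K \<inter> {1/2..})"
  have "compactin (top_of_set {0..1}) ?K"
    using K01 by (intro compactin_unit_image[OF K] continuous_intros) auto
  then have op: "openin (dipath_space X x y) {f \<in> dipaths X. f 0 = x \<and> f 1 = y \<and> f ` ?K \<subseteq> U}"
    using U by (rule compact_open_subbasic)
  have "{f \<in> topspace (dipath_space X x y). path_concat p f ` K \<subseteq> U} =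
    (if \<forall>t\<in>K. t \<le> 1/2 \<longrightarrow> p (2 * t) \<in> U then {f \<in> dipaths X. f 0 = x \<and> f 1 = y \<and> f ` ?K \<subseteq> U} else {})"
    (is "?L = (if ?c then _ else _)")
  proof -
    have "path_concat p f ` K \<subseteq> U \<longleftrightarrow> (\<forall>t\<in>K. t \<le> 1/2 \<longrightarrow> p (2 * t) \<in> U) \<and> f ` ?K \<subseteq> U" if f: "f 0 = x" for f
    proof -
      have "path_concat p f t \<in> U \<longleftrightarrow> (t \<le> 1/2 \<longrightarrow> p (2 * t) \<in> U) \<and> (1/2 \<le> t \<longrightarrow> f (2 * t - 1) \<in> U)"
        if "t \<in> K" for t
      proof (cases "t = 1/2")
        case True
        show ?thesis unfolding True using f p by (simp add: path_concat_def)
      next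
        case False
        then show ?thesis using K01 that by (auto simp: path_concat_def)
      qed
      moreover have "f ` ?K \<subseteq> U \<longleftrightarrow> (\<forall>t\<in>K. 1/2 \<le> t \<longrightarrow> f (2 * t - 1) \<in> U)"
        unfolding image_subset_iff by blast
      ultimately show ?thesis unfolding image_subset_iff[of "path_concat p f"] by blast
    qed
    then have "?L = {f \<in> dipaths X. f 0 = x \<and> f 1 = y \<and> ?c \<and> f ` ?K \<subseteq> U}"
      unfolding topspace_dipath_space mem_Collect_eq conj_assoc
      by (intro Collect_cong conj_cong refl) blast
    then show ?thesis by (cases ?c) simp_all
  qed
  then show "openin (dipath_space X x y) {f \<in> topspace (dipath_space X x y). path_concat p f ` K \<subseteq> U}"
    using op by simp
qed

lemma continuous_map_concat_right:
  assumes q: "q \<in> dipaths X" "q 0 = y"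
  shows "continuous_map (dipath_space X x y) (dipath_space X x (q 1)) (\<lambda>f. path_concat f q)"
proof (rule continuous_map_into_dipath_space)
  show "path_concat f q \<in> dipaths X \<and> path_concat f q 0 = x \<and> path_concat f q 1 = q 1"
    if "f \<in> topspace (dipath_space X x y)" for f
    using that q by (auto simp: topspace_dipath_space dipath_concat)
  fix K U assume K: "compactin (top_of_set {0..1::real}) K" and U: "openin (dspace X) U"
  have K01: "K \<subseteq> {0..1}" using K compactin_subset_topspace by fastforce
  \<comment> \<open>Here the half read by \<open>f\<close> is already closed in the definition, and
    the condition on the fixed \<open>q\<close> concerns the open half.\<close>
  let ?K = "(\<lambda>t. 2 * t) ` (K \<inter> {..1/2})"
  have "compactin (top_of_set {0..1}) ?K"
    using K01 by (intro compactin_unit_image[OF K] continuous_intros) auto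
  then have op: "openin (dipath_space X x y) {f \<in> dipaths X. f 0 = x \<and> f 1 = y \<and> f ` ?K \<subseteq> U}"
    using U by (rule compact_open_subbasic)
  have "{f \<in> topspace (dipath_space X x y). path_concat f q ` K \<subseteq> U} =
    (if \<forall>t\<in>K. 1/2 < t \<longrightarrow> q (2 * t - 1) \<in> U then {f \<in> dipaths X. f 0 = x \<and> f 1 = y \<and> f ` ?K \<subseteq> U} else {})"
    (is "?L = (if ?c then _ else _)")
  proof -
    have iff: "path_concat f q ` K \<subseteq> U \<longleftrightarrow> (\<forall>t\<in>K. 1/2 < t \<longrightarrow> q (2 * t - 1) \<in> U) \<and> f ` ?K \<subseteq> U" for f
    proof -
      have "path_concat f q t \<in> U \<longleftrightarrow> (t \<le> 1/2 \<longrightarrow> f (2 * t) \<in> U) \<and> (1/2 < t \<longrightarrow> q (2 * t - 1) \<in> U)"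
        if "t \<in> K" for t
        using K01 that by (auto simp: path_concat_def)
      moreover have "f ` ?K \<subseteq> U \<longleftrightarrow> (\<forall>t\<in>K. t \<le> 1/2 \<longrightarrow> f (2 * t) \<in> U)"
        unfolding image_subset_iff by blast
      ultimately show ?thesis unfolding image_subset_iff[of "path_concat f q"] by blast
    qed
    have "?L = {f \<in> dipaths X. f 0 = x \<and> f 1 = y \<and> ?c \<and> f ` ?K \<subseteq> U}"
      unfolding topspace_dipath_space mem_Collect_eq conj_assoc
      by (intro Collect_cong conj_cong refl iff)
    then show ?thesis by (cases ?c) simp_all
  qed
  then show "openin (dipath_space X x y) {f \<in> topspace (dipath_space X x y). path_concat f q ` K \<subseteq> U}"
    using op by simp
qed

lemma quotient_map_trace_of: "quotient_map (dipath_space X x y) (trace_space X x y) (trace_of X)"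
  unfolding trace_space_def by (rule quotient_map_quotient_topology)

text \<open>Only the middle factor varies, so continuity is tested on dipaths through a single
  quotient map. Joint continuity, which would involve a product of quotient maps, does not
  arise.\<close>

lemma continuous_map_trace_concat:
  assumes p: "p \<in> dipaths X" "p 1 = x" and q: "q \<in> dipaths X" "q 0 = y"
  shows "continuous_map (trace_space X x y) (trace_space X (p 0) (q 1))
    (\<lambda>\<sigma>. trace_concat X (trace_of X p) (trace_concat X \<sigma> (trace_of X q)))"
proof (rule continuous_compose_quotient_map[OF quotient_map_trace_of])
  have "continuous_map (dipath_space X x y) (trace_space X (p 0) (q 1))
      (trace_of X \<circ> (path_concat p \<circ> (\<lambda>f. path_concat f q)))"
    by (rule continuous_map_compose[OF continuous_map_compose[OF continuous_map_concat_right[OF q]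
          continuous_map_concat_left[OF p]] quotient_imp_continuous_map[OF quotient_map_trace_of]])
  then show "continuous_map (dipath_space X x y) (trace_space X (p 0) (q 1))
     ((\<lambda>\<sigma>. trace_concat X (trace_of X p) (trace_concat X \<sigma> (trace_of X q))) \<circ> trace_of X)"
    by (rule continuous_map_eq) (use p q in \<open>auto simp: topspace_dipath_space trace_concat_of dipath_concat\<close>)
qed

end

section \<open>Natural homotopy systems\<close>

locale directed_pair = X: dispace X + A: dispace A for X A :: "'a dispace" +
  assumes dipaths_sub: "dipaths A \<subseteq> dipaths X"
begin

lemma dipaths_A: "f \<in> dipaths A \<Longrightarrow> f \<in> dipaths X"
  using dipaths_sub by blast

text \<open>Zigzags in \<open>A\<close> are zigzags in \<open>X\<close>; hence
  \<open>trace_incl\<close> sends a trace of \<open>A\<close> to a single trace of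
  \<open>X\<close>.\<close>

lemma trace_of_A: "g \<in> trace_of A f \<Longrightarrow> trace_of X g = trace_of X f"
proof (induction rule: trace_of_induct)
  case (reparam g \<phi>)
  then show ?case using trace_of_reparam[OF dipaths_A] by simp
next
  case (unreparam g \<phi>)
  then show ?case using trace_of_reparam[OF dipaths_A] by simp
qed simp

lemma trace_incl_of: "trace_incl X (trace_of A f) = trace_of X f"
  unfolding trace_incl_def
proof (rule SUP_eq_const)
  show "trace_of A f \<noteq> {}" using trace_of_self by blast
qed (rule trace_of_A)

lemma tr_space_of: "tr_space X (trace_of A f) = trace_space X (f 0) (f 1)"
  by (simp add: tr_space_def)

lemma tr_sub_of: "tr_sub X A (trace_of A f) = trace_of X ` {g \<in> dipaths A. g 0 = f 0 \<and> g 1 = f 1}"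
  by (simp add: tr_sub_def A.topspace_trace_space image_image trace_incl_of)

lemma tr_push_of:
  assumes "p \<in> dipaths A" "q \<in> dipaths A" "f \<in> dipaths X" "p 1 = f 0" "f 1 = q 0"
  shows "tr_push X (trace_of A p) (trace_of A q) (trace_of X f) = trace_of X (path_concat p (path_concat f q))"
  using assms by (simp add: tr_push_def trace_incl_of X.trace_concat_of X.dipath_concat dipaths_A)

abbreviation "C \<equiv> trace_category A"
abbreviation "F \<equiv> Arr (factorization_category C)"
abbreviation "comp3 u e v \<equiv> Comp C u (Comp C e v)"

lemma category_simps: "Obj C = topspace (dspace A)" "Dom C = trace_source"
    "Cod C = trace_target" "Id C = (\<lambda>x. trace_of A (\<lambda>t\<in>{0..1}. x))" "Comp C = trace_concat A"
  by (simp_all add: trace_category_def)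

lemma Arr_F_E:
  assumes "(u, e, v) \<in> F"
  obtains p f q where "p \<in> dipaths A" "f \<in> dipaths A" "q \<in> dipaths A" "p 1 = f 0" "f 1 = q 0"
    "u = trace_of A p" "e = trace_of A f" "v = trace_of A q"
    "trace_concat A u (trace_concat A e v) = trace_of A (path_concat p (path_concat f q))"
proof -
  obtain p f q where *: "p \<in> dipaths A" "f \<in> dipaths A" "q \<in> dipaths A" "p 1 = f 0" "f 1 = q 0"
    "u = trace_of A p" "e = trace_of A f" "v = trace_of A q"
    using assms unfolding Arr_factorization A.Arr_trace_category category_simps by auto
  moreover have "trace_concat A u (trace_concat A e v) = trace_of A (path_concat p (path_concat f q))"
    using * by (simp add: A.trace_concat_of A.dipath_concat)
  ultimately show ?thesis using that by blast
qed

lemma pointed_pair_trace: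
  assumes "e \<in> Arr C"
  shows "pointed_pair (tr_space X e) (tr_sub X A e) (trace_incl X e)"
proof -
  obtain f where f: "f \<in> dipaths A" "e = trace_of A f"
    using assms unfolding A.Arr_trace_category by blast
  show ?thesis
    unfolding f(2) tr_space_of tr_sub_of trace_incl_of
    by unfold_locales (use f(1) dipaths_sub in \<open>auto simp: X.topspace_trace_space\<close>)
qed

text \<open>The link from traces to homotopy: factorizations enter the homotopy part only as maps of
  pointed pairs. Continuity is that of two-sided concatenation, and the subsets correspond because
  dipaths of \<open>A\<close> are closed under concatenation.\<close>

lemma pair_map_trace:
  assumes "(u, e, v) \<in> F"
  defines "e' \<equiv> trace_concat A u (trace_concat A e v)"
  shows "pair_map (tr_space X e) (tr_sub X A e) (trace_incl X e)
    (tr_space X e') (tr_sub X A e') (trace_incl X e') (tr_push X u v)"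
proof -
  obtain p f q where *: "p \<in> dipaths A" "f \<in> dipaths A" "q \<in> dipaths A" "p 1 = f 0" "f 1 = q 0"
    and uev: "u = trace_of A p" "e = trace_of A f" "v = trace_of A q"
    and e': "e' = trace_of A (path_concat p (path_concat f q))"
    using assms(1) unfolding e'_def by (rule Arr_F_E)
  have "path_concat p (path_concat f q) \<in> dipaths A"
    using * by (simp add: A.dipath_concat)
  then have "pointed_pair (tr_space X e') (tr_sub X A e') (trace_incl X e')"
    unfolding e' by (intro pointed_pair_trace) (simp add: A.Arr_trace_category)
  moreover have "pointed_pair (tr_space X e) (tr_sub X A e) (trace_incl X e)"
    using assms(1) by (intro pointed_pair_trace) (simp add: Arr_factorization)
  moreover have "pair_map_axioms (tr_space X e) (tr_sub X A e) (trace_incl X e)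
    (tr_space X e') (tr_sub X A e') (trace_incl X e') (tr_push X u v)"
  proof
    have "continuous_map (tr_space X e) (tr_space X e')
        (\<lambda>\<sigma>. trace_concat X (trace_of X p) (trace_concat X \<sigma> (trace_of X q)))"
      unfolding e' uev tr_space_of using X.continuous_map_trace_concat[of p "f 0" q "f 1"] *
      by (simp add: dipaths_A)
    then show "continuous_map (tr_space X e) (tr_space X e') (tr_push X u v)"
      unfolding tr_push_def uev trace_incl_of .
    show "tr_push X u v ` tr_sub X A e \<subseteq> tr_sub X A e'"
    proof
      fix \<sigma> assume "\<sigma> \<in> tr_push X u v ` tr_sub X A e"
      then obtain g where g: "g \<in> dipaths A" "g 0 = f 0" "g 1 = f 1" "\<sigma> = tr_push X u v (trace_of X g)"
        unfolding uev tr_sub_of by blast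
      have "\<sigma> = trace_of X (path_concat p (path_concat g q))"
        using g * unfolding uev by (simp add: tr_push_of dipaths_A)
      moreover have "path_concat p (path_concat g q) \<in> dipaths A"
        using g * by (simp add: A.dipath_concat)
      ultimately show "\<sigma> \<in> tr_sub X A e'"
        unfolding e' tr_sub_of by simp
    qed
    show "tr_push X u v (trace_incl X e) = trace_incl X e'"
      unfolding e' uev trace_incl_of using * by (simp add: tr_push_of dipaths_A)
  qed
  ultimately show ?thesis by (simp add: pair_map_def)
qed

text \<open>Identity traces of \<open>A\<close> include to identity traces of \<open>X\<close>, so
  these are the unit laws in the trace category of \<open>X\<close>.\<close>

lemma tr_push_ident:
  assumes "e \<in> Arr C" "\<sigma> \<in> topspace (tr_space X e)"
  shows "tr_push X (Id C (Dom C e)) (Id C (Cod C e)) \<sigma> = \<sigma>"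
proof -
  obtain f where f: "f \<in> dipaths A" "e = trace_of A f"
    using assms(1) unfolding A.Arr_trace_category by blast
  obtain g where g: "g \<in> dipaths X" "g 0 = f 0" "g 1 = f 1" "\<sigma> = trace_of X g"
    using assms(2) unfolding f(2) tr_space_of X.topspace_trace_space by blast
  have cat: "is_category (trace_category X)" by (rule X.is_category_trace_category)
  have \<sigma>: "\<sigma> \<in> Arr (trace_category X)" using g unfolding X.Arr_trace_category by blast
  have "Comp (trace_category X) (Id (trace_category X) (Dom (trace_category X) \<sigma>)) \<sigma> = \<sigma>"
    "Comp (trace_category X) \<sigma> (Id (trace_category X) (Cod (trace_category X) \<sigma>)) = \<sigma>"
    using cat \<sigma> unfolding is_category_def by blast+
  then show ?thesis
    using g by (simp add: tr_push_def category_simps f(2) trace_incl_of trace_category_def)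
qed

text \<open>Associativity in the trace category of \<open>X\<close> brings
  \<open>(u' u) \<sigma> (v v')\<close> to \<open>u' (u \<sigma> v) v'\<close>; representatives are
  chosen with matching end points.\<close>

lemma tr_push_comp:
  assumes 1: "(u, e, v) \<in> F"
    and 2: "(u', comp3 u e v, v') \<in> F"
    and \<sigma>: "\<sigma> \<in> topspace (tr_space X e)"
  shows "tr_push X (Comp C u' u) (Comp C v v') \<sigma> = tr_push X u' v' (tr_push X u v \<sigma>)"
proof -
  obtain p f q where *: "p \<in> dipaths A" "f \<in> dipaths A" "q \<in> dipaths A" "p 1 = f 0" "f 1 = q 0"
    "u = trace_of A p" "e = trace_of A f" "v = trace_of A q"
    "trace_concat A u (trace_concat A e v) = trace_of A (path_concat p (path_concat f q))"
    using 1 by (rule Arr_F_E)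
  obtain p' q' where **: "p' \<in> dipaths A" "q' \<in> dipaths A" "p' 1 = p 0" "q 1 = q' 0"
    "u' = trace_of A p'" "v' = trace_of A q'"
    using 2 unfolding Arr_factorization A.Arr_trace_category category_simps *(9) by auto
  obtain g where g: "g \<in> dipaths X" "g 0 = f 0" "g 1 = f 1" "\<sigma> = trace_of X g"
    using \<sigma> unfolding *(7) tr_space_of X.topspace_trace_space by blast
  have assoc: "trace_concat X (trace_concat X (trace_of X a) (trace_of X b)) (trace_of X c) =
      trace_concat X (trace_of X a) (trace_concat X (trace_of X b) (trace_of X c))"
    if "a \<in> dipaths X" "b \<in> dipaths X" "c \<in> dipaths X" "a 1 = b 0" "b 1 = c 0" for a b c
  proof -
    have "trace_of X a \<in> Arr (trace_category X)" "trace_of X b \<in> Arr (trace_category X)"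
      "trace_of X c \<in> Arr (trace_category X)"
      using that unfolding X.Arr_trace_category by blast+
    moreover have "Cod (trace_category X) (trace_of X a) = Dom (trace_category X) (trace_of X b)"
      "Cod (trace_category X) (trace_of X b) = Dom (trace_category X) (trace_of X c)"
      using that by (simp_all add: trace_category_def)
    moreover have "Comp (trace_category X) = trace_concat X" by (simp add: trace_category_def)
    ultimately show ?thesis
      using X.is_category_trace_category unfolding is_category_def by metis
  qed
  note pX = *(1-3)[THEN dipaths_A] **(1,2)[THEN dipaths_A]
  have d: "path_concat g q \<in> dipaths X" "path_concat q q' \<in> dipaths X" "path_concat g (path_concat q q') \<in> dipaths X"
    "path_concat (path_concat g q) q' \<in> dipaths X" "path_concat p (path_concat g q) \<in> dipaths X"
    "path_concat p' p \<in> dipaths X"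
    using pX g * ** by (simp_all add: X.dipath_concat)
  have "tr_push X (Comp C u' u) (Comp C v v') \<sigma> =
      trace_concat X (trace_concat X (trace_of X p') (trace_of X p))
        (trace_concat X (trace_of X g) (trace_concat X (trace_of X q) (trace_of X q')))"
    using * ** g pX unfolding tr_push_def category_simps
    by (simp add: A.trace_concat_of trace_incl_of X.trace_concat_of)
  also have "\<dots> = trace_concat X (trace_of X p') (trace_concat X (trace_of X p)
        (trace_concat X (trace_of X g) (trace_concat X (trace_of X q) (trace_of X q'))))"
    using assoc[of p' p "path_concat g (path_concat q q')"] pX d g * ** by (simp add: X.trace_concat_of)
  also have "\<dots> = trace_concat X (trace_of X p') (trace_concat X (trace_of X p)
        (trace_concat X (trace_concat X (trace_of X g) (trace_of X q)) (trace_of X q')))"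
    using assoc[of g q q'] pX g * ** by simp
  also have "\<dots> = trace_concat X (trace_of X p') (trace_concat X (trace_concat X (trace_of X p)
        (trace_concat X (trace_of X g) (trace_of X q))) (trace_of X q'))"
    using assoc[of p "path_concat g q" q'] pX d g * ** by (simp add: X.trace_concat_of)
  also have "\<dots> = tr_push X u' v' (tr_push X u v \<sigma>)"
    by (simp add: tr_push_def * ** g trace_incl_of)
  finally show ?thesis .
qed

text \<open>The target of the composite is bracketed differently from the target of the second
  factorization. The equation identifies the spaces attached to both, so that the two sides of a
  functor law can be compared.\<close>

lemma factorization_comp:
  assumes "(u, e, v) \<in> F"
    and "(u', comp3 u e v, v') \<in> F"
  shows "(Comp C u' u, e, Comp C v v') \<in> F"
    and "Comp C (Comp C u' u) (Comp C e (Comp C v v')) = Comp C u' (Comp C (comp3 u e v) v')"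
proof -
  have cat: "is_category (factorization_category C)"
    by (rule is_category_factorization_category[OF A.is_category_trace_category])
  have "Cod (factorization_category C) (u, e, v) = Dom (factorization_category C) (u', comp3 u e v, v')"
    by (simp add: Cod_factorization Dom_factorization)
  then have "Comp (factorization_category C) (u, e, v) (u', comp3 u e v, v') \<in> F \<and>
    Cod (factorization_category C) (Comp (factorization_category C) (u, e, v) (u', comp3 u e v, v')) =
    Cod (factorization_category C) (u', comp3 u e v, v')"
    using cat assms unfolding is_category_def by blast
  then show "(Comp C u' u, e, Comp C v v') \<in> F"
    "Comp C (Comp C u' u) (Comp C e (Comp C v v')) = Comp C u' (Comp C (comp3 u e v) v')"
    unfolding Comp_factorization Cod_factorization by simp_all
qed

lemma factorization_id:
  assumes "e \<in> Arr C"
  shows "(Id C (Dom C e), e, Id C (Cod C e)) \<in> F"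
    and "Comp C (Id C (Dom C e)) (Comp C e (Id C (Cod C e))) = e"
  using A.is_category_trace_category assms unfolding is_category_def Arr_factorization by simp_all

lemma onobj_P:
  "onobj (P_sub X A n) e = homotopy_action (n - 1) (subtopology (tr_space X e) (tr_sub X A e)) (trace_incl X e)"
  "onobj (P_amb X A n) e = homotopy_action (n - 1) (tr_space X e) (trace_incl X e)"
  "onobj (P_rel X A n) e = rel_homotopy_action (n - 1) (tr_space X e) (tr_sub X A e) (trace_incl X e)"
  "onobj (P_rel1 X A) e = tgt (coker_map X A e)"
  by (simp_all add: P_sub_def P_amb_def P_rel_def P_rel1_def Let_def)

text \<open>Once the arrows are recognized as induced morphisms, the functor laws become the
  composition and identity laws for those.\<close>

lemma onarr_P_sub:
  "onarr (P_sub X A n) (u, e, v) = induced_abs (n - 1)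
     (subtopology (tr_space X e) (tr_sub X A e)) (trace_incl X e)
     (subtopology (tr_space X (comp3 u e v)) (tr_sub X A (comp3 u e v)))
     (trace_incl X (comp3 u e v)) (tr_push X u v)"
  by (simp add: P_sub_def Let_def induced_abs_def category_simps)

lemma onarr_P_amb:
  "onarr (P_amb X A n) (u, e, v) = induced_abs (n - 1) (tr_space X e) (trace_incl X e)
     (tr_space X (comp3 u e v)) (trace_incl X (comp3 u e v)) (tr_push X u v)"
  by (simp add: P_amb_def Let_def induced_abs_def category_simps)

lemma onarr_P_rel:
  "2 \<le> n \<Longrightarrow> onarr (P_rel X A n) (u, e, v) = induced_rel (n - 1) (tr_space X e) (tr_sub X A e) (trace_incl X e)
     (tr_space X (comp3 u e v)) (tr_sub X A (comp3 u e v))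
     (trace_incl X (comp3 u e v)) (tr_push X u v)"
  by (auto simp: P_rel_def Let_def induced_rel_def category_simps)

lemma onarr_P_rel1:
  "onarr (P_rel1 X A) (u, e, v) = cokernel_mor (incl_map X A 1 e) (incl_map X A 1 (comp3 u e v))
     (onarr (P_amb X A 1) (u, e, v))"
  by (simp add: P_rel1_def Let_def cokernel_mor_def category_simps coker_map_def)

lemmas pair_map_C = pair_map_trace[folded category_simps(5)]

lemma Arr_F_mid: "(u, e, v) \<in> F \<Longrightarrow> e \<in> Arr C"
  by (simp add: Arr_factorization)

section \<open>The natural systems of the sequence\<close>

lemma is_natural_system_P_sub: "is_natural_system C (P_sub X A n)"
proof (rule is_natural_systemI[OF A.is_category_trace_category])
  show "is_action (onobj (P_sub X A n) e)" if "e \<in> Arr C" for e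
    unfolding onobj_P by (rule is_action_homotopy_action[OF pointed_pair.z_ZB[OF pointed_pair_trace[OF that]]])
  show "is_action_mor (onarr (P_sub X A n) (u, e, v)) \<and> src (onarr (P_sub X A n) (u, e, v)) = onobj (P_sub X A n) e \<and>
      tgt (onarr (P_sub X A n) (u, e, v)) = onobj (P_sub X A n) (comp3 u e v)"
    if "(u, e, v) \<in> F" for u e v
    unfolding onobj_P onarr_P_sub using pair_map.is_action_mor_sub[OF pair_map_C[OF that]]
    by (simp add: induced_abs_def)
  show "onarr (P_sub X A n) (Id C (Dom C e), e, Id C (Cod C e)) = action_id (onobj (P_sub X A n) e)"
    if "e \<in> Arr C" for e
    unfolding onobj_P onarr_P_sub factorization_id(2)[OF that]
    using tr_push_ident[OF that] pointed_pair.z_ZB[OF pointed_pair_trace[OF that]]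
    by (intro induced_abs_ident) auto
  fix u e v u' v' assume 1: "(u, e, v) \<in> F"
    and 2: "(u', comp3 u e v, v') \<in> F"
  interpret m1: pair_map "tr_space X e" "tr_sub X A e" "trace_incl X e" "tr_space X (comp3 u e v)"
    "tr_sub X A (comp3 u e v)" "trace_incl X (comp3 u e v)" "tr_push X u v"
    by (rule pair_map_C[OF 1])
  note m2 = pair_map_C[OF 2]
  show "onarr (P_sub X A n) (Comp C u' u, e, Comp C v v') =
      action_comp (onarr (P_sub X A n) (u, e, v)) (onarr (P_sub X A n) (u', comp3 u e v, v'))"
    unfolding onarr_P_sub factorization_comp(2)[OF 1 2]
    by (rule induced_abs_comp[symmetric, OF m1.cont_sub m1.\<phi>_y m1.Y.z_ZB pair_map.cont_sub[OF m2] pair_map.\<phi>_y[OF m2]])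
      (simp add: tr_push_comp[OF 1 2])
qed

lemma is_natural_system_P_amb: "is_natural_system C (P_amb X A n)"
proof (rule is_natural_systemI[OF A.is_category_trace_category])
  show "is_action (onobj (P_amb X A n) e)" if "e \<in> Arr C" for e
    unfolding onobj_P by (rule is_action_homotopy_action[OF pointed_pair.z_Z[OF pointed_pair_trace[OF that]]])
  show "is_action_mor (onarr (P_amb X A n) (u, e, v)) \<and> src (onarr (P_amb X A n) (u, e, v)) = onobj (P_amb X A n) e \<and>
      tgt (onarr (P_amb X A n) (u, e, v)) = onobj (P_amb X A n) (comp3 u e v)"
    if "(u, e, v) \<in> F" for u e v
    unfolding onobj_P onarr_P_amb using pair_map.is_action_mor_amb[OF pair_map_C[OF that]]
    by (simp add: induced_abs_def)
  show "onarr (P_amb X A n) (Id C (Dom C e), e, Id C (Cod C e)) = action_id (onobj (P_amb X A n) e)"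
    if "e \<in> Arr C" for e
    unfolding onobj_P onarr_P_amb factorization_id(2)[OF that]
    using tr_push_ident[OF that] pointed_pair.z_Z[OF pointed_pair_trace[OF that]]
    by (intro induced_abs_ident) auto
  fix u e v u' v' assume 1: "(u, e, v) \<in> F"
    and 2: "(u', comp3 u e v, v') \<in> F"
  interpret m1: pair_map "tr_space X e" "tr_sub X A e" "trace_incl X e" "tr_space X (comp3 u e v)"
    "tr_sub X A (comp3 u e v)" "trace_incl X (comp3 u e v)" "tr_push X u v"
    by (rule pair_map_C[OF 1])
  note m2 = pair_map_C[OF 2]
  show "onarr (P_amb X A n) (Comp C u' u, e, Comp C v v') =
      action_comp (onarr (P_amb X A n) (u, e, v)) (onarr (P_amb X A n) (u', comp3 u e v, v'))"
    unfolding onarr_P_amb factorization_comp(2)[OF 1 2]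
    by (rule induced_abs_comp[symmetric, OF m1.cont m1.\<phi>_y m1.Y.z_Z pair_map.cont[OF m2] pair_map.\<phi>_y[OF m2]])
      (simp add: tr_push_comp[OF 1 2])
qed

lemma is_natural_system_P_rel:
  assumes "2 \<le> n"
  shows "is_natural_system C (P_rel X A n)"
proof (rule is_natural_systemI[OF A.is_category_trace_category])
  \<comment> \<open>The system of index \<open>n\<close> lives in homotopy degree
    \<open>n - 1\<close>, and relative facts are indexed by \<open>Suc k\<close>; hence
    \<open>k = n - 2\<close>.\<close>
  obtain k where k: "n - 1 = Suc k" using assms by (intro that[of "n - 2"]) simp
  show "is_action (onobj (P_rel X A n) e)" if "e \<in> Arr C" for e
    unfolding onobj_P k
    by (rule is_action_rel_homotopy_action[OF pointed_pair.z_B[OF pointed_pair_trace[OF that]]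
          pointed_pair.z_Z[OF pointed_pair_trace[OF that]]])
  show "is_action_mor (onarr (P_rel X A n) (u, e, v)) \<and> src (onarr (P_rel X A n) (u, e, v)) = onobj (P_rel X A n) e \<and>
      tgt (onarr (P_rel X A n) (u, e, v)) = onobj (P_rel X A n) (comp3 u e v)"
    if "(u, e, v) \<in> F" for u e v
    unfolding onobj_P onarr_P_rel[OF assms] k using pair_map.is_action_mor_pair[OF pair_map_C[OF that]]
    by (simp add: induced_rel_def)
  show "onarr (P_rel X A n) (Id C (Dom C e), e, Id C (Cod C e)) = action_id (onobj (P_rel X A n) e)"
    if "e \<in> Arr C" for e
    unfolding onobj_P onarr_P_rel[OF assms] factorization_id(2)[OF that] k
    by (rule induced_rel_ident[OF pointed_pair.z_B[OF pointed_pair_trace[OF that]] tr_push_ident[OF that]])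
  fix u e v u' v' assume 1: "(u, e, v) \<in> F"
    and 2: "(u', comp3 u e v, v') \<in> F"
  interpret m1: pair_map "tr_space X e" "tr_sub X A e" "trace_incl X e" "tr_space X (comp3 u e v)"
    "tr_sub X A (comp3 u e v)" "trace_incl X (comp3 u e v)" "tr_push X u v"
    by (rule pair_map_C[OF 1])
  note m2 = pair_map_C[OF 2]
  show "onarr (P_rel X A n) (Comp C u' u, e, Comp C v v') =
      action_comp (onarr (P_rel X A n) (u, e, v)) (onarr (P_rel X A n) (u', comp3 u e v, v'))"
    unfolding onarr_P_rel[OF assms] factorization_comp(2)[OF 1 2] k
    by (rule induced_rel_comp[symmetric, OF m1.cont m1.\<phi>_y m1.\<phi>_C m1.Y.z_B m1.Y.z_Z
          pair_map.cont[OF m2] pair_map.\<phi>_y[OF m2] pair_map.\<phi>_C[OF m2] m1.Y.B_Z tr_push_comp[OF 1 2]])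
qed

lemma incl_map_mor:
  assumes "e \<in> Arr C"
  shows "is_action_mor (incl_map X A n e)" "src (incl_map X A n e) = onobj (P_sub X A n) e"
    "tgt (incl_map X A n e) = onobj (P_amb X A n) e"
  unfolding incl_map_def onobj_P
  by (rule pointed_pair.is_action_mor_homotopy_incl[OF pointed_pair_trace[OF assms]])
    (simp_all add: homotopy_incl_def)

lemma incl_map_natural:
  assumes "(u, e, v) \<in> F"
  shows "action_comp (onarr (P_sub X A n) (u, e, v)) (incl_map X A n (comp3 u e v)) =
    action_comp (incl_map X A n e) (onarr (P_amb X A n) (u, e, v))"
  unfolding onarr_P_sub onarr_P_amb incl_map_def
  by (rule pair_map.naturality_incl[OF pair_map_C[OF assms]])

lemma natural_incl: "is_natural_transformation C (P_sub X A n) (P_amb X A n) (incl_map X A n)"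
  by (rule is_natural_transformationI[OF is_natural_system_P_sub is_natural_system_P_amb])
    (simp_all add: incl_map_mor incl_map_natural)

text \<open>Naturality of the inclusion, packaged as input for the induced maps on
  cokernels.\<close>

lemma action_square_incl:
  assumes "(u, e, v) \<in> F"
  shows "action_square (incl_map X A n e) (incl_map X A n (comp3 u e v))
    (onarr (P_sub X A n) (u, e, v)) (onarr (P_amb X A n) (u, e, v))"
proof -
  note e = Arr_F_mid[OF assms]
  have e': "comp3 u e v \<in> Arr C"
    using assms by (rule Arr_F_E) (simp add: category_simps A.Arr_trace_category A.dipath_concat)
  show ?thesis
    by unfold_locales
      (use incl_map_mor[OF e, of n] incl_map_mor[OF e', of n] incl_map_natural[OF assms, of n]
        pair_map.is_action_mor_sub[OF pair_map_C[OF assms], of "n - 1"]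
        pair_map.is_action_mor_amb[OF pair_map_C[OF assms], of "n - 1"]
       in \<open>simp_all add: onarr_P_sub onarr_P_amb onobj_P induced_abs_def\<close>)
qed

lemma cokernel_incl_mor: "e \<in> Arr C \<Longrightarrow> is_action_mor (cokernel (incl_map X A n e))"
  by (rule action_morphism.is_action_mor_cokernel[OF action_morphism.intro[OF incl_map_mor(1)]])

text \<open>The functor laws of the ambient system pass to the cokernels, since an induced map is
  determined by its square with the projections.\<close>

lemma is_natural_system_P_rel1: "is_natural_system C (P_rel1 X A)"
proof (rule is_natural_systemI[OF A.is_category_trace_category])
  show "is_action (onobj (P_rel1 X A) e)" if "e \<in> Arr C" for e
    unfolding onobj_P coker_map_def by (rule action_mor_properties(2)[OF cokernel_incl_mor[OF that]])
  show "is_action_mor (onarr (P_rel1 X A) (u, e, v)) \<and> src (onarr (P_rel1 X A) (u, e, v)) = onobj (P_rel1 X A) e \<and>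
      tgt (onarr (P_rel1 X A) (u, e, v)) = onobj (P_rel1 X A) (comp3 u e v)"
    if "(u, e, v) \<in> F" for u e v
    unfolding onobj_P onarr_P_rel1 coker_map_def
    using action_square.is_action_mor_cokernel_mor[OF action_square_incl[OF that]]
    by (simp add: cokernel_mor_def)
  show "onarr (P_rel1 X A) (Id C (Dom C e), e, Id C (Cod C e)) = action_id (onobj (P_rel1 X A) e)"
    if e: "e \<in> Arr C" for e
  proof -
    have "onarr (P_amb X A 1) (Id C (Dom C e), e, Id C (Cod C e)) = action_id (tgt (incl_map X A 1 e))"
      unfolding incl_map_mor(3)[OF e] onobj_P onarr_P_amb factorization_id(2)[OF e]
      by (rule induced_abs_ident[OF pointed_pair.z_Z[OF pointed_pair_trace[OF e]] tr_push_ident[OF e]])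
    then show ?thesis
      unfolding onobj_P onarr_P_rel1 coker_map_def factorization_id(2)[OF e]
      by (intro cokernel_mor_ident[OF incl_map_mor(1)[OF e]
            action_square_incl[OF factorization_id(1)[OF e], of 1, unfolded factorization_id(2)[OF e]]])
  qed
  fix u e v u' v' assume 1: "(u, e, v) \<in> F"
    and 2: "(u', comp3 u e v, v') \<in> F"
  interpret m1: pair_map "tr_space X e" "tr_sub X A e" "trace_incl X e" "tr_space X (comp3 u e v)"
    "tr_sub X A (comp3 u e v)" "trace_incl X (comp3 u e v)" "tr_push X u v"
    by (rule pair_map_C[OF 1])
  note m2 = pair_map_C[OF 2]
  have eq: "onarr (P_amb X A 1) (Comp C u' u, e, Comp C v v') =
      action_comp (onarr (P_amb X A 1) (u, e, v)) (onarr (P_amb X A 1) (u', comp3 u e v, v'))"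
    unfolding onarr_P_amb factorization_comp(2)[OF 1 2]
    by (rule induced_abs_comp[symmetric, OF m1.cont m1.\<phi>_y m1.Y.z_Z pair_map.cont[OF m2] pair_map.\<phi>_y[OF m2]])
      (simp add: tr_push_comp[OF 1 2])
  show "onarr (P_rel1 X A) (Comp C u' u, e, Comp C v v') =
      action_comp (onarr (P_rel1 X A) (u, e, v)) (onarr (P_rel1 X A) (u', comp3 u e v, v'))"
    unfolding onarr_P_rel1 factorization_comp(2)[OF 1 2]
    by (rule cokernel_mor_comp[symmetric, OF action_square_incl[OF 1] action_square_incl[OF 2]
          action_square_incl[OF factorization_comp(1)[OF 1 2], of 1, unfolded factorization_comp(2)[OF 1 2]] eq])
qed

section \<open>The natural transformations of the sequence\<close>

lemma natural_coker: "is_natural_transformation C (P_amb X A 1) (P_rel1 X A) (coker_map X A)"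
proof (rule is_natural_transformationI[OF is_natural_system_P_amb is_natural_system_P_rel1])
  show "is_action_mor (coker_map X A e) \<and> src (coker_map X A e) = onobj (P_amb X A 1) e \<and>
      tgt (coker_map X A e) = onobj (P_rel1 X A) e" if "e \<in> Arr C" for e
    using cokernel_incl_mor[OF that, of 1] cokernel_properties(1)[OF incl_map_mor(1)[OF that, of 1]]
      incl_map_mor(3)[OF that, of 1]
    by (simp add: coker_map_def onobj_P(4))
  show "action_comp (onarr (P_amb X A 1) (u, e, v)) (coker_map X A (comp3 u e v)) =
      action_comp (coker_map X A e) (onarr (P_rel1 X A) (u, e, v))"
    if "(u, e, v) \<in> F" for u e v
    unfolding coker_map_def onarr_P_rel1
    by (rule action_square.cokernel_mor_square[symmetric, OF action_square_incl[OF that]])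
qed

text \<open>The range starts at 3: for \<open>n = 2\<close> the relative term is acted on by the
  absolute group, and \<open>f_map\<close> takes the place of this map.\<close>

lemma natural_rel:
  assumes "3 \<le> n"
  shows "is_natural_transformation C (P_amb X A n) (P_rel X A n) (rel_map X A n)"
proof -
  have n: "2 \<le> n" using assms by simp
  obtain k where k: "n - 1 = Suc k" "0 < k"
    using assms by (intro that[of "n - 2"]) auto
  show ?thesis
  proof (rule is_natural_transformationI[OF is_natural_system_P_amb is_natural_system_P_rel[OF n]])
    show "is_action_mor (rel_map X A n e) \<and> src (rel_map X A n e) = onobj (P_amb X A n) e \<and>
        tgt (rel_map X A n e) = onobj (P_rel X A n) e" if "e \<in> Arr C" for e
      unfolding rel_map_def onobj_P k(1)
      using pointed_pair.is_action_mor_homotopy_rel[OF pointed_pair_trace[OF that] k(2)]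
      by (simp add: homotopy_rel_def)
    show "action_comp (onarr (P_amb X A n) (u, e, v)) (rel_map X A n (comp3 u e v)) =
        action_comp (rel_map X A n e) (onarr (P_rel X A n) (u, e, v))"
      if "(u, e, v) \<in> F" for u e v
      unfolding onarr_P_amb onarr_P_rel[OF n] rel_map_def k(1)
      by (rule pair_map.naturality_rel[OF pair_map_C[OF that] k(2)])
  qed
qed

lemma natural_boundary:
  assumes "3 \<le> n"
  shows "is_natural_transformation C (P_rel X A n) (P_sub X A (n - 1)) (boundary_map X A n)"
proof -
  have n: "2 \<le> n" using assms by simp
  obtain k where k: "n - 1 = Suc k" "0 < k"
    using assms by (intro that[of "n - 2"]) auto
  show ?thesis
  proof (rule is_natural_transformationI[OF is_natural_system_P_rel[OF n] is_natural_system_P_sub])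
    show "is_action_mor (boundary_map X A n e) \<and> src (boundary_map X A n e) = onobj (P_rel X A n) e \<and>
        tgt (boundary_map X A n e) = onobj (P_sub X A (n - 1)) e" if "e \<in> Arr C" for e
      unfolding boundary_map_def onobj_P k(1)
      using pointed_pair.is_action_mor_homotopy_boundary[OF pointed_pair_trace[OF that] k(2)]
      by (simp add: homotopy_boundary_def)
    show "action_comp (onarr (P_rel X A n) (u, e, v)) (boundary_map X A n (comp3 u e v)) =
        action_comp (boundary_map X A n e) (onarr (P_sub X A (n - 1)) (u, e, v))"
      if "(u, e, v) \<in> F" for u e v
      unfolding onarr_P_sub onarr_P_rel[OF n] boundary_map_def k(1) diff_Suc_1
      by (rule pair_map.naturality_boundary[OF pair_map_C[OF that] k(2)])
  qed
qed

lemma natural_f: "is_natural_transformation C (P_amb X A 2) (P_rel X A 2) (f_map X A)"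
proof (rule is_natural_transformationI[OF is_natural_system_P_amb is_natural_system_P_rel[OF order_refl]])
  have n: "(2::nat) - 1 = 1" by simp
  show "is_action_mor (f_map X A e) \<and> src (f_map X A e) = onobj (P_amb X A 2) e \<and>
      tgt (f_map X A e) = onobj (P_rel X A 2) e" if "e \<in> Arr C" for e
    unfolding f_map_def onobj_P n
    using pointed_pair.is_action_mor_orbit_map[OF pointed_pair_trace[OF that]]
    by (simp add: orbit_map_def Let_def)
  show "action_comp (onarr (P_amb X A 2) (u, e, v)) (f_map X A (comp3 u e v)) =
      action_comp (f_map X A e) (onarr (P_rel X A 2) (u, e, v))"
    if "(u, e, v) \<in> F" for u e v
    unfolding onarr_P_amb onarr_P_rel[OF order_refl] f_map_def n
    by (rule pair_map.naturality_orbit[OF pair_map_C[OF that]])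
qed

lemma natural_g: "is_natural_transformation C (P_rel X A 2) (P_sub X A 1) (g_map X A)"
proof (rule is_natural_transformationI[OF is_natural_system_P_rel[OF order_refl] is_natural_system_P_sub])
  have n: "(2::nat) - 1 = 1" "(1::nat) - 1 = 0" by simp_all
  show "is_action_mor (g_map X A e) \<and> src (g_map X A e) = onobj (P_rel X A 2) e \<and>
      tgt (g_map X A e) = onobj (P_sub X A 1) e" if "e \<in> Arr C" for e
    unfolding g_map_def onobj_P n
    using pointed_pair.is_action_mor_start_component_map[OF pointed_pair_trace[OF that]]
    by (simp add: start_component_map_def Let_def)
  show "action_comp (onarr (P_rel X A 2) (u, e, v)) (g_map X A (comp3 u e v)) =
      action_comp (g_map X A e) (onarr (P_sub X A 1) (u, e, v))"
    if "(u, e, v) \<in> F" for u e v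
    unfolding onarr_P_sub onarr_P_rel[OF order_refl] g_map_def n
    by (rule pair_map.naturality_start[OF pair_map_C[OF that]])
qed

section \<open>Exactness at each position\<close>

lemma exact_higher:
  assumes "3 \<le> n"
  shows "exact_sequence_at C (P_sub X A n) (incl_map X A n) (P_amb X A n) (rel_map X A n) (P_rel X A n)"
    and "exact_sequence_at C (P_amb X A n) (rel_map X A n) (P_rel X A n) (boundary_map X A n) (P_sub X A (n - 1))"
    and "exact_sequence_at C (P_rel X A n) (boundary_map X A n) (P_sub X A (n - 1)) (incl_map X A (n - 1)) (P_amb X A (n - 1))"
proof -
  \<comment> \<open>\<open>k\<close> is the degree in which the boundary map lands, while the
    ambient and relative terms of index \<open>n\<close> have degree \<open>Suc k\<close>. The bound
    3 makes \<open>k\<close> positive.\<close>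
  obtain k where k: "n - 1 = Suc k" "0 < k"
    using assms by (intro that[of "n - 2"]) auto
  show "exact_sequence_at C (P_sub X A n) (incl_map X A n) (P_amb X A n) (rel_map X A n) (P_rel X A n)"
    "exact_sequence_at C (P_amb X A n) (rel_map X A n) (P_rel X A n) (boundary_map X A n) (P_sub X A (n - 1))"
    "exact_sequence_at C (P_rel X A n) (boundary_map X A n) (P_sub X A (n - 1)) (incl_map X A (n - 1)) (P_amb X A (n - 1))"
    unfolding exact_sequence_at_def Obj_factorization
    using natural_incl natural_rel[OF assms] natural_boundary[OF assms]
      pointed_pair.action_exact_incl_rel[OF pointed_pair_trace k(2)]
      pointed_pair.action_exact_rel_boundary[OF pointed_pair_trace k(2)]
      pointed_pair.action_exact_boundary_incl[OF pointed_pair_trace k(2)]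
    by (simp_all add: incl_map_def rel_map_def boundary_map_def k(1)[unfolded One_nat_def])
qed

text \<open>The first three positions are the cases \<open>k = 0\<close> of the image statements. At
  the last two exactness is formal, because the relative term is a cokernel.\<close>

lemma exact_low:
  shows "exact_sequence_at C (P_sub X A 2) (incl_map X A 2) (P_amb X A 2) (f_map X A) (P_rel X A 2)"
    and "exact_sequence_at C (P_amb X A 2) (f_map X A) (P_rel X A 2) (g_map X A) (P_sub X A 1)"
    and "exact_sequence_at C (P_rel X A 2) (g_map X A) (P_sub X A 1) (incl_map X A 1) (P_amb X A 1)"
    and "exact_sequence_at C (P_sub X A 1) (incl_map X A 1) (P_amb X A 1) (coker_map X A) (P_rel1 X A)"
    and "exact_sequence_at C (P_amb X A 1) (coker_map X A) (P_rel1 X A) (to_zero (P_rel1 X A)) zero_natural_system"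
proof -
  show "exact_sequence_at C (P_sub X A 2) (incl_map X A 2) (P_amb X A 2) (f_map X A) (P_rel X A 2)"
    "exact_sequence_at C (P_amb X A 2) (f_map X A) (P_rel X A 2) (g_map X A) (P_sub X A 1)"
    "exact_sequence_at C (P_rel X A 2) (g_map X A) (P_sub X A 1) (incl_map X A 1) (P_amb X A 1)"
    unfolding exact_sequence_at_def Obj_factorization
    using natural_incl natural_f natural_g pointed_pair.action_exact_incl_orbit[OF pointed_pair_trace]
      pointed_pair.action_exact_orbit_start[OF pointed_pair_trace]
      pointed_pair.action_exact_start_incl[OF pointed_pair_trace]
    by (simp_all add: incl_map_def f_map_def g_map_def)
  show "exact_sequence_at C (P_sub X A 1) (incl_map X A 1) (P_amb X A 1) (coker_map X A) (P_rel1 X A)"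
    unfolding exact_sequence_at_def Obj_factorization
    using natural_incl natural_coker action_exact_cokernel[OF incl_map_mor(1)] by (simp add: coker_map_def)
  show "exact_sequence_at C (P_amb X A 1) (coker_map X A) (P_rel1 X A) (to_zero (P_rel1 X A)) zero_natural_system"
    unfolding exact_sequence_at_def Obj_factorization
    using natural_coker is_natural_transformation_to_zero[OF is_natural_system_P_rel1]
      action_exact_cokernel_zero[OF incl_map_mor(1)] by (simp add: coker_map_def to_zero_def onobj_P(4))
qed

end

theorem theorem4p3p5:
  fixes X A :: "'a dispace"
  assumes "is_dispace X" and "directed_subspace A X"
  shows
    "(\<forall>n\<ge>3.
        exact_sequence_at (trace_category A)
          (P_sub X A n) (incl_map X A n) (P_amb X A n) (rel_map X A n) (P_rel X A n) \<and>
        exact_sequence_at (trace_category A)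
          (P_amb X A n) (rel_map X A n) (P_rel X A n) (boundary_map X A n) (P_sub X A (n - 1)) \<and>
        exact_sequence_at (trace_category A)
          (P_rel X A n) (boundary_map X A n) (P_sub X A (n - 1)) (incl_map X A (n - 1)) (P_amb X A (n - 1))) \<and>
     exact_sequence_at (trace_category A)
       (P_sub X A 2) (incl_map X A 2) (P_amb X A 2) (f_map X A) (P_rel X A 2) \<and>
     exact_sequence_at (trace_category A)
       (P_amb X A 2) (f_map X A) (P_rel X A 2) (g_map X A) (P_sub X A 1) \<and>
     exact_sequence_at (trace_category A)
       (P_rel X A 2) (g_map X A) (P_sub X A 1) (incl_map X A 1) (P_amb X A 1) \<and>
     exact_sequence_at (trace_category A)
       (P_sub X A 1) (incl_map X A 1) (P_amb X A 1) (coker_map X A) (P_rel1 X A) \<and>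
     exact_sequence_at (trace_category A)
       (P_amb X A 1) (coker_map X A) (P_rel1 X A) (to_zero (P_rel1 X A)) zero_natural_system"
proof -
  interpret directed_pair X A
    using assms by unfold_locales (auto simp: directed_subspace_def)
  show ?thesis
    by (intro conjI allI impI exact_higher exact_low)
qed

end
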